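(* Let $\Gamma=N\rtimes_\sigma H$ with $N$ a discrete abelian group and $H$ a finite group of order $\kappa$, and let $$L^*(\Gamma):=\{\mathsf{f}\in\ell^2(\Gamma):\ \widehat{\mathsf{f}}_{h,l}\in L^\infty(\widehat{N})\ \text{for all } h,l\in H\}.$$ The vector space $L^*(\Gamma)$, under the convolution product, the involution $\mathsf{f}^*(\gamma)=\overline{\mathsf{f}(\gamma^{-1})}$, $\gamma\in\Gamma$, and the norm $\|\mathsf{f}\|_{L^*(\Gamma)}=\|\mathbf{F}\|_{\mathcal{M}_\kappa(L^\infty(\widehat{N}))}$, where $\mathbf{F}$ is the transfer matrix of $\mathsf{f}$, becomes a $C^*$-algebra. Besides, the linear map $\mathcal{S}:\mathsf{f}\mapsto\mathbf{F}$ is a $C^*$-isomorphism between $L^*(\Gamma)$ and a $C^*$-subalgebra of $\mathcal{M}_\kappa(L^\infty(\widehat{N}))$, where the transform $\mathcal{S}$ changes the order of the multiplication, i.e., $\mathcal{S}(\mathsf{g}\ast\mathsf{f})=\mathcal{S}(\mathsf{f})\,\mathcal{S}(\mathsf{g})$ for $\mathsf{f},\mathsf{g}\in L^*(\Gamma)$.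
   Context: Setting: $(N,+)$ is a discrete abelian group, $(H,\cdot)$ is a finite group of order $\kappa$, $\sigma:H\to\mathrm{Aut}(N)$ is a homomorphism, and $\Gamma=N\rtimes_\sigma H$ is the set $N\times H$ with product $(n,h)(m,l)=(n+\sigma(h)(m),hl)$. Convolution on $\Gamma$: $(\mathsf{a}\ast\mathsf{f})(\gamma)=\sum_{\eta\in\Gamma}\mathsf{a}(\eta)\mathsf{f}(\eta^{-1}\gamma)$. $\widehat{N}$ is the (compact) dual group of $N$, with Haar measure normalized so that the Fourier transform $\widehat{\mathsf{a}}(\xi)=\sum_{n\in N}\mathsf{a}(n)\langle -n,\xi\rangle$, defined for $\mathsf{a}\in\ell^1(N)$, extends to a unitary operator $\ell^2(N)\to L^2(\widehat{N})$. Transfer matrix: for $\mathsf{f}\in\ell^2(\Gamma)$ and $h,l\in H$ put $\mathsf{f}_{h,l}(n):=\mathsf{f}[(0,l)^{-1}(n,h)]$, $n\in N$. The transfer matrix of $\mathsf{f}$ is $\mathbf{F}(\xi)=[\,\widehat{\mathsf{f}}_{h,l}(\xi)\,]_{h,l\in H}$ (row index $h$, column index $l$). $\mathcal{M}_\kappa(L^\infty(\widehat{N}))$ is the $C^*$-algebra of $\kappa\times\kappa$ matrices with entries in $L^\infty(\widehat{N})$, with pointwise addition and multiplication, involution given by the adjoint matrix, and norm $\|\mathbf{A}\|_{\mathcal{M}_\kappa(L^\infty(\widehat{N}))}=\sup\{\|\mathbf{A}(\cdot)\mathbf{x}(\cdot)\|_{L^2_\kappa(\widehat{N})}:\|\mathbf{x}\|_{L^2_\kappa(\widehat{N})}=1\}$,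 where $L^2_\kappa(\widehat{N})$ is the Hilbert space product of $\kappa$ copies of $L^2(\widehat{N})$. Here "$C^*$-isomorphism" is understood as an isometric linear bijection onto its image that preserves the involution and is multiplicative up to the stated reversal of the order of products. *)

theory Defs
  imports "HOL-Analysis.Analysis"
begin

section \<open>Semidirect products\<close>

text \<open>The abelian group N is the type \<open>'n :: ab_group_add\<close>. The finite group H is a type of class
  \<open>{group_add, finite}\<close>; \<open>group_add\<close> is the class of arbitrary (not necessarily
  commutative) groups, so \<open>h + l\<close>, \<open>- h\<close> and \<open>0\<close> stand for the product, the inverse and the
  identity of H, and the order of H is \<open>CARD('h)\<close>.\<close>

definition automorphism_action :: "('h::group_add \<Rightarrow> 'n::ab_group_add \<Rightarrow> 'n) \<Rightarrow> bool" where
  "automorphism_action \<sigma> \<longleftrightarrow>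
     (\<forall>h. bij (\<sigma> h) \<and> (\<forall>m n. \<sigma> h (m + n) = \<sigma> h m + \<sigma> h n)) \<and>
     (\<forall>h l. \<sigma> (h + l) = \<sigma> h \<circ> \<sigma> l)"

text \<open>The group structure on \<open>'n \<times> 'h\<close> is passed explicitly through \<open>\<sigma>\<close>; the componentwise
  addition that the library puts on product types plays no role.\<close>

definition sd_mult ::
  "('h::group_add \<Rightarrow> 'n::ab_group_add \<Rightarrow> 'n) \<Rightarrow> 'n \<times> 'h \<Rightarrow> 'n \<times> 'h \<Rightarrow> 'n \<times> 'h" where
  "sd_mult \<sigma> \<gamma> \<eta> = (fst \<gamma> + \<sigma> (snd \<gamma>) (fst \<eta>), snd \<gamma> + snd \<eta>)"

definition sd_inv ::
  "('h::group_add \<Rightarrow> 'n::ab_group_add \<Rightarrow> 'n) \<Rightarrow> 'n \<times> 'h \<Rightarrow> 'n \<times> 'h" where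
  "sd_inv \<sigma> \<gamma> = (\<sigma> (- snd \<gamma>) (- fst \<gamma>), - snd \<gamma>)"

lemma automorphism_action_zero:
  assumes "automorphism_action \<sigma>"
  shows "\<sigma> 0 n = n" "\<sigma> h 0 = 0"
proof -
  have "\<sigma> 0 (\<sigma> 0 n) = \<sigma> 0 n" and "inj (\<sigma> 0)"
    using assms unfolding automorphism_action_def by (metis add_0 comp_apply, metis bij_def)
  then show "\<sigma> 0 n = n" by (simp add: inj_eq)
  have "\<sigma> h (0 + 0) = \<sigma> h 0 + \<sigma> h 0"
    using assms unfolding automorphism_action_def by blast
  then show "\<sigma> h 0 = 0" by simp
qed

lemma sd_group:
  assumes "automorphism_action \<sigma>"
  shows "sd_mult \<sigma> (sd_mult \<sigma> a b) c = sd_mult \<sigma> a (sd_mult \<sigma> b c)"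
    and "sd_mult \<sigma> (0, 0) a = a"
    and "sd_mult \<sigma> a (0, 0) = a"
    and "sd_mult \<sigma> (sd_inv \<sigma> a) a = (0, 0)"
    and "sd_mult \<sigma> a (sd_inv \<sigma> a) = (0, 0)"
proof -
  have add: "\<sigma> h (m + n) = \<sigma> h m + \<sigma> h n" and comp: "\<sigma> (h + l) n = \<sigma> h (\<sigma> l n)" for h l m n
    using assms unfolding automorphism_action_def by auto
  note z = automorphism_action_zero[OF assms]
  show "sd_mult \<sigma> (sd_mult \<sigma> a b) c = sd_mult \<sigma> a (sd_mult \<sigma> b c)"
    by (simp add: sd_mult_def add comp add.assoc)
  show "sd_mult \<sigma> (0, 0) a = a" "sd_mult \<sigma> a (0, 0) = a"
    by (simp_all add: sd_mult_def z)
  show "sd_mult \<sigma> (sd_inv \<sigma> a) a = (0, 0)"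
    by (simp add: sd_mult_def sd_inv_def add[symmetric] z)
  show "sd_mult \<sigma> a (sd_inv \<sigma> a) = (0, 0)"
    by (simp add: sd_mult_def sd_inv_def comp[symmetric] z)
qed

definition summable1 :: "('a \<Rightarrow> complex) \<Rightarrow> bool" where
  "summable1 f \<longleftrightarrow> (\<lambda>x. cmod (f x)) summable_on UNIV"

definition summable2 :: "('a \<Rightarrow> complex) \<Rightarrow> bool" where
  "summable2 f \<longleftrightarrow> (\<lambda>x. (cmod (f x))\<^sup>2) summable_on UNIV"

definition l2_norm :: "('a \<Rightarrow> complex) \<Rightarrow> real" where
  "l2_norm f = sqrt (\<Sum>\<^sub>\<infinity>x. (cmod (f x))\<^sup>2)"

text \<open>For two square-summable functions the defining series converges absolutely, so the value 0
  that \<open>infsum\<close> assigns to divergent families does not occur.\<close>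

definition convolution ::
  "('h::group_add \<Rightarrow> 'n::ab_group_add \<Rightarrow> 'n) \<Rightarrow>
   ('n \<times> 'h \<Rightarrow> complex) \<Rightarrow> ('n \<times> 'h \<Rightarrow> complex) \<Rightarrow> 'n \<times> 'h \<Rightarrow> complex" where
  "convolution \<sigma> a f \<gamma> = (\<Sum>\<^sub>\<infinity>\<eta>. a \<eta> * f (sd_mult \<sigma> (sd_inv \<sigma> \<eta>) \<gamma>))"

definition group_star ::
  "('h::group_add \<Rightarrow> 'n::ab_group_add \<Rightarrow> 'n) \<Rightarrow> ('n \<times> 'h \<Rightarrow> complex) \<Rightarrow> 'n \<times> 'h \<Rightarrow> complex" where
  "group_star \<sigma> f \<gamma> = cnj (f (sd_inv \<sigma> \<gamma>))"

section \<open>The dual group and its Haar measure\<close>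

definition dual_group :: "('n::ab_group_add \<Rightarrow> complex) set" where
  "dual_group = {\<xi>. (\<forall>n. cmod (\<xi> n) = 1) \<and> (\<forall>m n. \<xi> (m + n) = \<xi> m * \<xi> n)}"

text \<open>As N is discrete, the compact-open topology on the dual group is the topology of pointwise
  convergence, that is, the subspace topology inherited from the product topology on
  \<open>'n \<Rightarrow> complex\<close>. For uncountable N the Borel sigma-algebra is larger than the product
  sigma-algebra, and regularity is a genuine part of the definition of a Haar measure. The
  normalization that makes the Fourier transform unitary is total mass 1, since the transform of
  the indicator function of \<open>{0}\<close> is the constant 1.\<close>

definition normalized_haar :: "('n::ab_group_add \<Rightarrow> complex) measure \<Rightarrow> bool" where
  "normalized_haar \<mu> \<longleftrightarrow>
     sets \<mu> = sets (restrict_space borel dual_group) \<and>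
     emeasure \<mu> (space \<mu>) = 1 \<and>
     (\<forall>\<zeta>\<in>dual_group. \<forall>A\<in>sets \<mu>. emeasure \<mu> ((\<lambda>\<xi> n. \<zeta> n * \<xi> n) ` A) = emeasure \<mu> A) \<and>
     (\<forall>A\<in>sets \<mu>. emeasure \<mu> A =
        (INF U\<in>{U. openin (top_of_set dual_group) U \<and> A \<subseteq> U}. emeasure \<mu> U)) \<and>
     (\<forall>U. openin (top_of_set dual_group) U \<longrightarrow>
        emeasure \<mu> U = (SUP K\<in>{K. compact K \<and> K \<subseteq> U}. emeasure \<mu> K))"

section \<open>Lebesgue spaces and the Fourier transform\<close>

text \<open>Elements of \<open>L\<^sup>2\<close> and \<open>L\<^sup>\<infinity>\<close> are sets of measurable functions: the classes with respect to
  equality almost everywhere.\<close>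

definition ae_class :: "'x measure \<Rightarrow> ('x \<Rightarrow> complex) \<Rightarrow> ('x \<Rightarrow> complex) set" where
  "ae_class \<mu> g = {g' \<in> borel_measurable \<mu>. AE \<xi> in \<mu>. g' \<xi> = g \<xi>}"

definition representative :: "('x \<Rightarrow> complex) set \<Rightarrow> 'x \<Rightarrow> complex" where
  "representative c = (SOME g. g \<in> c)"

definition square_integrable :: "'x measure \<Rightarrow> ('x \<Rightarrow> complex) \<Rightarrow> bool" where
  "square_integrable \<mu> g \<longleftrightarrow>
     g \<in> borel_measurable \<mu> \<and> integrable \<mu> (\<lambda>\<xi>. (cmod (g \<xi>))\<^sup>2)"

definition L2_norm :: "'x measure \<Rightarrow> ('x \<Rightarrow> complex) \<Rightarrow> real" where
  "L2_norm \<mu> g = sqrt (\<integral>\<xi>. (cmod (g \<xi>))\<^sup>2 \<partial>\<mu>)"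

definition L_infinity :: "'x measure \<Rightarrow> ('x \<Rightarrow> complex) set set" where
  "L_infinity \<mu> =
     {ae_class \<mu> g | g. g \<in> borel_measurable \<mu> \<and> (\<exists>C. AE \<xi> in \<mu>. cmod (g \<xi>) \<le> C)}"

text \<open>The pairing of \<open>n\<close> with a character \<open>\<xi>\<close> is \<open>\<xi> n\<close>.\<close>

definition fourier_l1 :: "('n::ab_group_add \<Rightarrow> complex) \<Rightarrow> ('n \<Rightarrow> complex) \<Rightarrow> complex" where
  "fourier_l1 a \<xi> = (\<Sum>\<^sub>\<infinity>n. a n * \<xi> (- n))"

text \<open>The extension by continuity of the transform from \<open>l\<^sup>1\<close> to \<open>l\<^sup>2\<close>: the transform of \<open>f\<close> is the
  limit in \<open>L\<^sup>2\<close> of the transforms of summable functions \<open>a\<close> as \<open>a\<close> tends to \<open>f\<close> in \<open>l\<^sup>2\<close>. Two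
  square-integrable functions are both such limits exactly when they agree almost everywhere, so
  the set below is an element of \<open>L\<^sup>2\<close> in the sense of classes.\<close>

definition fourier ::
  "('n::ab_group_add \<Rightarrow> complex) measure \<Rightarrow> ('n \<Rightarrow> complex) \<Rightarrow> (('n \<Rightarrow> complex) \<Rightarrow> complex) set" where
  "fourier \<mu> f = {g. square_integrable \<mu> g \<and>
     (\<forall>\<epsilon>>0. \<exists>\<delta>>0. \<forall>a. summable1 a \<and> l2_norm (\<lambda>n. a n - f n) < \<delta> \<longrightarrow>
        L2_norm \<mu> (\<lambda>\<xi>. fourier_l1 a \<xi> - g \<xi>) < \<epsilon>)}"

section \<open>C*-algebras\<close>

record 'a star_algebra =
  acarrier :: "'a set"
  azero :: 'a
  aadd :: "'a \<Rightarrow> 'a \<Rightarrow> 'a"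
  ascale :: "complex \<Rightarrow> 'a \<Rightarrow> 'a"
  amult :: "'a \<Rightarrow> 'a \<Rightarrow> 'a"
  astar :: "'a \<Rightarrow> 'a"
  anorm :: "'a \<Rightarrow> real"

definition adist :: "'a star_algebra \<Rightarrow> 'a \<Rightarrow> 'a \<Rightarrow> real" where
  "adist A x y = anorm A (aadd A x (ascale A (- 1) y))"

text \<open>C*-algebras are not required to be unital.\<close>

locale cstar_algebra =
  fixes A :: "'a star_algebra"
  assumes zero_closed: "azero A \<in> acarrier A"
    and add_closed: "\<lbrakk>x \<in> acarrier A; y \<in> acarrier A\<rbrakk> \<Longrightarrow> aadd A x y \<in> acarrier A"
    and scale_closed: "x \<in> acarrier A \<Longrightarrow> ascale A c x \<in> acarrier A"
    and mult_closed: "\<lbrakk>x \<in> acarrier A; y \<in> acarrier A\<rbrakk> \<Longrightarrow> amult A x y \<in> acarrier A"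
    and star_closed: "x \<in> acarrier A \<Longrightarrow> astar A x \<in> acarrier A"
    and add_assoc: "\<lbrakk>x \<in> acarrier A; y \<in> acarrier A; z \<in> acarrier A\<rbrakk>
          \<Longrightarrow> aadd A (aadd A x y) z = aadd A x (aadd A y z)"
    and add_commute: "\<lbrakk>x \<in> acarrier A; y \<in> acarrier A\<rbrakk> \<Longrightarrow> aadd A x y = aadd A y x"
    and add_zero: "x \<in> acarrier A \<Longrightarrow> aadd A x (azero A) = x"
    and add_inverse: "x \<in> acarrier A \<Longrightarrow> aadd A x (ascale A (- 1) x) = azero A"
    and scale_add_right: "\<lbrakk>x \<in> acarrier A; y \<in> acarrier A\<rbrakk>
          \<Longrightarrow> ascale A c (aadd A x y) = aadd A (ascale A c x) (ascale A c y)"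
    and scale_add_left: "x \<in> acarrier A
          \<Longrightarrow> ascale A (c + d) x = aadd A (ascale A c x) (ascale A d x)"
    and scale_scale: "x \<in> acarrier A \<Longrightarrow> ascale A c (ascale A d x) = ascale A (c * d) x"
    and scale_one: "x \<in> acarrier A \<Longrightarrow> ascale A 1 x = x"
    and mult_assoc: "\<lbrakk>x \<in> acarrier A; y \<in> acarrier A; z \<in> acarrier A\<rbrakk>
          \<Longrightarrow> amult A (amult A x y) z = amult A x (amult A y z)"
    and mult_add_right: "\<lbrakk>x \<in> acarrier A; y \<in> acarrier A; z \<in> acarrier A\<rbrakk>
          \<Longrightarrow> amult A x (aadd A y z) = aadd A (amult A x y) (amult A x z)"
    and mult_add_left: "\<lbrakk>x \<in> acarrier A; y \<in> acarrier A; z \<in> acarrier A\<rbrakk>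
          \<Longrightarrow> amult A (aadd A x y) z = aadd A (amult A x z) (amult A y z)"
    and mult_scale_left: "\<lbrakk>x \<in> acarrier A; y \<in> acarrier A\<rbrakk>
          \<Longrightarrow> amult A (ascale A c x) y = ascale A c (amult A x y)"
    and mult_scale_right: "\<lbrakk>x \<in> acarrier A; y \<in> acarrier A\<rbrakk>
          \<Longrightarrow> amult A x (ascale A c y) = ascale A c (amult A x y)"
    and star_star: "x \<in> acarrier A \<Longrightarrow> astar A (astar A x) = x"
    and star_add: "\<lbrakk>x \<in> acarrier A; y \<in> acarrier A\<rbrakk>
          \<Longrightarrow> astar A (aadd A x y) = aadd A (astar A x) (astar A y)"
    and star_scale: "x \<in> acarrier A \<Longrightarrow> astar A (ascale A c x) = ascale A (cnj c) (astar A x)"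
    and star_mult: "\<lbrakk>x \<in> acarrier A; y \<in> acarrier A\<rbrakk>
          \<Longrightarrow> astar A (amult A x y) = amult A (astar A y) (astar A x)"
    and norm_nonneg: "x \<in> acarrier A \<Longrightarrow> 0 \<le> anorm A x"
    and norm_eq_zero: "x \<in> acarrier A \<Longrightarrow> anorm A x = 0 \<longleftrightarrow> x = azero A"
    and norm_scale: "x \<in> acarrier A \<Longrightarrow> anorm A (ascale A c x) = cmod c * anorm A x"
    and norm_triangle: "\<lbrakk>x \<in> acarrier A; y \<in> acarrier A\<rbrakk>
          \<Longrightarrow> anorm A (aadd A x y) \<le> anorm A x + anorm A y"
    and norm_mult: "\<lbrakk>x \<in> acarrier A; y \<in> acarrier A\<rbrakk>
          \<Longrightarrow> anorm A (amult A x y) \<le> anorm A x * anorm A y"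
    and cstar_identity: "x \<in> acarrier A \<Longrightarrow> anorm A (amult A (astar A x) x) = (anorm A x)\<^sup>2"
    and complete: "\<lbrakk>\<And>k. X k \<in> acarrier A;
          \<forall>\<epsilon>>0. \<exists>K. \<forall>j\<ge>K. \<forall>k\<ge>K. adist A (X j) (X k) < \<epsilon>\<rbrakk>
          \<Longrightarrow> \<exists>x\<in>acarrier A. (\<lambda>k. adist A (X k) x) \<longlonglongrightarrow> 0"

definition cstar_subalgebra :: "'a set \<Rightarrow> 'a star_algebra \<Rightarrow> bool" where
  "cstar_subalgebra B A \<longleftrightarrow>
     cstar_algebra A \<and> B \<subseteq> acarrier A \<and> azero A \<in> B \<and>
     (\<forall>x\<in>B. \<forall>y\<in>B. aadd A x y \<in> B \<and> amult A x y \<in> B) \<and>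
     (\<forall>x\<in>B. astar A x \<in> B \<and> (\<forall>c. ascale A c x \<in> B)) \<and>
     (\<forall>X. \<forall>x\<in>acarrier A. (\<forall>k. X k \<in> B) \<and> (\<lambda>k. adist A (X k) x) \<longlonglongrightarrow> 0 \<longrightarrow> x \<in> B)"

definition reversing_cstar_isomorphism ::
  "'a star_algebra \<Rightarrow> 'b star_algebra \<Rightarrow> ('a \<Rightarrow> 'b) \<Rightarrow> bool" where
  "reversing_cstar_isomorphism A B S \<longleftrightarrow>
     bij_betw S (acarrier A) (acarrier B) \<and>
     (\<forall>x\<in>acarrier A. \<forall>y\<in>acarrier A. S (aadd A x y) = aadd B (S x) (S y)) \<and>
     (\<forall>c. \<forall>x\<in>acarrier A. S (ascale A c x) = ascale B c (S x)) \<and>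
     (\<forall>x\<in>acarrier A. S (astar A x) = astar B (S x)) \<and>
     (\<forall>x\<in>acarrier A. anorm B (S x) = anorm A x) \<and>
     (\<forall>x\<in>acarrier A. \<forall>y\<in>acarrier A. S (amult A x y) = amult B (S y) (S x))"

section \<open>Matrices over \<open>L\<^sup>\<infinity>\<close>\<close>

text \<open>A matrix with entries in \<open>L\<^sup>\<infinity>\<close> is a matrix of classes. The operations and the norm are defined
  pointwise on representatives and do not depend on their choice.\<close>

definition mat_rep :: "('x \<Rightarrow> complex) set^'h^'h \<Rightarrow> 'x \<Rightarrow> complex^'h^'h" where
  "mat_rep A \<xi> = (\<chi> h l. representative (A $ h $ l) \<xi>)"

definition mat_class :: "'x measure \<Rightarrow> ('x \<Rightarrow> complex^'h^'h) \<Rightarrow> ('x \<Rightarrow> complex) set^'h^'h" where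
  "mat_class \<mu> F = (\<chi> h l. ae_class \<mu> (\<lambda>\<xi>. F \<xi> $ h $ l))"

text \<open>The norm of the Hilbert space product of \<open>CARD('h)\<close> copies of \<open>L\<^sup>2\<close>.\<close>

definition L2_vec_norm :: "'x measure \<Rightarrow> ('x \<Rightarrow> complex^'h) \<Rightarrow> real" where
  "L2_vec_norm \<mu> x = sqrt (\<Sum>h\<in>UNIV. (L2_norm \<mu> (\<lambda>\<xi>. x \<xi> $ h))\<^sup>2)"

definition mat_norm :: "'x measure \<Rightarrow> ('x \<Rightarrow> complex) set^'h^'h \<Rightarrow> real" where
  "mat_norm \<mu> A = Sup {L2_vec_norm \<mu> (\<lambda>\<xi>. mat_rep A \<xi> *v x \<xi>) | x.
     (\<forall>h. square_integrable \<mu> (\<lambda>\<xi>. x \<xi> $ h)) \<and> L2_vec_norm \<mu> x = 1}"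

definition matrix_algebra :: "'x measure \<Rightarrow> (('x \<Rightarrow> complex) set^'h^'h) star_algebra" where
  "matrix_algebra \<mu> = \<lparr>
     acarrier = {A. \<forall>h l. A $ h $ l \<in> L_infinity \<mu>},
     azero = mat_class \<mu> (\<lambda>\<xi>. 0),
     aadd = (\<lambda>A B. mat_class \<mu> (\<lambda>\<xi>. mat_rep A \<xi> + mat_rep B \<xi>)),
     ascale = (\<lambda>c A. mat_class \<mu> (\<lambda>\<xi>. \<chi> h l. c * mat_rep A \<xi> $ h $ l)),
     amult = (\<lambda>A B. mat_class \<mu> (\<lambda>\<xi>. mat_rep A \<xi> ** mat_rep B \<xi>)),
     astar = (\<lambda>A. mat_class \<mu> (\<lambda>\<xi>. \<chi> h l. cnj (mat_rep A \<xi> $ l $ h))),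
     anorm = mat_norm \<mu>\<rparr>"

section \<open>The transfer matrix and the algebra \<open>L\<^sup>*(\<Gamma>)\<close>\<close>

definition component ::
  "('h::group_add \<Rightarrow> 'n::ab_group_add \<Rightarrow> 'n) \<Rightarrow> ('n \<times> 'h \<Rightarrow> complex) \<Rightarrow> 'h \<Rightarrow> 'h \<Rightarrow> 'n \<Rightarrow> complex" where
  "component \<sigma> f h l n = f (sd_mult \<sigma> (sd_inv \<sigma> (0, l)) (n, h))"

definition transfer_matrix ::
  "('h \<Rightarrow> 'n::ab_group_add \<Rightarrow> 'n) \<Rightarrow> ('n \<Rightarrow> complex) measure \<Rightarrow>
   ('n \<times> 'h \<Rightarrow> complex) \<Rightarrow> (('n \<Rightarrow> complex) \<Rightarrow> complex) set^('h::{group_add,finite})^('h::{group_add,finite})" where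
  "transfer_matrix \<sigma> \<mu> f = (\<chi> h l. fourier \<mu> (component \<sigma> f h l))"

definition L_star ::
  "('h::{group_add,finite} \<Rightarrow> 'n::ab_group_add \<Rightarrow> 'n) \<Rightarrow> ('n \<Rightarrow> complex) measure \<Rightarrow>
   ('n \<times> 'h \<Rightarrow> complex) star_algebra" where
  "L_star \<sigma> \<mu> = \<lparr>
     acarrier = {f. summable2 f \<and> (\<forall>h l. fourier \<mu> (component \<sigma> f h l) \<in> L_infinity \<mu>)},
     azero = (\<lambda>\<gamma>. 0),
     aadd = (\<lambda>f g \<gamma>. f \<gamma> + g \<gamma>),
     ascale = (\<lambda>c f \<gamma>. c * f \<gamma>),
     amult = convolution \<sigma>,
     astar = group_star \<sigma>,
     anorm = (\<lambda>f. mat_norm \<mu> (transfer_matrix \<sigma> \<mu> f))\<rparr>"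

end

theory Submission
  imports Defs "HOL-Probability.Probability_Measure"
begin

text \<open>Since characters separate the points of N, invariance makes them orthonormal for the Haar
  measure, so a function in their closed linear span is determined by its Fourier coefficients,
  which are the entries of the corresponding element of \<open>l\<^sup>2\<close>. The product of two bounded functions
  in the span stays in the span and its coefficients are the convolution of theirs; hence
  convolution on the semidirect product becomes multiplication of transfer matrices. The norm of
  \<open>M(L\<^sup>\<infinity>)\<close> dominates the \<open>L\<^sup>2\<close> norm of every entry, so the entries of a limit of transfer
  matrices are again in the span and their coefficients are the limits of coefficients: the image
  is closed. All C*-axioms are then pulled back from the matrix algebra along the transfer matrix.\<close>

section \<open>Characters of discrete abelian groups separate points\<close>

text \<open>Separation of points comes from divisibility of the unit circle: a character of the
  cyclic subgroup generated by one element is extended one element at a time, and Zorn's lemma makes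
  it total. Another obstacle is that \<open>fourier\<close> is a set of functions described by a
  limit over summable functions; \<open>fourier_iff\<close> trades it for membership in the closed
  span together with an equation between coefficients. From then on genuine functions are handled:
  \<open>is_transfer F f\<close> relates a bounded matrix function to \<open>f\<close>, and classes
  modulo null sets enter only through \<open>mat_class\<close>. Closedness of the image takes more
  than convergence of coefficients, since the limit must again be a transfer matrix: by
  \<open>component_eq\<close> the entry with indices \<open>h\<close>, \<open>l\<close> at
  \<open>n\<close> repeats the entry with indices \<open>- l + h\<close>, \<open>0\<close> at
  \<open>\<sigma> (- l) n\<close>, and such relations between coefficients survive limits. The
  reversed order of products comes from the left translations by \<open>(0, l)\<close> in the
  components: convolving \<open>g\<close> with \<open>f\<close> sums the products of
  \<open>F $ h $ k\<close> and \<open>G $ k $ l\<close> over \<open>k\<close>.\<close>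

primrec nat_mult :: "nat \<Rightarrow> 'a::monoid_add \<Rightarrow> 'a" where
  "nat_mult 0 x = 0"
| "nat_mult (Suc k) x = x + nat_mult k x"

lemma nat_mult_add: "nat_mult (j + k) x = nat_mult j x + nat_mult k x"
  by (induction j) (simp_all add: add.assoc)

lemma nat_mult_mult: "nat_mult (j * k) x = nat_mult j (nat_mult k x)"
  by (induction j) (simp_all add: nat_mult_add)

text \<open>A partial character is a character of a subgroup, given by its graph.\<close>

definition partial_character :: "('n::ab_group_add \<times> complex) set \<Rightarrow> bool" where
  "partial_character M \<longleftrightarrow> (0, 1) \<in> M \<and> (\<forall>m c. (m, c) \<in> M \<longrightarrow> cmod c = 1) \<and>
     (\<forall>c. (0, c) \<in> M \<longrightarrow> c = 1) \<and>
     (\<forall>m c m' c'. (m, c) \<in> M \<longrightarrow> (m', c') \<in> M \<longrightarrow> (m - m', c / c') \<in> M)"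

text \<open>Closure under differences and quotients yields the other closure properties: subtracting
  from \<open>0\<close> gives inverses, subtracting an inverse gives sums, and two values at the
  same point have as quotient a value at \<open>0\<close>, which is 1.\<close>

lemma partial_characterD:
  assumes "partial_character M"
  shows partial_character_zero: "(0, 1) \<in> M"
    and partial_character_norm: "(m, c) \<in> M \<Longrightarrow> cmod c = 1"
    and partial_character_unit: "(0, c) \<in> M \<Longrightarrow> c = 1"
    and partial_character_diff: "(m, c) \<in> M \<Longrightarrow> (m', c') \<in> M \<Longrightarrow> (m - m', c / c') \<in> M"
    and partial_character_minus: "(m, c) \<in> M \<Longrightarrow> (- m, inverse c) \<in> M"
    and partial_character_add: "(m, c) \<in> M \<Longrightarrow> (m', c') \<in> M \<Longrightarrow> (m + m', c * c') \<in> M"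
    and partial_character_unique: "(m, c) \<in> M \<Longrightarrow> (m, c') \<in> M \<Longrightarrow> c = c'"
    and partial_character_nat_mult: "(m, c) \<in> M \<Longrightarrow> (nat_mult k m, c ^ k) \<in> M"
proof -
  show z: "(0, 1) \<in> M" and "(m, c) \<in> M \<Longrightarrow> cmod c = 1" and u: "(0, c) \<in> M \<Longrightarrow> c = 1"
    and d: "(m, c) \<in> M \<Longrightarrow> (m', c') \<in> M \<Longrightarrow> (m - m', c / c') \<in> M" for m c m' c'
    using assms unfolding partial_character_def by blast+
  show m: "(m, c) \<in> M \<Longrightarrow> (- m, inverse c) \<in> M" for m c
    using d[OF z, of m c] by (simp add: divide_inverse)
  show a: "(m, c) \<in> M \<Longrightarrow> (m', c') \<in> M \<Longrightarrow> (m + m', c * c') \<in> M" for m c m' c'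
    using d[of m c "- m'" "inverse c'"] m[of m' c'] by (simp add: divide_inverse)
  show "(m, c) \<in> M \<Longrightarrow> (m, c') \<in> M \<Longrightarrow> c = c'"
    using u[of "c / c'"] d[of m c m c'] by auto
  show "(m, c) \<in> M \<Longrightarrow> (nat_mult k m, c ^ k) \<in> M"
    by (induction k) (simp_all add: z a)
qed

text \<open>The hypothesis \<open>compat\<close> says that wherever a multiple of \<open>x\<close>
  already lies in the domain, the old value is the matching power of \<open>w\<close>. This is
  exactly what makes the new values on the subgroup generated by the domain and \<open>x\<close>
  well defined.\<close>

lemma partial_character_extend:
  assumes M: "partial_character M" and w: "cmod w = 1"
    and compat: "\<And>k c. (nat_mult k x, c) \<in> M \<Longrightarrow> c = w ^ k"
  shows "\<exists>M'. partial_character M' \<and> M \<subseteq> M' \<and> (x, w) \<in> M'"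
proof -
  \<comment> \<open>Two natural exponents \<open>i\<close> and \<open>j\<close> stand for the
    integer multiple \<open>i - j\<close> of \<open>x\<close>.\<close>
  define M' where
    "M' = {(m + nat_mult i x - nat_mult j x, c * w ^ i / w ^ j) |m c i j. (m, c) \<in> M}"
  have w0: "w \<noteq> 0" using w by auto
  have M'I: "(m + nat_mult i x - nat_mult j x, c * w ^ i / w ^ j) \<in> M'" if "(m, c) \<in> M" for m c i j
    unfolding M'_def using that by blast
  have sub: "M \<subseteq> M'"
    using M'I[where i = 0 and j = 0] by auto
  have xw: "(x, w) \<in> M'"
    using M'I[OF partial_character_zero[OF M], of "Suc 0" 0] by simp
  have "partial_character M'"
    unfolding partial_character_def
  proof (intro conjI allI impI)
    show "(0, 1) \<in> M'"
      using sub partial_character_zero[OF M] by blast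
    show "cmod c = 1" if "(m, c) \<in> M'" for m c
      using that partial_character_norm[OF M]
      by (auto simp: M'_def norm_mult norm_divide norm_power w)
    show "c = 1" if c: "(0, c) \<in> M'" for c
    proof -
      obtain m c' i j where h: "0 = m + nat_mult i x - nat_mult j x" "c = c' * w ^ i / w ^ j"
        "(m, c') \<in> M"
        using c unfolding M'_def by blast
      \<comment> \<open>The sign of \<open>i - j\<close> decides whether the remaining multiple of
        \<open>x\<close> equals \<open>- m\<close> or \<open>m\<close>, that is, whether
        \<open>compat\<close> is applied to the inverse of \<open>c'\<close> or to
        \<open>c'\<close>.\<close>
      show "c = 1"
      proof (cases "j \<le> i")
        case True
        then obtain k where k: "i = j + k" using le_Suc_ex by blast
        have "nat_mult k x = - m"
          using h(1) by (simp add: k nat_mult_add algebra_simps eq_neg_iff_add_eq_0)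
        then have "inverse c' = w ^ k"
          using compat partial_character_minus[OF M h(3)] by simp
        moreover have "c' \<noteq> 0" using partial_character_norm[OF M h(3)] by auto
        ultimately show ?thesis
          using w0 by (simp add: h(2) k power_add field_simps)
      next
        case False
        then obtain k where k: "j = i + k" using le_Suc_ex nat_le_linear by metis
        have "nat_mult k x = m"
          using h(1) by (simp add: k nat_mult_add algebra_simps)
        then have "c' = w ^ k"
          using compat h(3) by simp
        then show ?thesis
          using w0 by (simp add: h(2) k power_add field_simps)
      qed
    qed
    show "(m - m', c / c') \<in> M'" if a: "(m, c) \<in> M'" and b: "(m', c') \<in> M'" for m c m' c'
    proof -
      obtain n d i j where h: "m = n + nat_mult i x - nat_mult j x" "c = d * w ^ i / w ^ j"
        "(n, d) \<in> M"
        using a unfolding M'_def by blast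
      obtain n' d' i' j' where h': "m' = n' + nat_mult i' x - nat_mult j' x"
        "c' = d' * w ^ i' / w ^ j'" "(n', d') \<in> M"
        using b unfolding M'_def by blast
      have "m - m' = (n - n') + nat_mult (i + j') x - nat_mult (j + i') x"
        by (simp add: h h' nat_mult_add algebra_simps)
      moreover have "c / c' = (d / d') * w ^ (i + j') / w ^ (j + i')"
        by (simp add: h h' power_add divide_simps)
      ultimately show ?thesis
        using M'I[OF partial_character_diff[OF M h(3) h'(3)]] by simp
    qed
  qed
  then show ?thesis using sub xw by blast
qed

text \<open>Divisibility of the circle, which lets a character be continued to an element some
  multiple of which already has a value; the root comes from dividing the argument by
  \<open>d\<close>.\<close>

lemma unit_complex_root:
  assumes "cmod c = 1" "d > 0"
  shows "\<exists>w. cmod w = 1 \<and> w ^ d = c"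
proof (intro exI conjI)
  show "cmod (cis (Arg c / real d)) = 1" by simp
  have "cis (Arg c / real d) ^ d = cis (Arg c)"
    using assms(2) by (simp add: Complex.DeMoivre)
  also have "\<dots> = c"
  proof -
    have "c \<noteq> 0" using assms(1) by auto
    then show ?thesis using cis_Arg[of c] assms(1) by (simp add: sgn_div_norm)
  qed
  finally show "cis (Arg c / real d) ^ d = c" .
qed

text \<open>If no positive multiple of \<open>x\<close> lies in the domain, there is no constraint
  and the value 1 will do. Otherwise let \<open>d\<close> be the least such multiple and give
  \<open>x\<close> a \<open>d\<close>-th root of the prescribed value; division with remainder and
  minimality of \<open>d\<close> show that all other multiples in the domain are multiples of
  \<open>d\<close>.\<close>

lemma partial_character_extend_point:
  assumes M: "partial_character M"
  shows "\<exists>M'. partial_character M' \<and> M \<subseteq> M' \<and> x \<in> Domain M'"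
proof (cases "\<exists>k>0. nat_mult k x \<in> Domain M")
  case False
  have "\<exists>M'. partial_character M' \<and> M \<subseteq> M' \<and> (x, 1) \<in> M'"
  proof (rule partial_character_extend[OF M])
    fix k c assume kc: "(nat_mult k x, c) \<in> M"
    then have "nat_mult k x \<in> Domain M" by (rule DomainI)
    then have "k = 0" using False by auto
    then show "c = 1 ^ k" using kc partial_character_unit[OF M] by simp
  qed simp
  then show ?thesis by blast
next
  case True
  define d where "d = (LEAST k. 0 < k \<and> nat_mult k x \<in> Domain M)"
  have d: "0 < d" "nat_mult d x \<in> Domain M"
    using LeastI_ex[OF True] by (simp_all add: d_def)
  have min: "\<not> (0 < r \<and> nat_mult r x \<in> Domain M)" if "r < d" for r
    using not_less_Least[of r "\<lambda>k. 0 < k \<and> nat_mult k x \<in> Domain M"] that by (simp add: d_def)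
  obtain c0 where c0: "(nat_mult d x, c0) \<in> M" using d by blast
  obtain w where w: "cmod w = 1" "w ^ d = c0"
    using unit_complex_root[OF partial_character_norm[OF M c0] d(1)] by blast
  have "\<exists>M'. partial_character M' \<and> M \<subseteq> M' \<and> (x, w) \<in> M'"
  proof (rule partial_character_extend[OF M w(1)])
    fix k c assume kc: "(nat_mult k x, c) \<in> M"
    define q where "q = k div d"
    define r where "r = k mod d"
    have k: "k = r + q * d" by (simp add: q_def r_def)
    have q: "(nat_mult (q * d) x, c0 ^ q) \<in> M"
      using partial_character_nat_mult[OF M c0] by (simp add: nat_mult_mult)
    have "nat_mult k x - nat_mult (q * d) x = nat_mult r x"
      by (simp add: k nat_mult_add)
    then have "nat_mult r x \<in> Domain M"
      using partial_character_diff[OF M kc q] by (metis DomainI)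
    then have "r = 0" using min[of r] d(1) by (auto simp: r_def)
    then have "c = c0 ^ q"
      using partial_character_unique[OF M kc] q k by simp
    then show "c = w ^ k"
      using \<open>r = 0\<close> by (simp only: w(2)[symmetric] k power_mult[symmetric] mult.commute add_0)
  qed
  then show ?thesis by blast
qed

lemma partial_character_Union:
  assumes "C \<noteq> {}" and "\<And>M. M \<in> C \<Longrightarrow> partial_character M"
    and chain: "\<And>M M'. M \<in> C \<Longrightarrow> M' \<in> C \<Longrightarrow> M \<subseteq> M' \<or> M' \<subseteq> M"
  shows "partial_character (\<Union>C)"
  unfolding partial_character_def
proof (intro conjI allI impI)
  show "(0, 1) \<in> \<Union>C"
    using assms(1,2) partial_character_zero by blast
  show "cmod c = 1" if "(m, c) \<in> \<Union>C" for m c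
    using that assms(2) partial_character_norm by blast
  show "c = 1" if "(0, c) \<in> \<Union>C" for c
    using that assms(2) partial_character_unit by blast
  show "(m - m', c / c') \<in> \<Union>C" if a: "(m, c) \<in> \<Union>C" and b: "(m', c') \<in> \<Union>C" for m c m' c'
  proof -
    obtain M M' where M: "M \<in> C" "(m, c) \<in> M" "M' \<in> C" "(m', c') \<in> M'" using a b by blast
    then obtain K where "K \<in> C" "(m, c) \<in> K" "(m', c') \<in> K" using chain[of M M'] by blast
    then show ?thesis using assms(2) partial_character_diff by blast
  qed
qed

text \<open>A maximal extension must be total, because \<open>partial_character_extend_point\<close>
  would enlarge it at any missing point.\<close>

lemma partial_character_extends_to_character:
  assumes M: "partial_character M"
  shows "\<exists>\<zeta>\<in>dual_group. \<forall>(m, c)\<in>M. \<zeta> m = c"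
proof -
  define P where "P = {K. partial_character K \<and> M \<subseteq> K}"
  have "\<exists>K\<in>P. \<forall>X\<in>P. K \<subseteq> X \<longrightarrow> X = K"
  proof (rule subset_Zorn_nonempty)
    show "P \<noteq> {}" using M by (auto simp: P_def)
    show "\<Union>C \<in> P" if C: "C \<noteq> {}" "subset.chain P C" for C
    proof -
      have "partial_character (\<Union>C)"
      proof (rule partial_character_Union)
        show "M \<subseteq> M' \<or> M' \<subseteq> M" if "M \<in> C" "M' \<in> C" for M M'
          using C(2) that unfolding subset.chain_def by blast
      qed (use C in \<open>auto simp: P_def subset.chain_def\<close>)
      moreover have "M \<subseteq> \<Union>C" using C unfolding P_def subset.chain_def by blast
      ultimately show ?thesis by (simp add: P_def)
    qed
  qed
  then obtain K where KP: "K \<in> P" "\<forall>X\<in>P. K \<subseteq> X \<longrightarrow> X = K" by (rule bexE)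
  then have K: "partial_character K" "M \<subseteq> K" by (simp_all add: P_def)
  have max: "X = K" if "partial_character X" "K \<subseteq> X" for X
    using KP(2) that K(2) by (simp add: P_def subset_trans)
  have total: "\<exists>c. (x, c) \<in> K" for x
  proof -
    obtain X where X: "partial_character X" "K \<subseteq> X" "x \<in> Domain X"
      using partial_character_extend_point[OF K(1), of x] by auto
    then show ?thesis using max[OF X(1,2)] by auto
  qed
  define \<zeta> where "\<zeta> x = (SOME c. (x, c) \<in> K)" for x
  have \<zeta>: "(x, \<zeta> x) \<in> K" for x
    unfolding \<zeta>_def using total[of x] by (rule someI_ex)
  have eq: "\<zeta> x = c" if "(x, c) \<in> K" for x c
    using partial_character_unique[OF K(1) \<zeta> that] .
  have "\<zeta> \<in> dual_group"
    unfolding dual_group_def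
    using partial_character_norm[OF K(1) \<zeta>] eq[OF partial_character_add[OF K(1) \<zeta> \<zeta>]] by simp
  then show ?thesis using eq K(2) by (intro bexI[of _ \<zeta>]) auto
qed

text \<open>It is enough to find a character of the cyclic subgroup generated by \<open>n\<close>
  that is not 1 at \<open>n\<close>: the value is -1 if \<open>n\<close> has infinite order, and
  \<open>cis (2 * pi / d)\<close> if it has order \<open>d\<close>.\<close>

lemma characters_separate_points:
  assumes n: "n \<noteq> 0"
  shows "\<exists>\<zeta>\<in>dual_group. \<zeta> n \<noteq> 1"
proof -
  have triv: "partial_character {(0::'a, 1)}"
    by (simp add: partial_character_def)
  have "\<exists>w. cmod w = 1 \<and> w \<noteq> 1 \<and> (\<forall>k. nat_mult k n = 0 \<longrightarrow> w ^ k = 1)"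
  proof (cases "\<exists>k>0. nat_mult k n = 0")
    case False
    then have k0: "k = 0" if "nat_mult k n = 0" for k using that by auto
    have "(-1::complex) ^ k = 1" if "nat_mult k n = 0" for k using k0[OF that] by simp
    then show ?thesis
      by (intro exI[of _ "-1"]) auto
  next
    case True
    define d where "d = (LEAST k. 0 < k \<and> nat_mult k n = 0)"
    have d: "0 < d" "nat_mult d n = 0"
      using LeastI_ex[OF True] by (simp_all add: d_def)
    have min: "\<not> (0 < r \<and> nat_mult r n = 0)" if "r < d" for r
      using not_less_Least[of r "\<lambda>k. 0 < k \<and> nat_mult k n = 0"] that by (simp add: d_def)
    \<comment> \<open>Order 1 would mean \<open>n = 0\<close>; from \<open>d \<ge> 2\<close> the
      root of unity below differs from 1.\<close>
    have "d \<noteq> 1" using d(2) n by auto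
    then have d2: "2 \<le> d" using d(1) by linarith
    define w where "w = cis (2 * pi / real d)"
    have wd: "w ^ d = 1"
      using d(1) by (simp add: w_def Complex.DeMoivre)
    have "w \<noteq> 1"
    proof
      assume "w = 1"
      then have "cos (2 * pi / real d) = 1" by (simp add: w_def complex_eq_iff)
      \<comment> \<open>The angle lies in the interval from 0 to \<open>pi\<close>, where the cosine
        is strictly decreasing.\<close>
      moreover have "cos (2 * pi / real d) < cos 0"
        using d2 by (intro cos_monotone_0_pi) (auto simp: divide_simps)
      ultimately show False by simp
    qed
    moreover have "w ^ k = 1" if k0: "nat_mult k n = 0" for k
    proof -
      have z: "nat_mult j (0::'a) = 0" for j by (induction j) simp_all
      have "nat_mult (k mod d + (k div d) * d) n = 0" using k0 by simp
      then have "nat_mult (k mod d) n = 0"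
        by (simp only: nat_mult_add nat_mult_mult d(2) z add_0_right)
      then have "k mod d = 0" using min[of "k mod d"] d(1) by auto
      then have "k = d * (k div d)" by auto
      then show ?thesis using wd by (metis power_mult power_one)
    qed
    ultimately show ?thesis by (intro exI[of _ w]) (auto simp: w_def)
  qed
  then obtain w where w: "cmod w = 1" "w \<noteq> 1" "\<And>k. nat_mult k n = 0 \<Longrightarrow> w ^ k = 1" by blast
  have "\<exists>M'. partial_character M' \<and> {(0, 1)} \<subseteq> M' \<and> (n, w) \<in> M'"
    using w by (intro partial_character_extend[OF triv]) auto
  then obtain M' where M': "partial_character M'" "(n, w) \<in> M'" by blast
  then obtain \<zeta> where "\<zeta> \<in> dual_group" "\<zeta> n = w"
    using partial_character_extends_to_character[OF M'(1)] by auto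
  then show ?thesis using w(2) by auto
qed

section \<open>Square-integrable functions\<close>

text \<open>Values in a Euclidean space let one theory serve both scalar functions and the column
  vectors on which matrices act. For complex values it agrees with \<open>square_integrable\<close>
  and \<open>L2_norm\<close>.\<close>

definition L2_fun :: "'x measure \<Rightarrow> ('x \<Rightarrow> 'b::euclidean_space) \<Rightarrow> bool" where
  "L2_fun \<mu> f \<longleftrightarrow> f \<in> borel_measurable \<mu> \<and> integrable \<mu> (\<lambda>\<xi>. (norm (f \<xi>))\<^sup>2)"

definition L2n :: "'x measure \<Rightarrow> ('x \<Rightarrow> 'b::euclidean_space) \<Rightarrow> real" where
  "L2n \<mu> f = sqrt (\<integral>\<xi>. (norm (f \<xi>))\<^sup>2 \<partial>\<mu>)"

section \<open>Domination and the inequalities of Cauchy-Schwarz and Minkowski\<close>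

lemma square_integrable_eq_L2_fun: "square_integrable = L2_fun"
  by (intro ext) (simp add: square_integrable_def L2_fun_def)

lemma L2_norm_eq_L2n: "L2_norm = L2n"
  by (intro ext) (simp add: L2_norm_def L2n_def)

lemma L2_fun_measurable: "L2_fun \<mu> f \<Longrightarrow> f \<in> borel_measurable \<mu>"
  by (simp add: L2_fun_def)

lemma L2n_nonneg [simp]: "0 \<le> L2n \<mu> f"
  by (simp add: L2n_def)

lemma L2n_power2: "(L2n \<mu> f)\<^sup>2 = (\<integral>\<xi>. (norm (f \<xi>))\<^sup>2 \<partial>\<mu>)"
  by (simp add: L2n_def)

lemma L2n_cong_AE:
  assumes "f \<in> borel_measurable \<mu>" "g \<in> borel_measurable \<mu>" "AE \<xi> in \<mu>. f \<xi> = g \<xi>"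
  shows "L2n \<mu> f = L2n \<mu> g"
proof -
  have "(\<integral>\<xi>. (norm (f \<xi>))\<^sup>2 \<partial>\<mu>) = (\<integral>\<xi>. (norm (g \<xi>))\<^sup>2 \<partial>\<mu>)"
    using assms by (intro integral_cong_AE) auto
  then show ?thesis by (simp add: L2n_def)
qed

text \<open>A single pointwise comparison yields both membership and the norm estimate;
  multiplication by bounded functions, by characters and by bounded matrices all reduce to
  it.\<close>

lemma L2_fun_dominated:
  assumes f: "L2_fun \<mu> f" and g: "g \<in> borel_measurable \<mu>"
    and le: "AE \<xi> in \<mu>. norm (g \<xi>) \<le> C * norm (f \<xi>)" and C: "0 \<le> C"
  shows "L2_fun \<mu> g" "L2n \<mu> g \<le> C * L2n \<mu> f"
proof -
  have le2: "AE \<xi> in \<mu>. (norm (g \<xi>))\<^sup>2 \<le> C\<^sup>2 * (norm (f \<xi>))\<^sup>2"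
    using le by eventually_elim (metis norm_ge_zero power_mono power_mult_distrib)
  have int: "integrable \<mu> (\<lambda>\<xi>. C\<^sup>2 * (norm (f \<xi>))\<^sup>2)"
    using f by (simp add: L2_fun_def)
  have "integrable \<mu> (\<lambda>\<xi>. (norm (g \<xi>))\<^sup>2)"
    using le2 g by (intro Bochner_Integration.integrable_bound[OF int]) auto
  then show g2: "L2_fun \<mu> g" using g by (simp add: L2_fun_def)
  have "(L2n \<mu> g)\<^sup>2 \<le> (\<integral>\<xi>. C\<^sup>2 * (norm (f \<xi>))\<^sup>2 \<partial>\<mu>)"
    unfolding L2n_power2 using g2 le2 by (intro integral_mono_AE int) (auto simp: L2_fun_def)
  also have "\<dots> = (C * L2n \<mu> f)\<^sup>2"
    by (simp add: L2n_power2 power_mult_distrib)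
  finally show "L2n \<mu> g \<le> C * L2n \<mu> f"
    by (rule power2_le_imp_le) (simp add: C)
qed

lemma L2_fun_scaleR:
  assumes "L2_fun \<mu> f"
  shows "L2_fun \<mu> (\<lambda>\<xi>. c *\<^sub>R f \<xi>)"
proof (rule L2_fun_dominated(1)[OF assms])
  show "(\<lambda>\<xi>. c *\<^sub>R f \<xi>) \<in> borel_measurable \<mu>"
    using L2_fun_measurable[OF assms] by measurable
  show "AE \<xi> in \<mu>. norm (c *\<^sub>R f \<xi>) \<le> \<bar>c\<bar> * norm (f \<xi>)" by simp
qed simp

lemma L2n_scaleR: "L2n \<mu> (\<lambda>\<xi>. c *\<^sub>R f \<xi>) = \<bar>c\<bar> * L2n \<mu> f"
  by (simp add: L2n_def power_mult_distrib real_sqrt_mult)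

lemma L2_fun_uminus: "L2_fun \<mu> f \<Longrightarrow> L2_fun \<mu> (\<lambda>\<xi>. - f \<xi>)"
  using L2_fun_scaleR[of \<mu> f "-1"] by simp

lemma L2_fun_integrable_mult:
  assumes f: "L2_fun \<mu> f" and g: "L2_fun \<mu> g"
  shows "integrable \<mu> (\<lambda>\<xi>. norm (f \<xi>) * norm (g \<xi>))"
proof (rule Bochner_Integration.integrable_bound)
  show "integrable \<mu> (\<lambda>\<xi>. (norm (f \<xi>))\<^sup>2 + (norm (g \<xi>))\<^sup>2)"
    using f g by (simp add: L2_fun_def)
  have "f \<in> borel_measurable \<mu>" "g \<in> borel_measurable \<mu>"
    using f g by (simp_all add: L2_fun_def)
  then show "(\<lambda>\<xi>. norm (f \<xi>) * norm (g \<xi>)) \<in> borel_measurable \<mu>"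
    by measurable
  have "a * b \<le> a\<^sup>2 + b\<^sup>2" if "0 \<le> a" "0 \<le> b" for a b :: real
    using sum_squares_bound[of a b] that mult_nonneg_nonneg[OF that] by linarith
  then show "AE \<xi> in \<mu>. norm (norm (f \<xi>) * norm (g \<xi>)) \<le> norm ((norm (f \<xi>))\<^sup>2 + (norm (g \<xi>))\<^sup>2)"
    by (auto simp: abs_of_nonneg)
qed

text \<open>The integral of \<open>(t * norm (f \<xi>) - norm (g \<xi>))\<^sup>2\<close> is a
  nonnegative quadratic in \<open>t\<close>, tested at its minimum \<open>t = c / a\<close>. If
  \<open>a = 0\<close>, then \<open>f\<close> vanishes almost everywhere and so does the
  product.\<close>

lemma L2_Cauchy_Schwarz:
  assumes f: "L2_fun \<mu> f" and g: "L2_fun \<mu> g"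
  shows "(\<integral>\<xi>. norm (f \<xi>) * norm (g \<xi>) \<partial>\<mu>) \<le> L2n \<mu> f * L2n \<mu> g"
proof -
  define a b c where "a = (\<integral>\<xi>. (norm (f \<xi>))\<^sup>2 \<partial>\<mu>)" and "b = (\<integral>\<xi>. (norm (g \<xi>))\<^sup>2 \<partial>\<mu>)"
    and "c = (\<integral>\<xi>. norm (f \<xi>) * norm (g \<xi>) \<partial>\<mu>)"
  note [simp] = L2_fun_integrable_mult[OF f g]
  have [simp]: "integrable \<mu> (\<lambda>\<xi>. (norm (f \<xi>))\<^sup>2)" "integrable \<mu> (\<lambda>\<xi>. (norm (g \<xi>))\<^sup>2)"
    using f g by (simp_all add: L2_fun_def)
  have quad: "0 \<le> t\<^sup>2 * a + b - 2 * t * c" for t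
  proof -
    have "0 \<le> (\<integral>\<xi>. (t * norm (f \<xi>) - norm (g \<xi>))\<^sup>2 \<partial>\<mu>)"
      by simp
    also have "(\<lambda>\<xi>. (t * norm (f \<xi>) - norm (g \<xi>))\<^sup>2) =
      (\<lambda>\<xi>. t\<^sup>2 * (norm (f \<xi>))\<^sup>2 + (norm (g \<xi>))\<^sup>2 - (2 * t) * (norm (f \<xi>) * norm (g \<xi>)))"
      by (intro ext) (simp add: power2_eq_square algebra_simps)
    also have "(\<integral>\<xi>. \<dots> \<xi> \<partial>\<mu>) = t\<^sup>2 * a + b - 2 * t * c"
      by (simp add: a_def b_def c_def)
    finally show ?thesis .
  qed
  have ab: "0 \<le> a" "0 \<le> b" "0 \<le> c" by (simp_all add: a_def b_def c_def)
  have "c\<^sup>2 \<le> a * b"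
  proof (cases "a = 0")
    case True
    have "AE \<xi> in \<mu>. (norm (f \<xi>))\<^sup>2 = 0"
      using True by (subst (asm) a_def, subst (asm) integral_nonneg_eq_0_iff_AE) auto
    then have "AE \<xi> in \<mu>. norm (f \<xi>) * norm (g \<xi>) = 0" by eventually_elim simp
    then have "c = 0" unfolding c_def by (rule integral_eq_zero_AE)
    then show ?thesis using ab by simp
  next
    case False
    have "0 \<le> (c / a)\<^sup>2 * a + b - 2 * (c / a) * c" by (rule quad)
    also have "\<dots> = b - c\<^sup>2 / a" using False by (simp add: power2_eq_square field_simps)
    finally show ?thesis using False ab by (simp add: field_simps)
  qed
  then have "sqrt (c\<^sup>2) \<le> sqrt (a * b)" by (rule real_sqrt_le_mono)
  then show ?thesis using ab by (simp add: real_sqrt_mult L2n_def a_def b_def c_def)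
qed

lemma L2_fun_add:
  assumes f: "L2_fun \<mu> f" and g: "L2_fun \<mu> g"
  shows "L2_fun \<mu> (\<lambda>\<xi>. f \<xi> + g \<xi>)" "L2n \<mu> (\<lambda>\<xi>. f \<xi> + g \<xi>) \<le> L2n \<mu> f + L2n \<mu> g"
proof -
  have [simp]: "integrable \<mu> (\<lambda>\<xi>. (norm (f \<xi>))\<^sup>2)" "integrable \<mu> (\<lambda>\<xi>. (norm (g \<xi>))\<^sup>2)"
    using f g by (simp_all add: L2_fun_def)
  note [simp] = L2_fun_integrable_mult[OF f g]
  have eq: "(norm (f \<xi>) + norm (g \<xi>))\<^sup>2 =
    (norm (f \<xi>))\<^sup>2 + 2 * (norm (f \<xi>) * norm (g \<xi>)) + (norm (g \<xi>))\<^sup>2" for \<xi>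
    by (simp add: power2_eq_square algebra_simps)
  have int: "integrable \<mu> (\<lambda>\<xi>. (norm (f \<xi>) + norm (g \<xi>))\<^sup>2)"
    unfolding eq by simp
  have le: "(norm (f \<xi> + g \<xi>))\<^sup>2 \<le> (norm (f \<xi>) + norm (g \<xi>))\<^sup>2" for \<xi>
    by (intro power_mono norm_triangle_ineq) simp
  have "integrable \<mu> (\<lambda>\<xi>. (norm (f \<xi> + g \<xi>))\<^sup>2)"
    using f g le by (intro Bochner_Integration.integrable_bound[OF int]) (auto simp: L2_fun_def)
  then show L2: "L2_fun \<mu> (\<lambda>\<xi>. f \<xi> + g \<xi>)"
    using f g by (simp add: L2_fun_def)
  have "(L2n \<mu> (\<lambda>\<xi>. f \<xi> + g \<xi>))\<^sup>2 \<le> (\<integral>\<xi>. (norm (f \<xi>) + norm (g \<xi>))\<^sup>2 \<partial>\<mu>)"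
    unfolding L2n_power2 using L2 le by (intro integral_mono int) (auto simp: L2_fun_def)
  also have "\<dots> = (L2n \<mu> f)\<^sup>2 + 2 * (\<integral>\<xi>. norm (f \<xi>) * norm (g \<xi>) \<partial>\<mu>) + (L2n \<mu> g)\<^sup>2"
    unfolding eq by (simp add: L2n_power2)
  also have "\<dots> \<le> (L2n \<mu> f + L2n \<mu> g)\<^sup>2"
    using L2_Cauchy_Schwarz[OF f g] by (simp add: power2_eq_square algebra_simps)
  finally show "L2n \<mu> (\<lambda>\<xi>. f \<xi> + g \<xi>) \<le> L2n \<mu> f + L2n \<mu> g"
    by (rule power2_le_imp_le) simp
qed

lemma L2_fun_diff:
  assumes f: "L2_fun \<mu> f" and g: "L2_fun \<mu> g"
  shows "L2_fun \<mu> (\<lambda>\<xi>. f \<xi> - g \<xi>)"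
  using L2_fun_add(1)[OF f L2_fun_uminus[OF g]] by simp

lemma L2n_minus_commute: "L2n \<mu> (\<lambda>\<xi>. f \<xi> - g \<xi>) = L2n \<mu> (\<lambda>\<xi>. g \<xi> - f \<xi>)"
  unfolding L2n_def by (subst norm_minus_commute) (rule refl)

lemma L2n_triangle_diff:
  assumes "L2_fun \<mu> f" "L2_fun \<mu> g" "L2_fun \<mu> h"
  shows "L2n \<mu> (\<lambda>\<xi>. f \<xi> - h \<xi>) \<le> L2n \<mu> (\<lambda>\<xi>. f \<xi> - g \<xi>) + L2n \<mu> (\<lambda>\<xi>. g \<xi> - h \<xi>)"
  using L2_fun_add(2)[OF L2_fun_diff[OF assms(1,2)] L2_fun_diff[OF assms(2,3)]] by simp

lemma L2_fun_zero [simp]: "L2_fun \<mu> (\<lambda>\<xi>. 0)"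
  by (simp add: L2_fun_def)

lemma L2_fun_sum:
  assumes "\<And>i. i \<in> I \<Longrightarrow> L2_fun \<mu> (f i)"
  shows "L2_fun \<mu> (\<lambda>\<xi>. \<Sum>i\<in>I. f i \<xi>)"
  using assms by (induction I rule: infinite_finite_induct) (simp_all add: L2_fun_add(1))

lemma L2n_eq_0_iff:
  assumes "L2_fun \<mu> f"
  shows "L2n \<mu> f = 0 \<longleftrightarrow> (AE \<xi> in \<mu>. f \<xi> = 0)"
proof -
  have "L2n \<mu> f = 0 \<longleftrightarrow> (\<integral>\<xi>. (norm (f \<xi>))\<^sup>2 \<partial>\<mu>) = 0"
    by (simp add: L2n_def)
  also have "\<dots> \<longleftrightarrow> (AE \<xi> in \<mu>. (norm (f \<xi>))\<^sup>2 = 0)"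
    using assms by (intro integral_nonneg_eq_0_iff_AE) (auto simp: L2_fun_def)
  finally show ?thesis by simp
qed

text \<open>On complex vectors \<open>\<bullet>\<close> is the real part of the Hermitian product.
  It still computes the square of \<open>L2n\<close> and still moves a matrix to its adjoint, as the
  C*-identity requires.\<close>

lemma L2_fun_integrable_inner:
  assumes f: "L2_fun \<mu> f" and g: "L2_fun \<mu> g"
  shows "integrable \<mu> (\<lambda>\<xi>. f \<xi> \<bullet> g \<xi>)" "(\<integral>\<xi>. f \<xi> \<bullet> g \<xi> \<partial>\<mu>) \<le> L2n \<mu> f * L2n \<mu> g"
proof -
  show int: "integrable \<mu> (\<lambda>\<xi>. f \<xi> \<bullet> g \<xi>)"
    using f g by (intro Bochner_Integration.integrable_bound[OF L2_fun_integrable_mult[OF f g]])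
      (auto simp: L2_fun_def Cauchy_Schwarz_ineq2)
  have "(\<integral>\<xi>. f \<xi> \<bullet> g \<xi> \<partial>\<mu>) \<le> (\<integral>\<xi>. norm (f \<xi>) * norm (g \<xi>) \<partial>\<mu>)"
    by (intro integral_mono int L2_fun_integrable_mult f g norm_cauchy_schwarz)
  then show "(\<integral>\<xi>. f \<xi> \<bullet> g \<xi> \<partial>\<mu>) \<le> L2n \<mu> f * L2n \<mu> g"
    using L2_Cauchy_Schwarz[OF f g] by linarith
qed

text \<open>This pairing carries no conjugate: it is the one in \<open>fourier_coeff\<close>, where
  the second factor is a character.\<close>

lemma L2_fun_integrable_times:
  fixes f g :: "'x \<Rightarrow> complex"
  assumes f: "L2_fun \<mu> f" and g: "L2_fun \<mu> g"
  shows "integrable \<mu> (\<lambda>\<xi>. f \<xi> * g \<xi>)" "cmod (\<integral>\<xi>. f \<xi> * g \<xi> \<partial>\<mu>) \<le> L2n \<mu> f * L2n \<mu> g"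
proof -
  show "integrable \<mu> (\<lambda>\<xi>. f \<xi> * g \<xi>)"
    using f g by (intro Bochner_Integration.integrable_bound[OF L2_fun_integrable_mult[OF f g]])
      (auto simp: L2_fun_def norm_mult)
  have "cmod (\<integral>\<xi>. f \<xi> * g \<xi> \<partial>\<mu>) \<le> (\<integral>\<xi>. cmod (f \<xi> * g \<xi>) \<partial>\<mu>)"
    by (rule integral_norm_bound)
  then show "cmod (\<integral>\<xi>. f \<xi> * g \<xi> \<partial>\<mu>) \<le> L2n \<mu> f * L2n \<mu> g"
    using L2_Cauchy_Schwarz[OF f g] by (simp add: norm_mult)
qed

section \<open>Vector-valued functions and their coordinates\<close>

lemma borel_measurable_vec_iff:
  fixes x :: "'x \<Rightarrow> 'b::euclidean_space^'h"
  shows "x \<in> borel_measurable \<mu> \<longleftrightarrow> (\<forall>h. (\<lambda>\<xi>. x \<xi> $ h) \<in> borel_measurable \<mu>)"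
proof
  assume "x \<in> borel_measurable \<mu>"
  then show "\<forall>h. (\<lambda>\<xi>. x \<xi> $ h) \<in> borel_measurable \<mu>"
    by (intro allI borel_measurable_continuous_on[where f = "\<lambda>v. v $ h" for h])
      (auto intro: continuous_intros)
next
  assume h: "\<forall>h. (\<lambda>\<xi>. x \<xi> $ h) \<in> borel_measurable \<mu>"
  have "(\<lambda>\<xi>. \<Sum>b\<in>Basis. (x \<xi> \<bullet> b) *\<^sub>R b) \<in> borel_measurable \<mu>"
  proof (intro borel_measurable_sum borel_measurable_scaleR borel_measurable_const)
    fix b :: "'b^'h" assume "b \<in> Basis"
    then obtain h u where b: "b = axis h u" by (auto simp: Basis_vec_def)
    have "(\<lambda>\<xi>. x \<xi> $ h \<bullet> u) \<in> borel_measurable \<mu>"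
      using h by (intro borel_measurable_inner borel_measurable_const) auto
    then show "(\<lambda>\<xi>. x \<xi> \<bullet> b) \<in> borel_measurable \<mu>"
      by (simp add: b inner_axis)
  qed
  then show "x \<in> borel_measurable \<mu>" by (simp add: euclidean_representation)
qed

lemma norm_vec_power2: "(norm (v :: 'b::euclidean_space^'h))\<^sup>2 = (\<Sum>h\<in>UNIV. (norm (v $ h))\<^sup>2)"
  by (simp add: norm_vec_def L2_set_def sum_nonneg)

lemma L2_fun_vec_iff:
  fixes x :: "'x \<Rightarrow> complex^'h"
  shows "L2_fun \<mu> x \<longleftrightarrow> (\<forall>h. L2_fun \<mu> (\<lambda>\<xi>. x \<xi> $ h))"
proof
  assume x: "L2_fun \<mu> x"
  show "\<forall>h. L2_fun \<mu> (\<lambda>\<xi>. x \<xi> $ h)"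
  proof
    fix h
    show "L2_fun \<mu> (\<lambda>\<xi>. x \<xi> $ h)"
      using x by (intro L2_fun_dominated(1)[OF x, where C = 1])
        (auto simp: L2_fun_def borel_measurable_vec_iff[of x] Finite_Cartesian_Product.norm_nth_le)
  qed
next
  assume "\<forall>h. L2_fun \<mu> (\<lambda>\<xi>. x \<xi> $ h)"
  then show "L2_fun \<mu> x"
    unfolding L2_fun_def borel_measurable_vec_iff[of x] norm_vec_power2 by auto
qed

text \<open>The norm on a product of copies of \<open>L2\<close> is the norm of one vector-valued
  function, so the scalar-style estimates above apply to columns at once.\<close>

lemma L2_vec_norm_eq_L2n:
  assumes "\<And>h. L2_fun \<mu> (\<lambda>\<xi>. x \<xi> $ h)"
  shows "L2_vec_norm \<mu> x = L2n \<mu> x"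
proof -
  have "L2_vec_norm \<mu> x = sqrt (\<Sum>h\<in>UNIV. \<integral>\<xi>. (cmod (x \<xi> $ h))\<^sup>2 \<partial>\<mu>)"
    by (simp add: L2_vec_norm_def L2_norm_eq_L2n L2n_power2)
  also have "\<dots> = L2n \<mu> x"
    using assms unfolding L2n_def norm_vec_power2
    by (subst Bochner_Integration.integral_sum) (auto simp: L2_fun_def)
  finally show ?thesis .
qed

section \<open>Matrices of essentially bounded functions\<close>

definition adjoint_matrix :: "complex^'h^'h \<Rightarrow> complex^'h^'h" where
  "adjoint_matrix A = (\<chi> h l. cnj (A $ l $ h))"

text \<open>These are the honest functions behind the elements of the carrier of
  \<open>matrix_algebra\<close>; calculations happen here, and classes are taken afterwards.\<close>

definition bounded_matrix :: "'x measure \<Rightarrow> ('x \<Rightarrow> complex^'h^'h) \<Rightarrow> bool" where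
  "bounded_matrix \<mu> F \<longleftrightarrow> (\<forall>h l. (\<lambda>\<xi>. F \<xi> $ h $ l) \<in> borel_measurable \<mu> \<and>
     (\<exists>C. AE \<xi> in \<mu>. cmod (F \<xi> $ h $ l) \<le> C))"

text \<open>The counterpart of \<open>mat_norm\<close> for functions instead of classes;
  \<open>mat_norm_mat_class\<close> identifies the two over a probability space.\<close>

definition operator_norm :: "'x measure \<Rightarrow> ('x \<Rightarrow> complex^'h^'h) \<Rightarrow> real" where
  "operator_norm \<mu> F = Sup {L2n \<mu> (\<lambda>\<xi>. F \<xi> *v x \<xi>) | x. L2_fun \<mu> x \<and> L2n \<mu> x = 1}"

section \<open>Pointwise action of matrices on vectors\<close>

lemma inner_matrix_vector_mult:
  fixes A :: "complex^'h^'h"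
  shows "(A *v x) \<bullet> y = x \<bullet> (adjoint_matrix A *v y)"
proof -
  have ip: "u \<bullet> v = Re (u * cnj v)" for u v :: complex
    by (simp add: inner_complex_def)
  have "(A *v x) \<bullet> y = (\<Sum>h\<in>UNIV. \<Sum>l\<in>UNIV. Re (A $ h $ l * x $ l * cnj (y $ h)))"
    by (simp add: inner_vec_def ip matrix_vector_mult_def sum_distrib_right Re_sum del: times_complex.sel)
  also have "\<dots> = (\<Sum>l\<in>UNIV. \<Sum>h\<in>UNIV. Re (A $ h $ l * x $ l * cnj (y $ h)))"
    by (rule sum.swap)
  also have "\<dots> = x \<bullet> (adjoint_matrix A *v y)"
    by (simp add: inner_vec_def ip matrix_vector_mult_def adjoint_matrix_def sum_distrib_left
        Re_sum mult_ac del: times_complex.sel)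
  finally show ?thesis .
qed

text \<open>The factor is crude, one summand for each entry. What counts is that it depends on the
  size of the matrix alone, so that small entries give a small operator norm.\<close>

lemma norm_matrix_vector_mult_le:
  fixes A :: "complex^'h^'h"
  assumes "\<And>h l. cmod (A $ h $ l) \<le> C"
  shows "norm (A *v v) \<le> (real CARD('h))\<^sup>2 * C * norm v"
proof -
  have "norm (A *v v) \<le> (\<Sum>h\<in>UNIV. cmod ((A *v v) $ h))"
    unfolding norm_vec_def by (rule L2_set_le_sum) simp
  also have "\<dots> \<le> (\<Sum>h\<in>(UNIV::'h set). \<Sum>l\<in>(UNIV::'h set). C * norm v)"
  proof (rule sum_mono)
    fix h
    have "cmod ((A *v v) $ h) \<le> (\<Sum>l\<in>UNIV. cmod (A $ h $ l * v $ l))"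
      by (simp add: matrix_vector_mult_def norm_sum)
    also have "\<dots> \<le> (\<Sum>l\<in>(UNIV::'h set). C * norm v)"
      unfolding norm_mult
      by (intro sum_mono mult_mono assms Finite_Cartesian_Product.norm_nth_le norm_ge_zero
          order_trans[OF norm_ge_zero assms])
    finally show "cmod ((A *v v) $ h) \<le> (\<Sum>l\<in>(UNIV::'h set). C * norm v)" .
  qed
  also have "\<dots> = (real CARD('h))\<^sup>2 * C * norm v"
    by (simp add: power2_eq_square)
  finally show ?thesis .
qed

lemma norm_axis_one: "norm (axis k 1 :: complex^'h) = 1"
  by (simp add: norm_eq_sqrt_inner inner_axis_axis)

section \<open>Classes modulo null sets and bounded representatives\<close>

lemma ae_class_eq_iff:
  assumes "f \<in> borel_measurable \<mu>" "g \<in> borel_measurable \<mu>"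
  shows "ae_class \<mu> f = ae_class \<mu> g \<longleftrightarrow> (AE \<xi> in \<mu>. f \<xi> = g \<xi>)"
proof
  assume "ae_class \<mu> f = ae_class \<mu> g"
  moreover have "f \<in> ae_class \<mu> f" using assms by (simp add: ae_class_def)
  ultimately show "AE \<xi> in \<mu>. f \<xi> = g \<xi>" by (simp add: ae_class_def)
next
  assume fg: "AE \<xi> in \<mu>. f \<xi> = g \<xi>"
  have "(AE \<xi> in \<mu>. k \<xi> = f \<xi>) \<longleftrightarrow> (AE \<xi> in \<mu>. k \<xi> = g \<xi>)" for k
    using fg by (auto elim: eventually_elim2)
  then show "ae_class \<mu> f = ae_class \<mu> g" by (simp add: ae_class_def)
qed

lemma representative_ae_class:
  assumes "f \<in> borel_measurable \<mu>"
  shows "representative (ae_class \<mu> f) \<in> borel_measurable \<mu>"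
    and "AE \<xi> in \<mu>. representative (ae_class \<mu> f) \<xi> = f \<xi>"
proof -
  have "f \<in> ae_class \<mu> f" using assms by (simp add: ae_class_def)
  then have "representative (ae_class \<mu> f) \<in> ae_class \<mu> f"
    unfolding representative_def by (rule someI[of "\<lambda>g. g \<in> ae_class \<mu> f"])
  then show "representative (ae_class \<mu> f) \<in> borel_measurable \<mu>"
    "AE \<xi> in \<mu>. representative (ae_class \<mu> f) \<xi> = f \<xi>"
    by (simp_all add: ae_class_def)
qed

lemma bounded_matrix_measurable:
  "bounded_matrix \<mu> F \<Longrightarrow> (\<lambda>\<xi>. F \<xi> $ h $ l) \<in> borel_measurable \<mu>"
  by (simp add: bounded_matrix_def)

text \<open>The finitely many entrywise bounds are merged by adding their absolute values, which
  makes the common bound nonnegative; finiteness also lets one null set serve all entries.\<close>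

lemma bounded_matrix_bound:
  fixes F :: "'x \<Rightarrow> complex^'h^'h"
  assumes "bounded_matrix \<mu> F"
  shows "\<exists>C\<ge>0. AE \<xi> in \<mu>. \<forall>h l. cmod (F \<xi> $ h $ l) \<le> C"
proof -
  obtain B where B: "\<And>h l. AE \<xi> in \<mu>. cmod (F \<xi> $ h $ l) \<le> B h l"
    using assms unfolding bounded_matrix_def by metis
  define C where "C = (\<Sum>h\<in>UNIV. \<Sum>l\<in>UNIV. \<bar>B h l\<bar>)"
  have BC: "B h l \<le> C" for h l
  proof -
    have "B h l \<le> \<bar>B h l\<bar>" by simp
    also have "\<dots> \<le> (\<Sum>l\<in>UNIV. \<bar>B h l\<bar>)"
      by (rule member_le_sum) auto
    also have "\<dots> \<le> C"
      unfolding C_def by (rule member_le_sum) (auto intro: sum_nonneg)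
    finally show ?thesis .
  qed
  have "AE \<xi> in \<mu>. \<forall>h l. cmod (F \<xi> $ h $ l) \<le> C"
  proof (intro eventually_all_finite)
    show "AE \<xi> in \<mu>. cmod (F \<xi> $ h $ l) \<le> C" for h l
      using B[of h l] by eventually_elim (use BC[of h l] in linarith)
  qed
  moreover have "0 \<le> C" by (simp add: C_def sum_nonneg)
  ultimately show ?thesis by blast
qed

lemma bounded_matrixI:
  assumes "\<And>h l. (\<lambda>\<xi>. F \<xi> $ h $ l) \<in> borel_measurable \<mu>"
    and "AE \<xi> in \<mu>. \<forall>h l. cmod (F \<xi> $ h $ l) \<le> C"
  shows "bounded_matrix \<mu> F"
  unfolding bounded_matrix_def
proof (intro allI conjI exI[of _ C])
  show "AE \<xi> in \<mu>. cmod (F \<xi> $ h $ l) \<le> C" for h l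
    using assms(2) by eventually_elim simp
qed (rule assms(1))

lemma bounded_matrix_add:
  assumes F: "bounded_matrix \<mu> F" and G: "bounded_matrix \<mu> G"
  shows "bounded_matrix \<mu> (\<lambda>\<xi>. F \<xi> + G \<xi>)"
proof -
  obtain C D where CD: "AE \<xi> in \<mu>. \<forall>h l. cmod (F \<xi> $ h $ l) \<le> C"
    "AE \<xi> in \<mu>. \<forall>h l. cmod (G \<xi> $ h $ l) \<le> D"
    using bounded_matrix_bound[OF F] bounded_matrix_bound[OF G] by auto
  show ?thesis
  proof (rule bounded_matrixI)
    show "(\<lambda>\<xi>. (F \<xi> + G \<xi>) $ h $ l) \<in> borel_measurable \<mu>" for h l
      using bounded_matrix_measurable[OF F] bounded_matrix_measurable[OF G] by simp
    show "AE \<xi> in \<mu>. \<forall>h l. cmod ((F \<xi> + G \<xi>) $ h $ l) \<le> C + D"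
      using CD by eventually_elim (auto intro!: order_trans[OF norm_triangle_ineq] add_mono)
  qed
qed

lemma bounded_matrix_scale:
  assumes F: "bounded_matrix \<mu> F"
  shows "bounded_matrix \<mu> (\<lambda>\<xi>. \<chi> h l. c * F \<xi> $ h $ l)"
proof -
  obtain C where C: "AE \<xi> in \<mu>. \<forall>h l. cmod (F \<xi> $ h $ l) \<le> C"
    using bounded_matrix_bound[OF F] by auto
  show ?thesis
  proof (rule bounded_matrixI)
    show "(\<lambda>\<xi>. (\<chi> h l. c * F \<xi> $ h $ l) $ h $ l) \<in> borel_measurable \<mu>" for h l
      using bounded_matrix_measurable[OF F] by simp
    show "AE \<xi> in \<mu>. \<forall>h l. cmod ((\<chi> h l. c * F \<xi> $ h $ l) $ h $ l) \<le> cmod c * C"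
      using C by eventually_elim (simp add: norm_mult mult_left_mono)
  qed
qed

lemma bounded_matrix_diff:
  assumes F: "bounded_matrix \<mu> F" and G: "bounded_matrix \<mu> G"
  shows "bounded_matrix \<mu> (\<lambda>\<xi>. F \<xi> - G \<xi>)"
proof -
  have eq: "(\<lambda>\<xi>. F \<xi> - G \<xi>) = (\<lambda>\<xi>. F \<xi> + (\<chi> h l. (-1) * G \<xi> $ h $ l))"
    by (simp add: fun_eq_iff vec_eq_iff)
  show ?thesis
    unfolding eq by (intro bounded_matrix_add bounded_matrix_scale F G)
qed

lemma bounded_matrix_mult:
  fixes F G :: "'x \<Rightarrow> complex^'h^'h"
  assumes F: "bounded_matrix \<mu> F" and G: "bounded_matrix \<mu> G"
  shows "bounded_matrix \<mu> (\<lambda>\<xi>. F \<xi> ** G \<xi>)"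
proof -
  obtain C D where CD: "AE \<xi> in \<mu>. \<forall>h l. cmod (F \<xi> $ h $ l) \<le> C"
    "AE \<xi> in \<mu>. \<forall>h l. cmod (G \<xi> $ h $ l) \<le> D" "0 \<le> C"
    using bounded_matrix_bound[OF F] bounded_matrix_bound[OF G] by auto
  show ?thesis
  proof (rule bounded_matrixI)
    show "(\<lambda>\<xi>. (F \<xi> ** G \<xi>) $ h $ l) \<in> borel_measurable \<mu>" for h l
      using bounded_matrix_measurable[OF F] bounded_matrix_measurable[OF G]
      by (simp add: matrix_matrix_mult_def)
    show "AE \<xi> in \<mu>. \<forall>h l. cmod ((F \<xi> ** G \<xi>) $ h $ l) \<le> (\<Sum>k\<in>(UNIV::'h set). C * D)"
      using CD(1,2)
    proof eventually_elim
      fix \<xi> assume a: "\<forall>h l. cmod (F \<xi> $ h $ l) \<le> C" "\<forall>h l. cmod (G \<xi> $ h $ l) \<le> D"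
      have "cmod (\<Sum>k\<in>UNIV. F \<xi> $ h $ k * G \<xi> $ k $ l) \<le> (\<Sum>k\<in>(UNIV::'h set). C * D)" for h l
        using a CD(3) by (intro sum_norm_le) (simp add: norm_mult mult_mono)
      then show "\<forall>h l. cmod ((F \<xi> ** G \<xi>) $ h $ l) \<le> (\<Sum>k\<in>(UNIV::'h set). C * D)"
        by (simp add: matrix_matrix_mult_def)
    qed
  qed
qed

lemma bounded_matrix_adjoint:
  assumes F: "bounded_matrix \<mu> F"
  shows "bounded_matrix \<mu> (\<lambda>\<xi>. adjoint_matrix (F \<xi>))"
proof -
  obtain C where C: "AE \<xi> in \<mu>. \<forall>h l. cmod (F \<xi> $ h $ l) \<le> C"
    using bounded_matrix_bound[OF F] by auto
  show ?thesis
  proof (rule bounded_matrixI)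
    show "(\<lambda>\<xi>. adjoint_matrix (F \<xi>) $ h $ l) \<in> borel_measurable \<mu>" for h l
      using borel_measurable_continuous_on[OF continuous_on_cnj[OF continuous_on_id]
          bounded_matrix_measurable[OF F, of l h]]
      by (simp add: adjoint_matrix_def)
    show "AE \<xi> in \<mu>. \<forall>h l. cmod (adjoint_matrix (F \<xi>) $ h $ l) \<le> C"
      using C by eventually_elim (simp add: adjoint_matrix_def)
  qed
qed

lemma bounded_matrix_zero [simp]: "bounded_matrix \<mu> (\<lambda>\<xi>. 0)"
  by (rule bounded_matrixI[where C = 0]) auto

lemma measurable_matrix_vector_mult:
  fixes F :: "'x \<Rightarrow> complex^'h^'h"
  assumes F: "bounded_matrix \<mu> F" and x: "x \<in> borel_measurable \<mu>"
  shows "(\<lambda>\<xi>. F \<xi> *v x \<xi>) \<in> borel_measurable \<mu>"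
proof -
  have "(\<lambda>\<xi>. \<Sum>l\<in>UNIV. F \<xi> $ h $ l * x \<xi> $ l) \<in> borel_measurable \<mu>" for h
  proof (intro borel_measurable_sum borel_measurable_times)
    show "(\<lambda>\<xi>. F \<xi> $ h $ l) \<in> borel_measurable \<mu>" for l
      using bounded_matrix_measurable[OF F] .
    show "(\<lambda>\<xi>. x \<xi> $ l) \<in> borel_measurable \<mu>" for l
      using x borel_measurable_vec_iff[of x] by auto
  qed
  then show ?thesis
    by (subst borel_measurable_vec_iff) (simp add: matrix_vector_mult_def)
qed

lemma L2n_matrix_vector_mult_le:
  fixes F :: "'x \<Rightarrow> complex^'h^'h"
  assumes F: "bounded_matrix \<mu> F" and C: "0 \<le> C" "AE \<xi> in \<mu>. \<forall>h l. cmod (F \<xi> $ h $ l) \<le> C"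
    and x: "L2_fun \<mu> x"
  shows "L2_fun \<mu> (\<lambda>\<xi>. F \<xi> *v x \<xi>)"
    and "L2n \<mu> (\<lambda>\<xi>. F \<xi> *v x \<xi>) \<le> (real CARD('h))\<^sup>2 * C * L2n \<mu> x"
proof -
  have "AE \<xi> in \<mu>. norm (F \<xi> *v x \<xi>) \<le> (real CARD('h))\<^sup>2 * C * norm (x \<xi>)"
    using C(2) by eventually_elim (simp add: norm_matrix_vector_mult_le)
  moreover have "0 \<le> (real CARD('h))\<^sup>2 * C" using C(1) by simp
  ultimately show "L2_fun \<mu> (\<lambda>\<xi>. F \<xi> *v x \<xi>)"
    "L2n \<mu> (\<lambda>\<xi>. F \<xi> *v x \<xi>) \<le> (real CARD('h))\<^sup>2 * C * L2n \<mu> x"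
    using L2_fun_dominated[OF x measurable_matrix_vector_mult[OF F L2_fun_measurable[OF x]]]
    by blast+
qed

lemma L2_fun_matrix_vector_mult:
  assumes F: "bounded_matrix \<mu> F" and x: "L2_fun \<mu> x"
  shows "L2_fun \<mu> (\<lambda>\<xi>. F \<xi> *v x \<xi>)"
  using bounded_matrix_bound[OF F] L2n_matrix_vector_mult_le(1)[OF F _ _ x] by blast

text \<open>Normalizing \<open>x\<close> reduces the claim to the supremum, whose set is bounded
  above by the entry estimate. A function of norm 0 cannot be normalized, but it vanishes almost
  everywhere, and so does its image.\<close>

lemma operator_norm_bound:
  fixes F :: "'x \<Rightarrow> complex^'h^'h"
  assumes F: "bounded_matrix \<mu> F" and x: "L2_fun \<mu> x"
  shows "L2n \<mu> (\<lambda>\<xi>. F \<xi> *v x \<xi>) \<le> operator_norm \<mu> F * L2n \<mu> x"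
proof (cases "L2n \<mu> x = 0")
  case True
  then have "AE \<xi> in \<mu>. x \<xi> = 0" using L2n_eq_0_iff[OF x] by simp
  then have "AE \<xi> in \<mu>. F \<xi> *v x \<xi> = 0" by eventually_elim simp
  then have "L2n \<mu> (\<lambda>\<xi>. F \<xi> *v x \<xi>) = 0"
    using L2n_eq_0_iff[OF L2_fun_matrix_vector_mult[OF F x]] by simp
  then show ?thesis using True by simp
next
  case False
  define y where "y \<xi> = (1 / L2n \<mu> x) *\<^sub>R x \<xi>" for \<xi>
  have y: "L2_fun \<mu> y" "L2n \<mu> y = 1"
    using L2_fun_scaleR[OF x] L2n_scaleR[of \<mu> "1 / L2n \<mu> x" x] False
    by (simp_all add: y_def[abs_def])
  obtain C where C: "0 \<le> C" "AE \<xi> in \<mu>. \<forall>h l. cmod (F \<xi> $ h $ l) \<le> C"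
    using bounded_matrix_bound[OF F] by blast
  have "bdd_above {L2n \<mu> (\<lambda>\<xi>. F \<xi> *v x \<xi>) | x. L2_fun \<mu> x \<and> L2n \<mu> x = 1}"
    using L2n_matrix_vector_mult_le(2)[OF F C]
    by (intro bdd_aboveI[where M = "(real CARD('h))\<^sup>2 * C"]) fastforce
  then have "L2n \<mu> (\<lambda>\<xi>. F \<xi> *v y \<xi>) \<le> operator_norm \<mu> F"
    unfolding operator_norm_def using y by (intro cSup_upper) auto
  moreover have "(\<lambda>\<xi>. F \<xi> *v y \<xi>) = (\<lambda>\<xi>. (1 / L2n \<mu> x) *\<^sub>R (F \<xi> *v x \<xi>))"
    by (simp add: fun_eq_iff vec_eq_iff y_def matrix_vector_mult_def scaleR_sum_right)
  ultimately have "\<bar>1 / L2n \<mu> x\<bar> * L2n \<mu> (\<lambda>\<xi>. F \<xi> *v x \<xi>) \<le> operator_norm \<mu> F"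
    by (simp only: L2n_scaleR)
  then show ?thesis using False L2n_nonneg[of \<mu> x]
    by (simp add: divide_simps mult.commute split: if_splits)
qed

section \<open>The operator norm over a probability space\<close>

context prob_space
begin

lemma L2_fun_const: "L2_fun M (\<lambda>\<xi>. c)" "L2n M (\<lambda>\<xi>. c) = norm c"
  by (simp_all add: L2_fun_def L2n_def prob_space)

lemma operator_norm_le:
  fixes F :: "'a \<Rightarrow> complex^'h^'h"
  assumes "\<And>x. L2_fun M x \<Longrightarrow> L2n M (\<lambda>\<xi>. F \<xi> *v x \<xi>) \<le> c * L2n M x"
  shows "operator_norm M F \<le> c"
  unfolding operator_norm_def
proof (rule cSup_least)
  \<comment> \<open>Total mass 1 gives a constant unit vector norm 1, so the supremum is taken over
    a nonempty set.\<close>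
  define u :: "complex^'h" where "u = axis undefined 1"
  have "L2_fun M (\<lambda>_. u) \<and> L2n M (\<lambda>_. u) = 1"
    by (simp add: L2_fun_const u_def norm_axis_one)
  then show "{L2n M (\<lambda>\<xi>. F \<xi> *v x \<xi>) | x. L2_fun M x \<and> L2n M x = 1} \<noteq> {}" by blast
qed (use assms in fastforce)

lemma operator_norm_nonneg:
  fixes F :: "'a \<Rightarrow> complex^'h^'h"
  assumes "bounded_matrix M F"
  shows "0 \<le> operator_norm M F"
proof -
  define u :: "complex^'h" where "u = axis undefined 1"
  have "0 \<le> L2n M (\<lambda>\<xi>. F \<xi> *v u)" by simp
  also have "\<dots> \<le> operator_norm M F * L2n M (\<lambda>_. u)"
    by (intro operator_norm_bound assms L2_fun_const)
  also have "\<dots> = operator_norm M F" by (simp add: L2_fun_const u_def norm_axis_one)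
  finally show ?thesis .
qed

lemma operator_norm_le_entries:
  fixes F :: "'a \<Rightarrow> complex^'h^'h"
  assumes "bounded_matrix M F" "0 \<le> C" "AE \<xi> in M. \<forall>h l. cmod (F \<xi> $ h $ l) \<le> C"
  shows "operator_norm M F \<le> (real CARD('h))\<^sup>2 * C"
  by (intro operator_norm_le L2n_matrix_vector_mult_le(2) assms)

lemma operator_norm_cong_AE:
  assumes F: "bounded_matrix M F" and G: "bounded_matrix M G" and eq: "AE \<xi> in M. F \<xi> = G \<xi>"
  shows "operator_norm M F = operator_norm M G"
proof -
  have "L2n M (\<lambda>\<xi>. F \<xi> *v x \<xi>) = L2n M (\<lambda>\<xi>. G \<xi> *v x \<xi>)" if "L2_fun M x" for x
  proof (intro L2n_cong_AE measurable_matrix_vector_mult F G L2_fun_measurable[OF that])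
    show "AE \<xi> in M. F \<xi> *v x \<xi> = G \<xi> *v x \<xi>"
      using eq by eventually_elim simp
  qed
  then show ?thesis
    using operator_norm_bound[OF F] operator_norm_bound[OF G]
    by (intro antisym operator_norm_le) auto
qed

text \<open>The entries are controlled by testing the operator on the indicator function of the set
  where an entry exceeds the norm.\<close>

lemma entry_le_operator_norm:
  fixes F :: "'a \<Rightarrow> complex^'h^'h"
  assumes F: "bounded_matrix M F"
  shows "AE \<xi> in M. \<forall>h l. cmod (F \<xi> $ h $ l) \<le> operator_norm M F"
proof (intro eventually_all_finite)
  fix h l
  define c where "c = operator_norm M F"
  have c0: "0 \<le> c" using operator_norm_nonneg[OF F] by (simp add: c_def)
  have [measurable]: "(\<lambda>\<xi>. F \<xi> $ h $ l) \<in> borel_measurable M"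
    by (rule bounded_matrix_measurable[OF F])
  \<comment> \<open>On the set \<open>E\<close> the entry exceeds \<open>c + e\<close>, whence
    \<open>(c + e) * L2n M x \<le> c * L2n M x\<close>; the slack \<open>e\<close> then forces
    \<open>E\<close> to be null. It also keeps the divisor \<open>c + e\<close> positive when
    \<open>c = 0\<close>.\<close>
  have "AE \<xi> in M. cmod (F \<xi> $ h $ l) \<le> c + e" if e: "0 < e" for e
  proof -
    define E where "E = {\<xi> \<in> space M. c + e < cmod (F \<xi> $ h $ l)}"
    have E: "E \<in> sets M" unfolding E_def by measurable
    define x :: "'a \<Rightarrow> complex^'h" where "x \<xi> = indicator E \<xi> *\<^sub>R axis l 1" for \<xi>
    have xm: "x \<in> borel_measurable M"
      unfolding x_def using E by measurable
    have nx: "norm (x \<xi>) = indicator E \<xi>" for \<xi>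
      by (simp add: x_def norm_axis_one indicator_def)
    have x: "L2_fun M x"
      by (rule L2_fun_dominated(1)[OF L2_fun_const(1)[of "1::real"] xm, where C = 1])
        (auto simp: nx indicator_def)
    have le: "norm (x \<xi>) \<le> 1 / (c + e) * norm (F \<xi> *v x \<xi>)" for \<xi>
    proof (cases "\<xi> \<in> E")
      case True
      have "F \<xi> *v x \<xi> = F \<xi> *v axis l 1"
        using True by (simp add: x_def)
      then have "(F \<xi> *v x \<xi>) $ h = F \<xi> $ h $ l"
        by (simp add: matrix_vector_mult_def axis_def if_distrib cong: if_cong)
      then have "cmod (F \<xi> $ h $ l) \<le> norm (F \<xi> *v x \<xi>)"
        using Finite_Cartesian_Product.norm_nth_le[of "F \<xi> *v x \<xi>" h] by simp
      then have "c + e \<le> norm (F \<xi> *v x \<xi>)"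
        using True by (simp add: E_def)
      then show ?thesis using True e c0 by (simp add: nx divide_simps)
    qed (use e c0 in \<open>simp add: nx\<close>)
    have "L2n M x \<le> 1 / (c + e) * L2n M (\<lambda>\<xi>. F \<xi> *v x \<xi>)"
      using le e c0
      by (intro L2_fun_dominated(2)[OF L2_fun_matrix_vector_mult[OF F x] xm]) auto
    also have "\<dots> \<le> 1 / (c + e) * (c * L2n M x)"
      using operator_norm_bound[OF F x] e c0 by (intro mult_left_mono) (auto simp: c_def)
    finally have "(c + e) * L2n M x \<le> c * L2n M x"
      using e c0 by (simp add: field_simps)
    then have "e * L2n M x \<le> 0" by (simp add: algebra_simps)
    then have "L2n M x = 0"
      using e L2n_nonneg[of M x] by (simp add: mult_le_0_iff)
    then have "AE \<xi> in M. x \<xi> = 0" using L2n_eq_0_iff[OF x] by simp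
    moreover have "AE \<xi> in M. \<xi> \<in> space M" by (rule AE_space)
    ultimately show ?thesis
    proof eventually_elim
      fix \<xi> assume a: "x \<xi> = 0" "\<xi> \<in> space M"
      then have "indicator E \<xi> = (0::real)" using nx[of \<xi>] by simp
      then have "\<xi> \<notin> E" by (simp add: indicator_def split: if_splits)
      then show "cmod (F \<xi> $ h $ l) \<le> c + e" using a by (simp add: E_def)
    qed
  qed
  \<comment> \<open>A sequence of slacks tending to 0 keeps the union of the exceptional sets
    null.\<close>
  then have "AE \<xi> in M. \<forall>n. cmod (F \<xi> $ h $ l) \<le> c + 1 / real (Suc n)"
    unfolding AE_all_countable by simp
  then show "AE \<xi> in M. cmod (F \<xi> $ h $ l) \<le> operator_norm M F"
  proof eventually_elim
    fix \<xi> assume a: "\<forall>n. cmod (F \<xi> $ h $ l) \<le> c + 1 / real (Suc n)"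
    show "cmod (F \<xi> $ h $ l) \<le> operator_norm M F"
    proof (rule field_le_epsilon)
      fix e :: real assume "0 < e"
      then obtain n where "1 / real (Suc n) < e" using nat_approx_posE by blast
      then show "cmod (F \<xi> $ h $ l) \<le> operator_norm M F + e"
        using a[rule_format, of n] by (simp add: c_def)
    qed
  qed
qed

lemma operator_norm_add:
  assumes F: "bounded_matrix M F" and G: "bounded_matrix M G"
  shows "operator_norm M (\<lambda>\<xi>. F \<xi> + G \<xi>) \<le> operator_norm M F + operator_norm M G"
proof (rule operator_norm_le)
  fix x :: "'a \<Rightarrow> complex^'b" assume x: "L2_fun M x"
  have "L2n M (\<lambda>\<xi>. (F \<xi> + G \<xi>) *v x \<xi>) \<le> L2n M (\<lambda>\<xi>. F \<xi> *v x \<xi>) + L2n M (\<lambda>\<xi>. G \<xi> *v x \<xi>)"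
    unfolding matrix_vector_mult_add_rdistrib
    by (intro L2_fun_add(2) L2_fun_matrix_vector_mult F G x)
  then show "L2n M (\<lambda>\<xi>. (F \<xi> + G \<xi>) *v x \<xi>) \<le> (operator_norm M F + operator_norm M G) * L2n M x"
    using operator_norm_bound[OF F x] operator_norm_bound[OF G x] by (simp add: distrib_right)
qed

lemma operator_norm_mult:
  assumes F: "bounded_matrix M F" and G: "bounded_matrix M G"
  shows "operator_norm M (\<lambda>\<xi>. F \<xi> ** G \<xi>) \<le> operator_norm M F * operator_norm M G"
proof (rule operator_norm_le)
  fix x :: "'a \<Rightarrow> complex^'b" assume x: "L2_fun M x"
  have "L2n M (\<lambda>\<xi>. (F \<xi> ** G \<xi>) *v x \<xi>) \<le> operator_norm M F * L2n M (\<lambda>\<xi>. G \<xi> *v x \<xi>)"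
    unfolding matrix_vector_mul_assoc[symmetric]
    by (intro operator_norm_bound L2_fun_matrix_vector_mult F G x)
  also have "\<dots> \<le> operator_norm M F * (operator_norm M G * L2n M x)"
    by (intro mult_left_mono operator_norm_bound operator_norm_nonneg F G x)
  finally show "L2n M (\<lambda>\<xi>. (F \<xi> ** G \<xi>) *v x \<xi>) \<le> operator_norm M F * operator_norm M G * L2n M x"
    by (simp add: mult.assoc)
qed

lemma operator_norm_scale:
  assumes F: "bounded_matrix M F"
  shows "operator_norm M (\<lambda>\<xi>. \<chi> h l. c * F \<xi> $ h $ l) = cmod c * operator_norm M F"
proof -
  have eq: "L2n M (\<lambda>\<xi>. (\<chi> h l. c * F \<xi> $ h $ l) *v x \<xi>) = cmod c * L2n M (\<lambda>\<xi>. F \<xi> *v x \<xi>)" for x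
  proof -
    have "(norm ((\<chi> h l. c * F \<xi> $ h $ l) *v x \<xi>))\<^sup>2 = (cmod c)\<^sup>2 * (norm (F \<xi> *v x \<xi>))\<^sup>2" for \<xi>
      unfolding norm_vec_power2
      by (simp add: matrix_vector_mult_def mult.assoc sum_distrib_left[symmetric] norm_mult
          power_mult_distrib)
    then show ?thesis by (simp add: L2n_def real_sqrt_mult)
  qed
  show ?thesis
  proof (rule antisym)
    show "operator_norm M (\<lambda>\<xi>. \<chi> h l. c * F \<xi> $ h $ l) \<le> cmod c * operator_norm M F"
      using operator_norm_bound[OF F]
      by (intro operator_norm_le) (simp add: eq mult_left_mono mult.assoc)
    show "cmod c * operator_norm M F \<le> operator_norm M (\<lambda>\<xi>. \<chi> h l. c * F \<xi> $ h $ l)"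
    proof (cases "c = 0")
      case True
      then show ?thesis using operator_norm_nonneg[OF bounded_matrix_scale[OF F, of c]] by simp
    next
      case False
      have "operator_norm M F \<le> operator_norm M (\<lambda>\<xi>. \<chi> h l. c * F \<xi> $ h $ l) / cmod c"
        using operator_norm_bound[OF bounded_matrix_scale[OF F, of c]] False
        by (intro operator_norm_le) (simp add: eq field_simps)
      then show ?thesis using False by (simp add: field_simps)
    qed
  qed
qed

lemma L2n_power2_inner: "(L2n M x)\<^sup>2 = (\<integral>\<xi>. x \<xi> \<bullet> x \<xi> \<partial>M)"
  by (simp add: L2n_power2 power2_norm_eq_inner)

text \<open>With \<open>y\<close> the image of \<open>x\<close> under the adjoint, the square of
  \<open>L2n M y\<close> is the integral of \<open>(F \<xi> *v y \<xi>) \<bullet> x \<xi>\<close>,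
  at most \<open>operator_norm M F * L2n M y * L2n M x\<close>; one factor \<open>L2n M y\<close>
  cancels.\<close>

lemma operator_norm_adjoint_le:
  assumes F: "bounded_matrix M F"
  shows "operator_norm M (\<lambda>\<xi>. adjoint_matrix (F \<xi>)) \<le> operator_norm M F"
proof (rule operator_norm_le)
  fix x :: "'a \<Rightarrow> complex^'b" assume x: "L2_fun M x"
  define y where "y \<xi> = adjoint_matrix (F \<xi>) *v x \<xi>" for \<xi>
  have y: "L2_fun M y"
    unfolding y_def by (intro L2_fun_matrix_vector_mult bounded_matrix_adjoint F x)
  have Fy: "L2_fun M (\<lambda>\<xi>. F \<xi> *v y \<xi>)" by (intro L2_fun_matrix_vector_mult F y)
  have "(L2n M y)\<^sup>2 = (\<integral>\<xi>. (F \<xi> *v y \<xi>) \<bullet> x \<xi> \<partial>M)"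
    unfolding L2n_power2_inner inner_matrix_vector_mult y_def[symmetric] ..
  also have "\<dots> \<le> L2n M (\<lambda>\<xi>. F \<xi> *v y \<xi>) * L2n M x"
    by (rule L2_fun_integrable_inner(2)[OF Fy x])
  also have "\<dots> \<le> operator_norm M F * L2n M y * L2n M x"
    by (intro mult_right_mono operator_norm_bound F y) simp
  finally have "L2n M y * L2n M y \<le> L2n M y * (operator_norm M F * L2n M x)"
    by (simp add: power2_eq_square mult_ac)
  then have "L2n M y \<le> operator_norm M F * L2n M x"
    using operator_norm_nonneg[OF F] L2n_nonneg[of M y] by (cases "L2n M y = 0") auto
  then show "L2n M (\<lambda>\<xi>. adjoint_matrix (F \<xi>) *v x \<xi>) \<le> operator_norm M F * L2n M x"
    by (simp add: y_def[abs_def])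
qed

text \<open>The upper bound is submultiplicativity together with the bound for the adjoint. The
  lower bound moves one factor \<open>F\<close> across the inner product in the square of the norm
  of \<open>F \<xi> *v x \<xi>\<close> and applies Cauchy-Schwarz.\<close>

lemma operator_norm_cstar_identity:
  assumes F: "bounded_matrix M F"
  shows "operator_norm M (\<lambda>\<xi>. adjoint_matrix (F \<xi>) ** F \<xi>) = (operator_norm M F)\<^sup>2"
proof (rule antisym)
  note Fa = bounded_matrix_adjoint[OF F]
  have "operator_norm M (\<lambda>\<xi>. adjoint_matrix (F \<xi>) ** F \<xi>) \<le>
      operator_norm M (\<lambda>\<xi>. adjoint_matrix (F \<xi>)) * operator_norm M F"
    by (rule operator_norm_mult[OF Fa F])
  also have "\<dots> \<le> operator_norm M F * operator_norm M F"
    by (intro mult_right_mono operator_norm_adjoint_le operator_norm_nonneg F)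
  finally show "operator_norm M (\<lambda>\<xi>. adjoint_matrix (F \<xi>) ** F \<xi>) \<le> (operator_norm M F)\<^sup>2"
    by (simp add: power2_eq_square)
  define c where "c = operator_norm M (\<lambda>\<xi>. adjoint_matrix (F \<xi>) ** F \<xi>)"
  have AF: "bounded_matrix M (\<lambda>\<xi>. adjoint_matrix (F \<xi>) ** F \<xi>)"
    by (rule bounded_matrix_mult[OF Fa F])
  have c0: "0 \<le> c" unfolding c_def by (rule operator_norm_nonneg[OF AF])
  have "operator_norm M F \<le> sqrt c"
  proof (rule operator_norm_le)
    fix x :: "'a \<Rightarrow> complex^'b" assume x: "L2_fun M x"
    have "(L2n M (\<lambda>\<xi>. F \<xi> *v x \<xi>))\<^sup>2 = (\<integral>\<xi>. x \<xi> \<bullet> ((adjoint_matrix (F \<xi>) ** F \<xi>) *v x \<xi>) \<partial>M)"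
      unfolding L2n_power2_inner inner_matrix_vector_mult matrix_vector_mul_assoc ..
    also have "\<dots> \<le> L2n M x * L2n M (\<lambda>\<xi>. (adjoint_matrix (F \<xi>) ** F \<xi>) *v x \<xi>)"
      by (intro L2_fun_integrable_inner(2) L2_fun_matrix_vector_mult AF x)
    also have "\<dots> \<le> L2n M x * (c * L2n M x)"
      unfolding c_def by (intro mult_left_mono operator_norm_bound AF x) simp
    also have "\<dots> = (sqrt c * L2n M x)\<^sup>2"
      using c0 by (simp add: power2_eq_square mult_ac flip: real_sqrt_mult)
    finally show "L2n M (\<lambda>\<xi>. F \<xi> *v x \<xi>) \<le> sqrt c * L2n M x"
      by (rule power2_le_imp_le) (simp add: c0)
  qed
  then have "(operator_norm M F)\<^sup>2 \<le> (sqrt c)\<^sup>2"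
    by (intro power_mono operator_norm_nonneg F)
  then show "(operator_norm M F)\<^sup>2 \<le> operator_norm M (\<lambda>\<xi>. adjoint_matrix (F \<xi>) ** F \<xi>)"
    using c0 by (simp add: c_def)
qed

end

section \<open>From matrix functions to matrices of classes\<close>

lemma mat_class_eq_iff:
  fixes F G :: "'x \<Rightarrow> complex^'h^'h"
  assumes F: "bounded_matrix \<mu> F" and G: "bounded_matrix \<mu> G"
  shows "mat_class \<mu> F = mat_class \<mu> G \<longleftrightarrow> (AE \<xi> in \<mu>. F \<xi> = G \<xi>)"
proof -
  have "mat_class \<mu> F = mat_class \<mu> G \<longleftrightarrow> (\<forall>h l. AE \<xi> in \<mu>. F \<xi> $ h $ l = G \<xi> $ h $ l)"
    using F G by (simp add: mat_class_def vec_eq_iff ae_class_eq_iff bounded_matrix_measurable)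
  also have "\<dots> \<longleftrightarrow> (AE \<xi> in \<mu>. \<forall>h l. F \<xi> $ h $ l = G \<xi> $ h $ l)"
    by (simp only: AE_all_countable)
  finally show ?thesis by (simp add: vec_eq_iff)
qed

text \<open>The arbitrary choice in \<open>representative\<close> alters each of the finitely many
  entries on a null set only, so boundedness is inherited from \<open>F\<close>.\<close>

lemma mat_rep_mat_class:
  fixes F :: "'x \<Rightarrow> complex^'h^'h"
  assumes F: "bounded_matrix \<mu> F"
  shows "AE \<xi> in \<mu>. mat_rep (mat_class \<mu> F) \<xi> = F \<xi>" "bounded_matrix \<mu> (mat_rep (mat_class \<mu> F))"
proof -
  have r: "AE \<xi> in \<mu>. mat_rep (mat_class \<mu> F) \<xi> $ h $ l = F \<xi> $ h $ l"
    "(\<lambda>\<xi>. mat_rep (mat_class \<mu> F) \<xi> $ h $ l) \<in> borel_measurable \<mu>" for h l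
    using representative_ae_class[OF bounded_matrix_measurable[OF F, of h l]]
    by (simp_all add: mat_rep_def mat_class_def)
  have "AE \<xi> in \<mu>. \<forall>h l. mat_rep (mat_class \<mu> F) \<xi> $ h $ l = F \<xi> $ h $ l"
    by (intro eventually_all_finite r)
  then show ae: "AE \<xi> in \<mu>. mat_rep (mat_class \<mu> F) \<xi> = F \<xi>"
    by eventually_elim (simp add: vec_eq_iff)
  obtain C where C: "AE \<xi> in \<mu>. \<forall>h l. cmod (F \<xi> $ h $ l) \<le> C"
    using bounded_matrix_bound[OF F] by blast
  have "AE \<xi> in \<mu>. \<forall>h l. cmod (mat_rep (mat_class \<mu> F) \<xi> $ h $ l) \<le> C"
    using C ae by eventually_elim simp
  then show "bounded_matrix \<mu> (mat_rep (mat_class \<mu> F))"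
    by (rule bounded_matrixI[OF r(2)])
qed

lemma mat_class_in_carrier:
  "bounded_matrix \<mu> F \<Longrightarrow> mat_class \<mu> F \<in> acarrier (matrix_algebra \<mu>)"
  by (auto simp: matrix_algebra_def mat_class_def bounded_matrix_def L_infinity_def)

lemma matrix_algebra_carrierE:
  assumes "A \<in> acarrier (matrix_algebra \<mu>)"
  obtains F where "bounded_matrix \<mu> F" "A = mat_class \<mu> F"
proof -
  have "\<forall>h l. \<exists>g. g \<in> borel_measurable \<mu> \<and> (\<exists>C. AE \<xi> in \<mu>. cmod (g \<xi>) \<le> C) \<and>
      A $ h $ l = ae_class \<mu> g"
    using assms by (simp add: matrix_algebra_def L_infinity_def) blast
  then obtain g where g: "\<And>h l. g h l \<in> borel_measurable \<mu>"
    "\<And>h l. \<exists>C. AE \<xi> in \<mu>. cmod (g h l \<xi>) \<le> C" "\<And>h l. A $ h $ l = ae_class \<mu> (g h l)"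
    by metis
  show thesis
  proof (rule that)
    show "bounded_matrix \<mu> (\<lambda>\<xi>. \<chi> h l. g h l \<xi>)"
      using g by (simp add: bounded_matrix_def)
    show "A = mat_class \<mu> (\<lambda>\<xi>. \<chi> h l. g h l \<xi>)"
      using g by (simp add: mat_class_def vec_eq_iff)
  qed
qed

text \<open>Here and in the three companions below, an operation on classes may be computed with any
  bounded representatives, because the chosen ones differ from them on a null set only.\<close>

lemma mat_class_add:
  assumes F: "bounded_matrix \<mu> F" and G: "bounded_matrix \<mu> G"
  shows "aadd (matrix_algebra \<mu>) (mat_class \<mu> F) (mat_class \<mu> G) = mat_class \<mu> (\<lambda>\<xi>. F \<xi> + G \<xi>)"
proof -
  have "AE \<xi> in \<mu>. mat_rep (mat_class \<mu> F) \<xi> + mat_rep (mat_class \<mu> G) \<xi> = F \<xi> + G \<xi>"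
    using mat_rep_mat_class(1)[OF F] mat_rep_mat_class(1)[OF G] by eventually_elim simp
  then show ?thesis
    using F G by (simp add: matrix_algebra_def mat_class_eq_iff bounded_matrix_add mat_rep_mat_class(2))
qed

lemma mat_class_mult:
  assumes F: "bounded_matrix \<mu> F" and G: "bounded_matrix \<mu> G"
  shows "amult (matrix_algebra \<mu>) (mat_class \<mu> F) (mat_class \<mu> G) = mat_class \<mu> (\<lambda>\<xi>. F \<xi> ** G \<xi>)"
proof -
  have "AE \<xi> in \<mu>. mat_rep (mat_class \<mu> F) \<xi> ** mat_rep (mat_class \<mu> G) \<xi> = F \<xi> ** G \<xi>"
    using mat_rep_mat_class(1)[OF F] mat_rep_mat_class(1)[OF G] by eventually_elim simp
  then show ?thesis
    using F G by (simp add: matrix_algebra_def mat_class_eq_iff bounded_matrix_mult mat_rep_mat_class(2))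
qed

lemma mat_class_scale:
  assumes F: "bounded_matrix \<mu> F"
  shows "ascale (matrix_algebra \<mu>) c (mat_class \<mu> F) = mat_class \<mu> (\<lambda>\<xi>. \<chi> h l. c * F \<xi> $ h $ l)"
proof -
  have "AE \<xi> in \<mu>. (\<chi> h l. c * mat_rep (mat_class \<mu> F) \<xi> $ h $ l) = (\<chi> h l. c * F \<xi> $ h $ l)"
    using mat_rep_mat_class(1)[OF F] by eventually_elim simp
  then show ?thesis
    using F by (simp add: matrix_algebra_def mat_class_eq_iff bounded_matrix_scale mat_rep_mat_class(2))
qed

lemma mat_class_star:
  assumes F: "bounded_matrix \<mu> F"
  shows "astar (matrix_algebra \<mu>) (mat_class \<mu> F) = mat_class \<mu> (\<lambda>\<xi>. adjoint_matrix (F \<xi>))"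
proof -
  have "AE \<xi> in \<mu>. adjoint_matrix (mat_rep (mat_class \<mu> F) \<xi>) = adjoint_matrix (F \<xi>)"
    using mat_rep_mat_class(1)[OF F] by eventually_elim simp
  then show ?thesis
    using F by (simp add: matrix_algebra_def mat_class_eq_iff bounded_matrix_adjoint mat_rep_mat_class(2)
        flip: adjoint_matrix_def)
qed

lemma matrix_algebra_zero: "azero (matrix_algebra \<mu>) = mat_class \<mu> (\<lambda>\<xi>. 0)"
  by (simp add: matrix_algebra_def)

text \<open>Both suprema run over the same set of numbers, once a family of square-integrable
  coordinates is read as one vector-valued function.\<close>

lemma mat_norm_eq_operator_norm:
  assumes F: "bounded_matrix \<mu> (mat_rep A)"
  shows "mat_norm \<mu> A = operator_norm \<mu> (mat_rep A)"
proof -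
  have "{L2_vec_norm \<mu> (\<lambda>\<xi>. mat_rep A \<xi> *v x \<xi>) | x.
     (\<forall>h. square_integrable \<mu> (\<lambda>\<xi>. x \<xi> $ h)) \<and> L2_vec_norm \<mu> x = 1} =
     {L2n \<mu> (\<lambda>\<xi>. mat_rep A \<xi> *v x \<xi>) | x. L2_fun \<mu> x \<and> L2n \<mu> x = 1}"
  proof (intro Collect_cong ex_cong1)
    fix r and x :: "'a \<Rightarrow> complex^'b"
    have "L2_vec_norm \<mu> (\<lambda>\<xi>. mat_rep A \<xi> *v x \<xi>) = L2n \<mu> (\<lambda>\<xi>. mat_rep A \<xi> *v x \<xi>)"
      and "L2_vec_norm \<mu> x = L2n \<mu> x" if "L2_fun \<mu> x"
      using that L2_fun_matrix_vector_mult[OF F that] unfolding L2_fun_vec_iff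
      by (simp_all add: L2_vec_norm_eq_L2n)
    moreover have "(\<forall>h. square_integrable \<mu> (\<lambda>\<xi>. x \<xi> $ h)) \<longleftrightarrow> L2_fun \<mu> x"
      unfolding square_integrable_eq_L2_fun L2_fun_vec_iff ..
    ultimately show "(r = L2_vec_norm \<mu> (\<lambda>\<xi>. mat_rep A \<xi> *v x \<xi>) \<and>
        (\<forall>h. square_integrable \<mu> (\<lambda>\<xi>. x \<xi> $ h)) \<and> L2_vec_norm \<mu> x = 1) \<longleftrightarrow>
      (r = L2n \<mu> (\<lambda>\<xi>. mat_rep A \<xi> *v x \<xi>) \<and> L2_fun \<mu> x \<and> L2n \<mu> x = 1)"
      by (cases "L2_fun \<mu> x") simp_all
  qed
  then show ?thesis by (simp add: mat_norm_def operator_norm_def)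
qed

section \<open>Completeness and the C*-axioms of the matrix algebra\<close>

context prob_space
begin

lemma mat_norm_mat_class:
  assumes F: "bounded_matrix M F"
  shows "mat_norm M (mat_class M F) = operator_norm M F"
  using mat_norm_eq_operator_norm[OF mat_rep_mat_class(2)[OF F]]
    operator_norm_cong_AE[OF mat_rep_mat_class(2)[OF F] F mat_rep_mat_class(1)[OF F]] by simp

lemma adist_mat_class:
  assumes F: "bounded_matrix M F" and G: "bounded_matrix M G"
  shows "adist (matrix_algebra M) (mat_class M F) (mat_class M G) = operator_norm M (\<lambda>\<xi>. F \<xi> - G \<xi>)"
proof -
  have eq: "(\<lambda>\<xi>. F \<xi> + (\<chi> h l. (-1) * G \<xi> $ h $ l)) = (\<lambda>\<xi>. F \<xi> - G \<xi>)"
    by (simp add: fun_eq_iff vec_eq_iff)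
  have "adist (matrix_algebra M) (mat_class M F) (mat_class M G) =
      mat_norm M (mat_class M (\<lambda>\<xi>. F \<xi> + (\<chi> h l. (-1) * G \<xi> $ h $ l)))"
    by (simp only: adist_def mat_class_scale[OF G] mat_class_add[OF F bounded_matrix_scale[OF G]])
      (simp add: matrix_algebra_def)
  then show ?thesis
    by (simp only: eq mat_norm_mat_class[OF bounded_matrix_diff[OF F G]])
qed

text \<open>By \<open>entry_le_operator_norm\<close> a Cauchy sequence is uniformly Cauchy in each
  entry off a null set, so entrywise limits exist there. Uniform closeness of the entries returns to
  the operator norm through \<open>operator_norm_le_entries\<close>.\<close>

lemma operator_norm_complete:
  fixes F :: "nat \<Rightarrow> 'a \<Rightarrow> complex^'h^'h"
  assumes F: "\<And>k. bounded_matrix M (F k)"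
    and Cauchy: "\<forall>\<epsilon>>0. \<exists>K. \<forall>j\<ge>K. \<forall>k\<ge>K. operator_norm M (\<lambda>\<xi>. F j \<xi> - F k \<xi>) < \<epsilon>"
  shows "\<exists>G. bounded_matrix M G \<and> (\<lambda>k. operator_norm M (\<lambda>\<xi>. F k \<xi> - G \<xi>)) \<longlonglongrightarrow> 0"
proof -
  define d where "d j k = operator_norm M (\<lambda>\<xi>. F j \<xi> - F k \<xi>)" for j k
  \<comment> \<open>Only countably many choices of \<open>j\<close>, \<open>k\<close>,
    \<open>h\<close>, \<open>l\<close> occur, so one null set serves them all.\<close>
  have "AE \<xi> in M. \<forall>j k h l. cmod ((F j \<xi> - F k \<xi>) $ h $ l) \<le> d j k"
    unfolding AE_all_countable d_def
    using entry_le_operator_norm[OF bounded_matrix_diff[OF F F]] by (simp add: AE_all_countable)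
  then have d: "AE \<xi> in M. \<forall>j k h l. cmod (F j \<xi> $ h $ l - F k \<xi> $ h $ l) \<le> d j k"
    by simp
  \<comment> \<open>\<open>lim\<close> is total, so \<open>G\<close> is defined everywhere and
    measurable; entries diverge at most on a null set, where the value is unspecified.\<close>
  define G :: "'a \<Rightarrow> complex^'h^'h" where "G \<xi> = (\<chi> h l. lim (\<lambda>k. F k \<xi> $ h $ l))" for \<xi>
  have lim: "AE \<xi> in M. \<forall>h l. (\<lambda>k. F k \<xi> $ h $ l) \<longlonglongrightarrow> G \<xi> $ h $ l"
    using d
  proof eventually_elim
    fix \<xi> assume a: "\<forall>j k h l. cmod (F j \<xi> $ h $ l - F k \<xi> $ h $ l) \<le> d j k"
    have "Cauchy (\<lambda>k. F k \<xi> $ h $ l)" for h l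
    proof (rule CauchyI)
      fix e :: real assume "0 < e"
      then obtain K where "\<forall>j\<ge>K. \<forall>k\<ge>K. d j k < e" using Cauchy d_def by metis
      then show "\<exists>K. \<forall>m\<ge>K. \<forall>n\<ge>K. norm (F m \<xi> $ h $ l - F n \<xi> $ h $ l) < e"
        using a by (meson le_less_trans)
    qed
    then show "\<forall>h l. (\<lambda>k. F k \<xi> $ h $ l) \<longlonglongrightarrow> G \<xi> $ h $ l"
      by (simp add: G_def Cauchy_convergent_iff convergent_LIMSEQ_iff)
  qed
  \<comment> \<open>Letting \<open>j\<close> tend to infinity in the Cauchy estimate turns the
    strict bound into a weak one for the limit.\<close>
  have bound: "AE \<xi> in M. \<forall>h l. cmod (F k \<xi> $ h $ l - G \<xi> $ h $ l) \<le> e"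
    if K: "\<forall>j\<ge>K. \<forall>k\<ge>K. d j k < e" and k: "k \<ge> K" for K k e
    using d lim
  proof eventually_elim
    fix \<xi> assume a: "\<forall>j k h l. cmod (F j \<xi> $ h $ l - F k \<xi> $ h $ l) \<le> d j k"
      "\<forall>h l. (\<lambda>k. F k \<xi> $ h $ l) \<longlonglongrightarrow> G \<xi> $ h $ l"
    show "\<forall>h l. cmod (F k \<xi> $ h $ l - G \<xi> $ h $ l) \<le> e"
    proof (intro allI)
      fix h l
      have "(\<lambda>j. cmod (F k \<xi> $ h $ l - F j \<xi> $ h $ l)) \<longlonglongrightarrow> cmod (F k \<xi> $ h $ l - G \<xi> $ h $ l)"
        using a(2) by (intro tendsto_norm tendsto_diff tendsto_const) blast
      moreover have "\<forall>j\<ge>K. cmod (F k \<xi> $ h $ l - F j \<xi> $ h $ l) \<le> e"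
        using a(1) K k by (meson le_less_trans less_imp_le)
      ultimately show "cmod (F k \<xi> $ h $ l - G \<xi> $ h $ l) \<le> e"
        by (intro Lim_bounded) auto
    qed
  qed
  have Gm: "(\<lambda>\<xi>. G \<xi> $ h $ l) \<in> borel_measurable M" for h l
    using bounded_matrix_measurable[OF F] by (simp add: G_def)
  have bG: "bounded_matrix M G"
  proof -
    obtain K where K: "\<forall>j\<ge>K. \<forall>k\<ge>K. d j k < 1" using Cauchy d_def by (metis zero_less_one)
    obtain C where C: "AE \<xi> in M. \<forall>h l. cmod (F K \<xi> $ h $ l) \<le> C"
      using bounded_matrix_bound[OF F[of K]] by blast
    show ?thesis
    proof (rule bounded_matrixI[OF Gm])
      show "AE \<xi> in M. \<forall>h l. cmod (G \<xi> $ h $ l) \<le> C + 1"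
        using C bound[OF K order_refl]
      proof (eventually_elim, intro allI)
        fix \<xi> h l
        assume "\<forall>h l. cmod (F K \<xi> $ h $ l) \<le> C" "\<forall>h l. cmod (F K \<xi> $ h $ l - G \<xi> $ h $ l) \<le> 1"
        then show "cmod (G \<xi> $ h $ l) \<le> C + 1"
          using norm_triangle_sub[of "G \<xi> $ h $ l" "F K \<xi> $ h $ l"]
          by (smt (verit, best) norm_minus_commute)
      qed
    qed
  qed
  have "(\<lambda>k. operator_norm M (\<lambda>\<xi>. F k \<xi> - G \<xi>)) \<longlonglongrightarrow> 0"
  proof (rule LIMSEQ_I)
    fix r :: real assume r: "0 < r"
    \<comment> \<open>Chosen so that the factor in \<open>operator_norm_le_entries\<close> turns
      \<open>e\<close> into \<open>r / 2\<close>.\<close>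
    define e where "e = r / (2 * (real CARD('h))\<^sup>2)"
    have e: "0 < e" "(real CARD('h))\<^sup>2 * e < r" using r by (simp_all add: e_def)
    obtain K where K: "\<forall>j\<ge>K. \<forall>k\<ge>K. d j k < e" using Cauchy e(1) d_def by metis
    have "norm (operator_norm M (\<lambda>\<xi>. F k \<xi> - G \<xi>) - 0) < r" if k: "k \<ge> K" for k
    proof -
      have FG: "bounded_matrix M (\<lambda>\<xi>. F k \<xi> - G \<xi>)" by (intro bounded_matrix_diff F bG)
      have "operator_norm M (\<lambda>\<xi>. F k \<xi> - G \<xi>) \<le> (real CARD('h))\<^sup>2 * e"
        using bound[OF K k] e(1) by (intro operator_norm_le_entries FG) simp_all
      then show ?thesis using operator_norm_nonneg[OF FG] e(2) by simp
    qed
    then show "\<exists>K. \<forall>k\<ge>K. norm (operator_norm M (\<lambda>\<xi>. F k \<xi> - G \<xi>) - 0) < r" by blast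
  qed
  then show ?thesis using bG by blast
qed

lemma anorm_mat_class:
  "bounded_matrix M F \<Longrightarrow> anorm (matrix_algebra M) (mat_class M F) = operator_norm M F"
  by (simp add: matrix_algebra_def mat_norm_mat_class)

lemmas mat_class_simps = mat_class_add mat_class_mult mat_class_scale mat_class_star
  matrix_algebra_zero anorm_mat_class mat_class_in_carrier
  bounded_matrix_add bounded_matrix_mult bounded_matrix_scale bounded_matrix_adjoint

text \<open>The algebraic laws hold pointwise for representatives, which \<open>congI\<close> lifts
  to classes without any null sets. Definiteness of the norm rests on
  \<open>entry_le_operator_norm\<close> and completeness on
  \<open>operator_norm_complete\<close>.\<close>

lemma cstar_algebra_matrix_algebra:
  "cstar_algebra (matrix_algebra M :: (('a \<Rightarrow> complex) set^'h^'h) star_algebra)"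
    (is "cstar_algebra ?A")
proof
  note E = matrix_algebra_carrierE
  note s = mat_class_simps
  have congI: "mat_class M F = mat_class M G" if "\<And>\<xi>. F \<xi> = G \<xi>"
    for F G :: "'a \<Rightarrow> complex^'h^'h"
    using that by (metis ext)
  show "azero ?A \<in> acarrier ?A" by (simp add: s)
  fix x y z :: "('a \<Rightarrow> complex) set^'h^'h" and c d :: complex
  assume x: "x \<in> acarrier ?A"
  obtain F where F: "bounded_matrix M F" "x = mat_class M F" using E[OF x] .
  show "ascale ?A c x \<in> acarrier ?A" "astar ?A x \<in> acarrier ?A"
    using F by (simp_all add: s)
  show "aadd ?A x (azero ?A) = x"
    using F by (simp add: s)
  show "aadd ?A x (ascale ?A (- 1) x) = azero ?A"
    by (simp only: F(2) mat_class_scale[OF F(1)] mat_class_add[OF F(1) bounded_matrix_scale[OF F(1)]]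
        matrix_algebra_zero) (intro congI, simp add: vec_eq_iff)
  show "ascale ?A (c + d) x = aadd ?A (ascale ?A c x) (ascale ?A d x)"
    using F by (simp add: s) (intro congI, simp add: vec_eq_iff algebra_simps)
  show "ascale ?A c (ascale ?A d x) = ascale ?A (c * d) x"
    using F by (simp add: s mult.assoc)
  show "ascale ?A 1 x = x"
    using F by (simp add: s)
  show "astar ?A (astar ?A x) = x"
    using F by (simp add: s) (intro congI, simp add: vec_eq_iff adjoint_matrix_def)
  show "astar ?A (ascale ?A c x) = ascale ?A (cnj c) (astar ?A x)"
    using F by (simp add: s) (intro congI, simp add: vec_eq_iff adjoint_matrix_def)
  show "0 \<le> anorm ?A x"
    using F by (simp add: s operator_norm_nonneg)
  show "anorm ?A x = 0 \<longleftrightarrow> x = azero ?A"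
  proof
    assume "anorm ?A x = 0"
    then have n0: "operator_norm M F = 0" using F by (simp add: s)
    have "AE \<xi> in M. F \<xi> = 0"
      using entry_le_operator_norm[OF F(1)] by eventually_elim (simp add: vec_eq_iff n0)
    then show "x = azero ?A"
      unfolding F(2) matrix_algebra_zero mat_class_eq_iff[OF F(1) bounded_matrix_zero] .
  next
    assume x0: "x = azero ?A"
    have "operator_norm M (\<lambda>\<xi>. 0 :: complex^'h^'h) \<le> (real CARD('h))\<^sup>2 * 0"
      by (intro operator_norm_le_entries) auto
    moreover have "0 \<le> operator_norm M (\<lambda>\<xi>. 0 :: complex^'h^'h)"
      by (intro operator_norm_nonneg bounded_matrix_zero)
    ultimately have "operator_norm M (\<lambda>\<xi>. 0 :: complex^'h^'h) = 0" by linarith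
    then show "anorm ?A x = 0"
      by (simp add: x0 matrix_algebra_zero anorm_mat_class)
  qed
  show "anorm ?A (ascale ?A c x) = cmod c * anorm ?A x"
    using F by (simp add: s operator_norm_scale)
  show "anorm ?A (amult ?A (astar ?A x) x) = (anorm ?A x)\<^sup>2"
    using F by (simp add: s operator_norm_cstar_identity)
  assume y: "y \<in> acarrier ?A"
  obtain G where G: "bounded_matrix M G" "y = mat_class M G" using E[OF y] .
  show "aadd ?A x y \<in> acarrier ?A" "amult ?A x y \<in> acarrier ?A"
    using F G by (simp_all add: s)
  show "aadd ?A x y = aadd ?A y x"
    using F G by (simp add: s add.commute)
  show "ascale ?A c (aadd ?A x y) = aadd ?A (ascale ?A c x) (ascale ?A c y)"
    using F G by (simp add: s) (intro congI, simp add: vec_eq_iff algebra_simps)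
  show "amult ?A (ascale ?A c x) y = ascale ?A c (amult ?A x y)"
    using F G by (simp add: s)
      (intro congI, simp add: vec_eq_iff matrix_matrix_mult_def sum_distrib_left mult.assoc)
  show "amult ?A x (ascale ?A c y) = ascale ?A c (amult ?A x y)"
    using F G by (simp add: s)
      (intro congI, simp add: vec_eq_iff matrix_matrix_mult_def sum_distrib_left mult_ac)
  show "astar ?A (aadd ?A x y) = aadd ?A (astar ?A x) (astar ?A y)"
    using F G by (simp add: s) (intro congI, simp add: vec_eq_iff adjoint_matrix_def)
  show "astar ?A (amult ?A x y) = amult ?A (astar ?A y) (astar ?A x)"
    using F G by (simp add: s)
      (intro congI, simp add: vec_eq_iff adjoint_matrix_def matrix_matrix_mult_def mult.commute)
  show "anorm ?A (aadd ?A x y) \<le> anorm ?A x + anorm ?A y"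
    using F G by (simp add: s operator_norm_add)
  show "anorm ?A (amult ?A x y) \<le> anorm ?A x * anorm ?A y"
    using F G by (simp add: s operator_norm_mult)
  assume z: "z \<in> acarrier ?A"
  obtain H where H: "bounded_matrix M H" "z = mat_class M H" using E[OF z] .
  show "aadd ?A (aadd ?A x y) z = aadd ?A x (aadd ?A y z)"
    using F G H by (simp add: s add.assoc)
  show "amult ?A (amult ?A x y) z = amult ?A x (amult ?A y z)"
    using F G H by (simp add: s matrix_mul_assoc)
  show "amult ?A x (aadd ?A y z) = aadd ?A (amult ?A x y) (amult ?A x z)"
    using F G H by (simp add: s matrix_add_ldistrib)
  show "amult ?A (aadd ?A x y) z = aadd ?A (amult ?A x z) (amult ?A y z)"
    using F G H by (simp add: s)
      (intro congI, simp add: vec_eq_iff matrix_matrix_mult_def algebra_simps sum.distrib)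
next
  fix X :: "nat \<Rightarrow> ('a \<Rightarrow> complex) set^'h^'h"
  assume X: "\<And>k. X k \<in> acarrier ?A"
    and Cauchy: "\<forall>\<epsilon>>0. \<exists>K. \<forall>j\<ge>K. \<forall>k\<ge>K. adist ?A (X j) (X k) < \<epsilon>"
  have "\<forall>k. \<exists>F. bounded_matrix M F \<and> X k = mat_class M F"
    using matrix_algebra_carrierE[OF X] by metis
  then obtain F where F: "\<And>k. bounded_matrix M (F k)" "\<And>k. X k = mat_class M (F k)" by metis
  have "\<exists>G. bounded_matrix M G \<and> (\<lambda>k. operator_norm M (\<lambda>\<xi>. F k \<xi> - G \<xi>)) \<longlonglongrightarrow> 0"
    using Cauchy by (intro operator_norm_complete F(1)) (simp add: F adist_mat_class)
  then obtain G where G: "bounded_matrix M G" "(\<lambda>k. operator_norm M (\<lambda>\<xi>. F k \<xi> - G \<xi>)) \<longlonglongrightarrow> 0"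
    by blast
  then show "\<exists>x\<in>acarrier ?A. (\<lambda>k. adist ?A (X k) x) \<longlonglongrightarrow> 0"
    by (intro bexI[of _ "mat_class M G"]) (simp_all add: F adist_mat_class mat_class_in_carrier)
qed

end

section \<open>The Fourier transform\<close>

lemma dual_groupD:
  assumes "\<xi> \<in> dual_group"
  shows dual_group_norm: "cmod (\<xi> n) = 1"
    and dual_group_add: "\<xi> (m + n) = \<xi> m * \<xi> n"
    and dual_group_zero: "\<xi> 0 = 1"
    and dual_group_minus: "\<xi> (- n) = cnj (\<xi> n)"
proof -
  show n: "cmod (\<xi> n) = 1" and a: "\<xi> (m + n) = \<xi> m * \<xi> n" for m n
    using assms by (simp_all add: dual_group_def)
  have nz: "\<xi> n \<noteq> 0" for n using n[of n] by auto
  have "\<xi> 0 * \<xi> 0 = \<xi> 0" using a[of 0 0] by simp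
  then show z: "\<xi> 0 = 1" using nz[of 0] by simp
  have "\<xi> n * \<xi> (- n) = 1" using a[of n "- n"] z by simp
  moreover have "\<xi> n * cnj (\<xi> n) = 1" using n[of n] by (simp add: complex_norm_square[symmetric])
  ultimately have "\<xi> n * \<xi> (- n) = \<xi> n * cnj (\<xi> n)" by simp
  then show "\<xi> (- n) = cnj (\<xi> n)" using nz[of n] by simp
qed

lemma dual_group_cnj: "\<zeta> \<in> dual_group \<Longrightarrow> (\<lambda>n. cnj (\<zeta> n)) \<in> dual_group"
  by (simp add: dual_group_def)

text \<open>The sign agrees with \<open>fourier_l1\<close>: this is the transform of the function
  that equals \<open>c\<close> on a finite set \<open>F\<close> and 0 elsewhere.\<close>

definition trig_poly :: "'n set \<Rightarrow> ('n::ab_group_add \<Rightarrow> complex) \<Rightarrow> ('n \<Rightarrow> complex) \<Rightarrow> complex" where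
  "trig_poly F c \<xi> = (\<Sum>n\<in>F. c n * \<xi> (- n))"

text \<open>Integrating against \<open>\<xi> n\<close> extracts the coefficient of
  \<open>\<xi> (- n)\<close>, since the latter is the conjugate of the former on the dual
  group.\<close>

definition fourier_coeff ::
  "('n::ab_group_add \<Rightarrow> complex) measure \<Rightarrow> (('n \<Rightarrow> complex) \<Rightarrow> complex) \<Rightarrow> 'n \<Rightarrow> complex" where
  "fourier_coeff \<mu> g n = (\<integral>\<xi>. g \<xi> * \<xi> n \<partial>\<mu>)"

text \<open>The closed linear span of the characters; that it is all of \<open>L\<^sup>2\<close> is never needed.\<close>

definition character_span ::
  "('n::ab_group_add \<Rightarrow> complex) measure \<Rightarrow> (('n \<Rightarrow> complex) \<Rightarrow> complex) set" where
  "character_span \<mu> = {g. L2_fun \<mu> g \<and>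
     (\<forall>\<epsilon>>0. \<exists>F c. finite F \<and> L2n \<mu> (\<lambda>\<xi>. g \<xi> - trig_poly F c \<xi>) < \<epsilon>)}"

lemma L2_fun_cong:
  assumes "\<And>\<xi>. \<xi> \<in> space \<mu> \<Longrightarrow> f \<xi> = g \<xi>"
  shows "L2_fun \<mu> f \<longleftrightarrow> L2_fun \<mu> g" "L2n \<mu> f = L2n \<mu> g"
proof -
  have "f \<in> borel_measurable \<mu> \<longleftrightarrow> g \<in> borel_measurable \<mu>"
    using assms by (rule measurable_cong)
  moreover have "integrable \<mu> (\<lambda>\<xi>. (norm (f \<xi>))\<^sup>2) \<longleftrightarrow> integrable \<mu> (\<lambda>\<xi>. (norm (g \<xi>))\<^sup>2)"
    using assms by (intro Bochner_Integration.integrable_cong) auto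
  ultimately show "L2_fun \<mu> f \<longleftrightarrow> L2_fun \<mu> g" by (simp add: L2_fun_def)
  have "(\<integral>\<xi>. (norm (f \<xi>))\<^sup>2 \<partial>\<mu>) = (\<integral>\<xi>. (norm (g \<xi>))\<^sup>2 \<partial>\<mu>)"
    using assms by (intro Bochner_Integration.integral_cong) auto
  then show "L2n \<mu> f = L2n \<mu> g" by (simp add: L2n_def)
qed

lemma infsum_outside_finite:
  fixes f :: "'a \<Rightarrow> 'b::{topological_ab_group_add, t2_space}"
  assumes "f summable_on UNIV" "finite F"
  shows "f summable_on (- F)" "infsum f (- F) = infsum f UNIV - sum f F"
proof -
  have "(f has_sum (infsum f UNIV - sum f F)) (UNIV - F)"
    using assms by (intro has_sum_Diff) auto
  then show "f summable_on (- F)" "infsum f (- F) = infsum f UNIV - sum f F"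
    by (auto simp: Compl_eq_Diff_UNIV has_sum_iff)
qed

section \<open>Haar measure and orthogonality of characters\<close>

locale haar_measure =
  fixes \<mu> :: "('n::ab_group_add \<Rightarrow> complex) measure"
  assumes haar: "normalized_haar \<mu>"
begin

lemma sets_mu: "sets \<mu> = sets (restrict_space borel dual_group)"
  using haar by (simp add: normalized_haar_def)

lemma space_mu: "space \<mu> = dual_group"
  using sets_eq_imp_space_eq[OF sets_mu] by (simp add: space_restrict_space)

sublocale prob_space \<mu>
  by (rule prob_spaceI) (use haar in \<open>simp add: normalized_haar_def\<close>)

lemma evaluation_measurable [measurable]: "(\<lambda>\<xi>. \<xi> n) \<in> borel_measurable \<mu>"
proof -
  have "(\<lambda>\<xi>::'n \<Rightarrow> complex. \<xi> n) \<in> borel_measurable borel"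
    by (intro borel_measurable_continuous_onI continuous_on_product_coordinates)
  then have "(\<lambda>\<xi>. \<xi> n) \<in> borel_measurable (restrict_space borel (dual_group :: ('n \<Rightarrow> complex) set))"
    by (rule measurable_restrict_space1)
  then show ?thesis
    using measurable_cong_sets[OF sets_mu refl] by blast
qed

lemma translation_measurable:
  assumes \<zeta>: "\<zeta> \<in> dual_group"
  shows "(\<lambda>\<xi> n. \<zeta> n * \<xi> n) \<in> measurable \<mu> \<mu>"
proof -
  have "(\<lambda>(\<xi>::'n \<Rightarrow> complex) n. \<zeta> n * \<xi> n) \<in> borel_measurable borel"
    by (intro borel_measurable_continuous_onI continuous_on_coordinatewise_then_product
        continuous_on_mult continuous_on_const continuous_on_product_coordinates)
  then have "(\<lambda>\<xi> n. \<zeta> n * \<xi> n) \<in>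
      measurable (restrict_space borel dual_group) (restrict_space borel dual_group)"
    using \<zeta> by (intro measurable_restrict_space2 measurable_restrict_space1)
      (auto simp: dual_group_def space_restrict_space norm_mult)
  then show ?thesis
    using measurable_cong_sets[OF sets_mu sets_mu] by blast
qed

lemma emeasure_translation:
  assumes "\<zeta> \<in> dual_group" "A \<in> sets \<mu>"
  shows "emeasure \<mu> ((\<lambda>\<xi> n. \<zeta> n * \<xi> n) ` A) = emeasure \<mu> A"
proof -
  have "\<forall>\<zeta>\<in>dual_group. \<forall>A\<in>sets \<mu>. emeasure \<mu> ((\<lambda>\<xi> n. \<zeta> n * \<xi> n) ` A) = emeasure \<mu> A"
    using haar unfolding normalized_haar_def by (elim conjE)
  then show ?thesis using assms by simp
qed

text \<open>The preimage of a set under translation by \<open>\<zeta>\<close> is its image under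
  translation by the conjugate character, so invariance of images becomes invariance of the
  push-forward, the form in which integrals can be transformed.\<close>

lemma distr_translation:
  assumes \<zeta>: "\<zeta> \<in> dual_group"
  shows "distr \<mu> \<mu> (\<lambda>\<xi> n. \<zeta> n * \<xi> n) = \<mu>"
proof (rule measure_eqI)
  fix A assume "A \<in> sets (distr \<mu> \<mu> (\<lambda>\<xi> n. \<zeta> n * \<xi> n))"
  then have A: "A \<in> sets \<mu>" by simp
  have inv: "\<zeta> n * cnj (\<zeta> n) = 1" for n
    using dual_group_norm[OF \<zeta>, of n] by (simp add: complex_norm_square[symmetric])
  have inv': "\<zeta> n * (cnj (\<zeta> n) * c) = c" "cnj (\<zeta> n) * (\<zeta> n * c) = c" for n c
    using inv[of n] by (simp_all add: mult.assoc[symmetric] mult.commute[of "cnj (\<zeta> n)"])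
  have "(\<lambda>\<xi> n. \<zeta> n * \<xi> n) -` A \<inter> space \<mu> = (\<lambda>\<xi> n. cnj (\<zeta> n) * \<xi> n) ` A"
  proof (intro equalityI subsetI)
    fix \<xi> assume "\<xi> \<in> (\<lambda>\<xi> n. \<zeta> n * \<xi> n) -` A \<inter> space \<mu>"
    then have "(\<lambda>n. \<zeta> n * \<xi> n) \<in> A" by simp
    moreover have "\<xi> = (\<lambda>n. cnj (\<zeta> n) * (\<zeta> n * \<xi> n))" by (simp add: inv')
    ultimately show "\<xi> \<in> (\<lambda>\<xi> n. cnj (\<zeta> n) * \<xi> n) ` A"
      by (intro image_eqI[where x = "\<lambda>n. \<zeta> n * \<xi> n"])
  next
    fix \<xi> assume "\<xi> \<in> (\<lambda>\<xi> n. cnj (\<zeta> n) * \<xi> n) ` A"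
    then obtain \<eta> where \<eta>: "\<eta> \<in> A" "\<xi> = (\<lambda>n. cnj (\<zeta> n) * \<eta> n)" by blast
    have "\<eta> \<in> dual_group" using \<eta>(1) sets.sets_into_space[OF A] space_mu by blast
    then have "\<xi> \<in> dual_group"
      using dual_group_cnj[OF \<zeta>] by (auto simp: \<eta>(2) dual_group_def norm_mult)
    moreover have "(\<lambda>n. \<zeta> n * \<xi> n) = \<eta>" by (simp add: \<eta>(2) inv')
    ultimately show "\<xi> \<in> (\<lambda>\<xi> n. \<zeta> n * \<xi> n) -` A \<inter> space \<mu>" using \<eta>(1) space_mu by simp
  qed
  then have "emeasure (distr \<mu> \<mu> (\<lambda>\<xi> n. \<zeta> n * \<xi> n)) A = emeasure \<mu> ((\<lambda>\<xi> n. cnj (\<zeta> n) * \<xi> n) ` A)"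
    using A by (simp add: emeasure_distr[OF translation_measurable[OF \<zeta>]])
  also have "\<dots> = emeasure \<mu> A"
    by (rule emeasure_translation[OF dual_group_cnj[OF \<zeta>] A])
  finally show "emeasure (distr \<mu> \<mu> (\<lambda>\<xi> n. \<zeta> n * \<xi> n)) A = emeasure \<mu> A" .
qed simp

text \<open>Translation by \<open>\<zeta>\<close> multiplies the integral by
  \<open>\<zeta> n\<close>; a character with \<open>\<zeta> n \<noteq> 1\<close> therefore forces it
  to vanish.\<close>

lemma integral_character: "(\<integral>\<xi>. \<xi> n \<partial>\<mu>) = (if n = 0 then 1 else 0)"
proof (cases "n = 0")
  case True
  have "(\<integral>\<xi>. \<xi> n \<partial>\<mu>) = (\<integral>\<xi>. 1 \<partial>\<mu>)"
    using True by (intro Bochner_Integration.integral_cong) (auto simp: space_mu dual_group_zero)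
  then show ?thesis using True by (simp add: prob_space)
next
  case False
  then obtain \<zeta> :: "'n \<Rightarrow> complex" where \<zeta>: "\<zeta> \<in> dual_group" "\<zeta> n \<noteq> 1"
    using characters_separate_points by blast
  have "(\<integral>\<xi>. \<xi> n \<partial>\<mu>) = (\<integral>\<xi>. \<xi> n \<partial>distr \<mu> \<mu> (\<lambda>\<xi> n. \<zeta> n * \<xi> n))"
    by (simp add: distr_translation[OF \<zeta>(1)])
  also have "\<dots> = (\<integral>\<xi>. \<zeta> n * \<xi> n \<partial>\<mu>)"
    by (rule integral_distr[OF translation_measurable[OF \<zeta>(1)] evaluation_measurable])
  also have "\<dots> = \<zeta> n * (\<integral>\<xi>. \<xi> n \<partial>\<mu>)" by simp
  finally have "(1 - \<zeta> n) * (\<integral>\<xi>. \<xi> n \<partial>\<mu>) = 0" by (simp add: algebra_simps)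
  then show ?thesis using \<zeta>(2) False by simp
qed

section \<open>Fourier coefficients of square-integrable functions\<close>

lemma L2_fun_bounded:
  assumes "g \<in> borel_measurable \<mu>" "AE \<xi> in \<mu>. cmod (g \<xi>) \<le> C" "0 \<le> C"
  shows "L2_fun \<mu> g" "L2n \<mu> g \<le> C"
  using L2_fun_dominated[OF L2_fun_const(1)[of "1::complex"] assms(1), of C] assms
    L2_fun_const(2)[of "1::complex"] by simp_all

lemma AE_dual_group: "(\<And>\<xi>. \<xi> \<in> dual_group \<Longrightarrow> P \<xi>) \<Longrightarrow> AE \<xi> in \<mu>. P \<xi>"
  by (rule AE_I2) (simp add: space_mu)

lemma L2_fun_mult_bounded:
  assumes g: "L2_fun \<mu> g" and b: "b \<in> borel_measurable \<mu>" "AE \<xi> in \<mu>. cmod (b \<xi>) \<le> C"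
    and C: "0 \<le> C"
  shows "L2_fun \<mu> (\<lambda>\<xi>. g \<xi> * b \<xi>)" "L2n \<mu> (\<lambda>\<xi>. g \<xi> * b \<xi>) \<le> C * L2n \<mu> g"
proof -
  have m: "(\<lambda>\<xi>. g \<xi> * b \<xi>) \<in> borel_measurable \<mu>"
    by (intro borel_measurable_times L2_fun_measurable g b)
  have "AE \<xi> in \<mu>. cmod (g \<xi> * b \<xi>) \<le> C * cmod (g \<xi>)"
    using b(2) by eventually_elim (simp add: norm_mult mult.commute mult_right_mono)
  then show "L2_fun \<mu> (\<lambda>\<xi>. g \<xi> * b \<xi>)" "L2n \<mu> (\<lambda>\<xi>. g \<xi> * b \<xi>) \<le> C * L2n \<mu> g"
    using L2_fun_dominated[OF g m _ C] by blast+
qed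

lemma L2_fun_character_mult:
  assumes "L2_fun \<mu> g"
  shows "L2_fun \<mu> (\<lambda>\<xi>. g \<xi> * \<xi> n)" "L2n \<mu> (\<lambda>\<xi>. g \<xi> * \<xi> n) \<le> L2n \<mu> g"
  using L2_fun_mult_bounded[OF assms evaluation_measurable[of n] AE_dual_group, of 1]
  by (simp_all add: dual_group_norm)

lemma L2_fun_character: "L2_fun \<mu> (\<lambda>\<xi>. \<xi> n)" "L2n \<mu> (\<lambda>\<xi>. \<xi> n) \<le> 1"
  using L2_fun_character_mult[OF L2_fun_const(1)[of 1], of n] L2_fun_const(2)[of "1::complex"]
  by simp_all

lemma L2_fun_mult_const:
  fixes g :: "('n \<Rightarrow> complex) \<Rightarrow> complex"
  assumes "L2_fun \<mu> g"
  shows "L2_fun \<mu> (\<lambda>\<xi>. c * g \<xi>)"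
  using L2_fun_mult_bounded(1)[OF assms, of "\<lambda>_. c" "cmod c"]
  by (simp add: mult.commute)

lemma L2n_mult_const: "L2n \<mu> (\<lambda>\<xi>. c * g \<xi>) = cmod c * L2n \<mu> g"
  by (simp add: L2n_def norm_mult power_mult_distrib real_sqrt_mult)

lemma integrable_coeff: "L2_fun \<mu> g \<Longrightarrow> integrable \<mu> (\<lambda>\<xi>. g \<xi> * \<xi> n)"
  by (rule L2_fun_integrable_times(1)[OF _ L2_fun_character(1)])

lemma L2_fun_trig_poly: "L2_fun \<mu> (trig_poly F c)"
  unfolding trig_poly_def[abs_def]
  by (intro L2_fun_sum L2_fun_mult_const L2_fun_character)

lemma fourier_coeff_bound:
  assumes "L2_fun \<mu> g"
  shows "cmod (fourier_coeff \<mu> g n) \<le> L2n \<mu> g"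
proof -
  have "cmod (fourier_coeff \<mu> g n) \<le> L2n \<mu> g * L2n \<mu> (\<lambda>\<xi>. \<xi> n)"
    unfolding fourier_coeff_def by (rule L2_fun_integrable_times(2)[OF assms L2_fun_character(1)])
  also have "\<dots> \<le> L2n \<mu> g * 1"
    by (intro mult_left_mono L2_fun_character(2)) simp
  finally show ?thesis by simp
qed

lemma fourier_coeff_add:
  "L2_fun \<mu> f \<Longrightarrow> L2_fun \<mu> g \<Longrightarrow>
    fourier_coeff \<mu> (\<lambda>\<xi>. f \<xi> + g \<xi>) n = fourier_coeff \<mu> f n + fourier_coeff \<mu> g n"
  by (simp add: fourier_coeff_def distrib_right integrable_coeff)

lemma fourier_coeff_diff:
  "L2_fun \<mu> f \<Longrightarrow> L2_fun \<mu> g \<Longrightarrow>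
    fourier_coeff \<mu> (\<lambda>\<xi>. f \<xi> - g \<xi>) n = fourier_coeff \<mu> f n - fourier_coeff \<mu> g n"
  by (simp add: fourier_coeff_def left_diff_distrib integrable_coeff)

lemma fourier_coeff_scale: "fourier_coeff \<mu> (\<lambda>\<xi>. c * g \<xi>) n = c * fourier_coeff \<mu> g n"
  by (simp add: fourier_coeff_def mult.assoc)

lemma fourier_coeff_sum:
  assumes "\<And>i. i \<in> I \<Longrightarrow> L2_fun \<mu> (f i)"
  shows "fourier_coeff \<mu> (\<lambda>\<xi>. \<Sum>i\<in>I. f i \<xi>) n = (\<Sum>i\<in>I. fourier_coeff \<mu> (f i) n)"
  unfolding fourier_coeff_def sum_distrib_right
  by (intro Bochner_Integration.integral_sum integrable_coeff assms)

lemma fourier_coeff_cong_AE: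
  assumes "f \<in> borel_measurable \<mu>" "g \<in> borel_measurable \<mu>" "AE \<xi> in \<mu>. f \<xi> = g \<xi>"
  shows "fourier_coeff \<mu> f n = fourier_coeff \<mu> g n"
  unfolding fourier_coeff_def
proof (rule integral_cong_AE)
  show "AE \<xi> in \<mu>. f \<xi> * \<xi> n = g \<xi> * \<xi> n"
    using assms(3) by eventually_elim simp
qed (use assms in auto)

lemma fourier_coeff_shift:
  "fourier_coeff \<mu> (\<lambda>\<xi>. \<xi> m * g \<xi>) n = fourier_coeff \<mu> g (m + n)"
  unfolding fourier_coeff_def
  by (intro Bochner_Integration.integral_cong) (auto simp: space_mu dual_group_add mult_ac)

lemma fourier_coeff_cnj: "fourier_coeff \<mu> (\<lambda>\<xi>. cnj (g \<xi>)) n = cnj (fourier_coeff \<mu> g (- n))"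
proof -
  have "fourier_coeff \<mu> (\<lambda>\<xi>. cnj (g \<xi>)) n = (\<integral>\<xi>. cnj (g \<xi> * \<xi> (- n)) \<partial>\<mu>)"
    unfolding fourier_coeff_def
    by (intro Bochner_Integration.integral_cong) (auto simp: space_mu dual_group_minus)
  then show ?thesis by (simp add: fourier_coeff_def del: complex_cnj_mult)
qed

lemma fourier_coeff_trig_poly:
  assumes "finite F"
  shows "fourier_coeff \<mu> (trig_poly F c) n = (if n \<in> F then c n else 0)"
proof -
  have "fourier_coeff \<mu> (trig_poly F c) n = (\<Sum>m\<in>F. fourier_coeff \<mu> (\<lambda>\<xi>. c m * \<xi> (- m)) n)"
    unfolding trig_poly_def[abs_def]
    by (intro fourier_coeff_sum L2_fun_mult_const L2_fun_character)
  also have "\<dots> = (\<Sum>m\<in>F. c m * fourier_coeff \<mu> (\<lambda>\<xi>. \<xi> (- m) * 1) n)"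
    by (simp add: fourier_coeff_scale)
  also have "\<dots> = (\<Sum>m\<in>F. c m * (if n = m then 1 else 0))"
    unfolding fourier_coeff_shift by (simp add: fourier_coeff_def integral_character)
  finally show ?thesis using assms by (simp add: if_distrib cong: if_cong)
qed

lemma integral_mult_cnj_trig_poly:
  assumes g: "L2_fun \<mu> g"
  shows "(\<integral>\<xi>. g \<xi> * cnj (trig_poly F c \<xi>) \<partial>\<mu>) = (\<Sum>n\<in>F. cnj (c n) * fourier_coeff \<mu> g n)"
proof -
  have "(\<integral>\<xi>. g \<xi> * cnj (trig_poly F c \<xi>) \<partial>\<mu>) = (\<integral>\<xi>. (\<Sum>n\<in>F. cnj (c n) * (g \<xi> * \<xi> n)) \<partial>\<mu>)"
    by (intro Bochner_Integration.integral_cong)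
      (auto simp: space_mu dual_group_minus trig_poly_def sum_distrib_left mult_ac)
  then show ?thesis by (simp add: fourier_coeff_def integrable_coeff[OF g])
qed

lemma L2n_power2_cnj: "complex_of_real ((L2n \<mu> g)\<^sup>2) = (\<integral>\<xi>. g \<xi> * cnj (g \<xi>) \<partial>\<mu>)"
  unfolding L2n_power2 integral_complex_of_real[symmetric] complex_norm_square ..

lemma L2_fun_cnj: "L2_fun \<mu> g \<Longrightarrow> L2_fun \<mu> (\<lambda>\<xi>. cnj (g \<xi>))"
  unfolding L2_fun_def
  using borel_measurable_continuous_on[OF continuous_on_cnj[OF continuous_on_id], of g] by simp

text \<open>Pythagoras for the orthonormal characters, after completing the square. Among
  polynomials with frequencies in \<open>F\<close> the coefficients of \<open>g\<close> give the
  best approximation, and its error does not grow when \<open>F\<close> does.\<close>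

lemma L2n_diff_trig_poly:
  assumes g: "L2_fun \<mu> g" and F: "finite F"
  shows "(L2n \<mu> (\<lambda>\<xi>. g \<xi> - trig_poly F c \<xi>))\<^sup>2 = (L2n \<mu> g)\<^sup>2
    - (\<Sum>n\<in>F. (cmod (fourier_coeff \<mu> g n))\<^sup>2) + (\<Sum>n\<in>F. (cmod (fourier_coeff \<mu> g n - c n))\<^sup>2)"
proof -
  note t = L2_fun_trig_poly[of F c]
  note int = L2_fun_integrable_times(1)
  define I where "I = (\<Sum>n\<in>F. cnj (c n) * fourier_coeff \<mu> g n)"
  have gt: "(\<integral>\<xi>. g \<xi> * cnj (trig_poly F c \<xi>) \<partial>\<mu>) = I"
    unfolding I_def by (rule integral_mult_cnj_trig_poly[OF g])
  have tg: "(\<integral>\<xi>. trig_poly F c \<xi> * cnj (g \<xi>) \<partial>\<mu>) = cnj I"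
  proof -
    have "(\<integral>\<xi>. trig_poly F c \<xi> * cnj (g \<xi>) \<partial>\<mu>) = (\<integral>\<xi>. cnj (g \<xi> * cnj (trig_poly F c \<xi>)) \<partial>\<mu>)"
      by (simp add: mult.commute)
    then show ?thesis unfolding gt[symmetric] by (simp only: Bochner_Integration.integral_cnj)
  qed
  have tt: "(\<integral>\<xi>. trig_poly F c \<xi> * cnj (trig_poly F c \<xi>) \<partial>\<mu>) = (\<Sum>n\<in>F. cnj (c n) * c n)"
    unfolding integral_mult_cnj_trig_poly[OF t]
    by (intro sum.cong) (auto simp: fourier_coeff_trig_poly[OF F])
  \<comment> \<open>The expansion is carried out over the complex numbers, with a product by the
    conjugate in place of the squared modulus; \<open>I\<close> and \<open>cnj I\<close> are the
    cross terms.\<close>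
  have "complex_of_real ((L2n \<mu> (\<lambda>\<xi>. g \<xi> - trig_poly F c \<xi>))\<^sup>2) =
     (\<integral>\<xi>. (g \<xi> * cnj (g \<xi>) - g \<xi> * cnj (trig_poly F c \<xi>)) -
       (trig_poly F c \<xi> * cnj (g \<xi>) - trig_poly F c \<xi> * cnj (trig_poly F c \<xi>)) \<partial>\<mu>)"
    unfolding L2n_power2_cnj by (simp add: algebra_simps)
  also have "\<dots> = complex_of_real ((L2n \<mu> g)\<^sup>2) - I - (cnj I - (\<Sum>n\<in>F. cnj (c n) * c n))"
    unfolding L2n_power2_cnj
    by (simp add: gt tg tt int[OF g L2_fun_cnj[OF g]] int[OF g L2_fun_cnj[OF t]]
        int[OF t L2_fun_cnj[OF g]] int[OF t L2_fun_cnj[OF t]])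
  also have "\<dots> = complex_of_real ((L2n \<mu> g)\<^sup>2 - (\<Sum>n\<in>F. (cmod (fourier_coeff \<mu> g n))\<^sup>2)
      + (\<Sum>n\<in>F. (cmod (fourier_coeff \<mu> g n - c n))\<^sup>2))"
    unfolding I_def of_real_diff of_real_add of_real_sum complex_norm_square cnj_sum
    by (simp add: algebra_simps sum.distrib sum_subtractf)
  finally show ?thesis by (simp only: of_real_eq_iff)
qed

section \<open>Partial sums and Parseval's identity\<close>

lemma character_span_L2: "g \<in> character_span \<mu> \<Longrightarrow> L2_fun \<mu> g"
  by (simp add: character_span_def)

text \<open>By best approximation the partial sum over any finite \<open>F\<close> containing
  \<open>F0\<close> is at least as close to \<open>g\<close> as any polynomial with frequencies in
  \<open>F0\<close>. The mere existence of approximants thus becomes convergence of the partial sums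
  along finite sets.\<close>

lemma character_span_partial_sums:
  assumes g: "g \<in> character_span \<mu>"
  shows "((\<lambda>F. L2n \<mu> (\<lambda>\<xi>. g \<xi> - trig_poly F (fourier_coeff \<mu> g) \<xi>)) \<longlongrightarrow> 0)
    (finite_subsets_at_top UNIV)"
proof (rule tendstoI)
  fix e :: real assume e: "0 < e"
  note g2 = character_span_L2[OF g]
  obtain F0 c where F0: "finite F0" "L2n \<mu> (\<lambda>\<xi>. g \<xi> - trig_poly F0 c \<xi>) < e"
    using g e unfolding character_span_def by blast
  have "L2n \<mu> (\<lambda>\<xi>. g \<xi> - trig_poly F (fourier_coeff \<mu> g) \<xi>) < e"
    if F: "finite F" "F0 \<subseteq> F" for F
  proof -
    have "(L2n \<mu> (\<lambda>\<xi>. g \<xi> - trig_poly F (fourier_coeff \<mu> g) \<xi>))\<^sup>2 =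
        (L2n \<mu> g)\<^sup>2 - (\<Sum>n\<in>F. (cmod (fourier_coeff \<mu> g n))\<^sup>2)"
      using L2n_diff_trig_poly[OF g2 F(1), of "fourier_coeff \<mu> g"] by simp
    also have "\<dots> \<le> (L2n \<mu> g)\<^sup>2 - (\<Sum>n\<in>F0. (cmod (fourier_coeff \<mu> g n))\<^sup>2)"
      using F by (simp add: sum_mono2)
    also have "\<dots> \<le> (L2n \<mu> (\<lambda>\<xi>. g \<xi> - trig_poly F0 c \<xi>))\<^sup>2"
      using L2n_diff_trig_poly[OF g2 F0(1), of c] by (simp add: sum_nonneg)
    finally show ?thesis using F0(2) by (meson L2n_nonneg le_less_trans power2_le_imp_le)
  qed
  then show "\<forall>\<^sub>F F in finite_subsets_at_top UNIV.
      dist (L2n \<mu> (\<lambda>\<xi>. g \<xi> - trig_poly F (fourier_coeff \<mu> g) \<xi>)) 0 < e"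
    using F0(1) by (auto simp: eventually_finite_subsets_at_top)
qed

text \<open>With the coefficients of \<open>g\<close> for \<open>c\<close>,
  \<open>L2n_diff_trig_poly\<close> identifies the deficit in Bessel's inequality with the squared
  error of the partial sum, which tends to 0.\<close>

lemma Parseval:
  assumes g: "g \<in> character_span \<mu>"
  shows "((\<lambda>n. (cmod (fourier_coeff \<mu> g n))\<^sup>2) has_sum (L2n \<mu> g)\<^sup>2) UNIV"
proof -
  have "((\<lambda>F. (L2n \<mu> g)\<^sup>2 - (L2n \<mu> (\<lambda>\<xi>. g \<xi> - trig_poly F (fourier_coeff \<mu> g) \<xi>))\<^sup>2) \<longlongrightarrow>
      (L2n \<mu> g)\<^sup>2 - 0\<^sup>2) (finite_subsets_at_top UNIV)"
    by (intro tendsto_intros character_span_partial_sums g)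
  moreover have "\<forall>\<^sub>F F in finite_subsets_at_top UNIV.
      (L2n \<mu> g)\<^sup>2 - (L2n \<mu> (\<lambda>\<xi>. g \<xi> - trig_poly F (fourier_coeff \<mu> g) \<xi>))\<^sup>2 =
      (\<Sum>n\<in>F. (cmod (fourier_coeff \<mu> g n))\<^sup>2)"
    using L2n_diff_trig_poly[OF character_span_L2[OF g], of _ "fourier_coeff \<mu> g"]
    by (intro eventually_finite_subsets_at_top_weakI) simp
  ultimately show ?thesis
    unfolding has_sum_def by (simp add: filterlim_cong)
qed

lemma summable2_fourier_coeff: "g \<in> character_span \<mu> \<Longrightarrow> summable2 (fourier_coeff \<mu> g)"
  unfolding summable2_def by (rule has_sum_imp_summable[OF Parseval])

lemma l2_norm_fourier_coeff: "g \<in> character_span \<mu> \<Longrightarrow> l2_norm (fourier_coeff \<mu> g) = L2n \<mu> g"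
  unfolding l2_norm_def by (simp add: infsumI[OF Parseval])

section \<open>Stability of the closed span\<close>

lemma character_span_closed:
  assumes g: "L2_fun \<mu> g"
    and approx: "\<And>\<epsilon>. 0 < \<epsilon> \<Longrightarrow> \<exists>h\<in>character_span \<mu>. L2n \<mu> (\<lambda>\<xi>. g \<xi> - h \<xi>) < \<epsilon>"
  shows "g \<in> character_span \<mu>"
proof -
  have "\<exists>F c. finite F \<and> L2n \<mu> (\<lambda>\<xi>. g \<xi> - trig_poly F c \<xi>) < \<epsilon>" if "0 < \<epsilon>" for \<epsilon>
  proof -
    have e2: "0 < \<epsilon> / 2" using that by simp
    then obtain h where h: "h \<in> character_span \<mu>" "L2n \<mu> (\<lambda>\<xi>. g \<xi> - h \<xi>) < \<epsilon> / 2"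
      using approx by blast
    obtain F c where F: "finite F" "L2n \<mu> (\<lambda>\<xi>. h \<xi> - trig_poly F c \<xi>) < \<epsilon> / 2"
      using e2 h(1) unfolding character_span_def by blast
    have "L2n \<mu> (\<lambda>\<xi>. g \<xi> - trig_poly F c \<xi>) < \<epsilon>"
      using L2n_triangle_diff[OF g character_span_L2[OF h(1)] L2_fun_trig_poly[of F c]] h(2) F(2)
      by linarith
    then show ?thesis using F(1) by blast
  qed
  then show ?thesis using g by (simp add: character_span_def)
qed

lemma trig_poly_in_character_span:
  assumes "finite F"
  shows "trig_poly F c \<in> character_span \<mu>"
proof -
  have "\<exists>F' c'. finite F' \<and> L2n \<mu> (\<lambda>\<xi>. trig_poly F c \<xi> - trig_poly F' c' \<xi>) < e" if "0 < e" for e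
    using that assms by (intro exI[of _ F] exI[of _ c]) (simp add: L2n_def)
  then show ?thesis by (simp add: character_span_def L2_fun_trig_poly)
qed

lemma character_span_cong_AE:
  assumes g: "g \<in> borel_measurable \<mu>" and eq: "AE \<xi> in \<mu>. g \<xi> = f \<xi>"
    and f: "f \<in> character_span \<mu>"
  shows "g \<in> character_span \<mu>"
proof (rule character_span_closed)
  have le: "AE \<xi> in \<mu>. cmod (g \<xi>) \<le> 1 * cmod (f \<xi>)"
    using eq by eventually_elim simp
  show g2: "L2_fun \<mu> g"
    by (rule L2_fun_dominated(1)[OF character_span_L2[OF f] g le]) simp
  have "AE \<xi> in \<mu>. g \<xi> - f \<xi> = 0" using eq by eventually_elim simp
  then have "L2n \<mu> (\<lambda>\<xi>. g \<xi> - f \<xi>) = 0"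
    using L2n_eq_0_iff[OF L2_fun_diff[OF g2 character_span_L2[OF f]]] by simp
  then show "\<exists>h\<in>character_span \<mu>. L2n \<mu> (\<lambda>\<xi>. g \<xi> - h \<xi>) < \<epsilon>" if "0 < \<epsilon>" for \<epsilon>
    using f that by (intro bexI[of _ f]) auto
qed

lemma character_span_scale:
  assumes g: "g \<in> character_span \<mu>"
  shows "(\<lambda>\<xi>. c * g \<xi>) \<in> character_span \<mu>"
proof -
  have "\<exists>F d. finite F \<and> L2n \<mu> (\<lambda>\<xi>. c * g \<xi> - trig_poly F d \<xi>) < e" if e: "0 < e" for e
  proof -
    \<comment> \<open>Adding 1 keeps the divisor positive when \<open>c = 0\<close>.\<close>
    have "0 < e / (cmod c + 1)" using e by (intro divide_pos_pos) (auto intro: add_nonneg_pos)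
    then obtain F d where F: "finite F" "L2n \<mu> (\<lambda>\<xi>. g \<xi> - trig_poly F d \<xi>) < e / (cmod c + 1)"
      using g unfolding character_span_def by blast
    have "(\<lambda>\<xi>. c * g \<xi> - trig_poly F (\<lambda>n. c * d n) \<xi>) = (\<lambda>\<xi>. c * (g \<xi> - trig_poly F d \<xi>))"
      by (simp add: trig_poly_def sum_distrib_left mult.assoc right_diff_distrib)
    then have "L2n \<mu> (\<lambda>\<xi>. c * g \<xi> - trig_poly F (\<lambda>n. c * d n) \<xi>) =
        cmod c * L2n \<mu> (\<lambda>\<xi>. g \<xi> - trig_poly F d \<xi>)"
      by (simp only: L2n_mult_const)
    also have "\<dots> \<le> (cmod c + 1) * L2n \<mu> (\<lambda>\<xi>. g \<xi> - trig_poly F d \<xi>)"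
      by (intro mult_right_mono) auto
    also have "\<dots> < e"
      using F(2) by (simp add: pos_less_divide_eq add_nonneg_pos mult.commute)
    finally show ?thesis using F(1) by blast
  qed
  then show ?thesis using L2_fun_mult_const[OF character_span_L2[OF g]] by (simp add: character_span_def)
qed

lemma character_span_add:
  assumes f: "f \<in> character_span \<mu>" and g: "g \<in> character_span \<mu>"
  shows "(\<lambda>\<xi>. f \<xi> + g \<xi>) \<in> character_span \<mu>"
proof -
  note f2 = character_span_L2[OF f] and g2 = character_span_L2[OF g]
  have "\<exists>F c. finite F \<and> L2n \<mu> (\<lambda>\<xi>. (f \<xi> + g \<xi>) - trig_poly F c \<xi>) < e" if e: "0 < e" for e
  proof -
    have e2: "0 < e / 2" using e by simp
    obtain F c where F: "finite F" "L2n \<mu> (\<lambda>\<xi>. f \<xi> - trig_poly F c \<xi>) < e / 2"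
      using f e2 unfolding character_span_def by blast
    obtain G d where G: "finite G" "L2n \<mu> (\<lambda>\<xi>. g \<xi> - trig_poly G d \<xi>) < e / 2"
      using g e2 unfolding character_span_def by blast
    \<comment> \<open>Each coefficient family is cut off outside its own frequency set, so that both
      polynomials can be summed over the union.\<close>
    define b where "b n = (if n \<in> F then c n else 0) + (if n \<in> G then d n else 0)" for n
    have "trig_poly (F \<union> G) b \<xi> = trig_poly F c \<xi> + trig_poly G d \<xi>" for \<xi>
    proof -
      have "trig_poly (F \<union> G) b \<xi> = (\<Sum>n\<in>F \<union> G. if n \<in> F then c n * \<xi> (- n) else 0) +
          (\<Sum>n\<in>F \<union> G. if n \<in> G then d n * \<xi> (- n) else 0)"
        unfolding trig_poly_def b_def sum.distrib[symmetric] by (intro sum.cong) (auto simp: distrib_right)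
      also have "\<dots> = trig_poly F c \<xi> + trig_poly G d \<xi>"
        unfolding trig_poly_def using F(1) G(1)
        by (simp add: sum.inter_restrict[symmetric] Int_absorb1)
      finally show ?thesis .
    qed
    then have "(\<lambda>\<xi>. (f \<xi> + g \<xi>) - trig_poly (F \<union> G) b \<xi>) =
        (\<lambda>\<xi>. (f \<xi> - trig_poly F c \<xi>) + (g \<xi> - trig_poly G d \<xi>))"
      by (simp add: algebra_simps)
    then have "L2n \<mu> (\<lambda>\<xi>. (f \<xi> + g \<xi>) - trig_poly (F \<union> G) b \<xi>) < e"
      using L2_fun_add(2)[OF L2_fun_diff[OF f2 L2_fun_trig_poly[of F c]]
          L2_fun_diff[OF g2 L2_fun_trig_poly[of G d]]] F(2) G(2) by simp
    then show ?thesis using F(1) G(1) by blast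
  qed
  then show ?thesis using L2_fun_add(1)[OF f2 g2] by (simp add: character_span_def)
qed

lemma character_span_diff:
  assumes f: "f \<in> character_span \<mu>" and g: "g \<in> character_span \<mu>"
  shows "(\<lambda>\<xi>. f \<xi> - g \<xi>) \<in> character_span \<mu>"
  using character_span_add[OF f character_span_scale[OF g, of "-1"]] by simp

lemma character_span_sum:
  assumes "finite I" "\<And>i. i \<in> I \<Longrightarrow> f i \<in> character_span \<mu>"
  shows "(\<lambda>\<xi>. \<Sum>i\<in>I. f i \<xi>) \<in> character_span \<mu>"
  using assms
proof (induction I rule: finite_induct)
  case empty
  show ?case
    using trig_poly_in_character_span[of "{}" "\<lambda>_. 0"] by (simp add: trig_poly_def[abs_def])
next
  case (insert i I)
  then show ?case using character_span_add[of "f i" "\<lambda>\<xi>. \<Sum>i\<in>I. f i \<xi>"] by simp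
qed

text \<open>Multiplication by \<open>\<xi> m\<close> turns frequency \<open>n\<close> of a
  polynomial into \<open>n - m\<close> and, as \<open>\<xi> m\<close> has modulus 1, does not
  increase the error.\<close>

lemma character_span_shift:
  assumes g: "g \<in> character_span \<mu>"
  shows "(\<lambda>\<xi>. \<xi> m * g \<xi>) \<in> character_span \<mu>"
proof -
  have g': "L2_fun \<mu> (\<lambda>\<xi>. \<xi> m * g \<xi>)"
    using L2_fun_character_mult(1)[OF character_span_L2[OF g], of m] by (simp add: mult.commute)
  have "\<exists>F d. finite F \<and> L2n \<mu> (\<lambda>\<xi>. \<xi> m * g \<xi> - trig_poly F d \<xi>) < e" if e: "0 < e" for e
  proof -
    obtain F d where F: "finite F" "L2n \<mu> (\<lambda>\<xi>. g \<xi> - trig_poly F d \<xi>) < e"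
      using g e unfolding character_span_def by blast
    have "L2n \<mu> (\<lambda>\<xi>. \<xi> m * g \<xi> - trig_poly ((\<lambda>n. n - m) ` F) (\<lambda>k. d (k + m)) \<xi>) =
        L2n \<mu> (\<lambda>\<xi>. (g \<xi> - trig_poly F d \<xi>) * \<xi> m)"
    proof (rule L2_fun_cong(2))
      fix \<xi> assume "\<xi> \<in> space \<mu>"
      then have \<xi>: "\<xi> \<in> dual_group" by (simp add: space_mu)
      have "inj_on (\<lambda>n. n - m) F" by (simp add: inj_on_def)
      then have "trig_poly ((\<lambda>n. n - m) ` F) (\<lambda>k. d (k + m)) \<xi> = (\<Sum>n\<in>F. d n * \<xi> (m + - n))"
        by (simp add: trig_poly_def sum.reindex)
      also have "\<dots> = trig_poly F d \<xi> * \<xi> m"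
        unfolding dual_group_add[OF \<xi>] trig_poly_def sum_distrib_right
        by (intro sum.cong) (simp_all add: mult_ac)
      finally show "\<xi> m * g \<xi> - trig_poly ((\<lambda>n. n - m) ` F) (\<lambda>k. d (k + m)) \<xi> =
          (g \<xi> - trig_poly F d \<xi>) * \<xi> m"
        by (simp add: algebra_simps)
    qed
    also have "\<dots> \<le> L2n \<mu> (\<lambda>\<xi>. g \<xi> - trig_poly F d \<xi>)"
      by (intro L2_fun_character_mult(2) L2_fun_diff character_span_L2 g L2_fun_trig_poly)
    finally show ?thesis using F by (meson finite_imageI le_less_trans)
  qed
  then show ?thesis using g' by (simp add: character_span_def)
qed

lemma character_span_cnj:
  assumes g: "g \<in> character_span \<mu>"
  shows "(\<lambda>\<xi>. cnj (g \<xi>)) \<in> character_span \<mu>"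
proof -
  have "\<exists>F d. finite F \<and> L2n \<mu> (\<lambda>\<xi>. cnj (g \<xi>) - trig_poly F d \<xi>) < e" if e: "0 < e" for e
  proof -
    obtain F d where F: "finite F" "L2n \<mu> (\<lambda>\<xi>. g \<xi> - trig_poly F d \<xi>) < e"
      using g e unfolding character_span_def by blast
    have "L2n \<mu> (\<lambda>\<xi>. cnj (g \<xi>) - trig_poly (uminus ` F) (\<lambda>k. cnj (d (- k))) \<xi>) =
        L2n \<mu> (\<lambda>\<xi>. cnj (g \<xi> - trig_poly F d \<xi>))"
      by (rule L2_fun_cong(2))
        (simp add: space_mu trig_poly_def sum.reindex dual_group_minus)
    also have "\<dots> = L2n \<mu> (\<lambda>\<xi>. g \<xi> - trig_poly F d \<xi>)"
      unfolding L2n_def by (simp only: complex_mod_cnj)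
    finally show ?thesis using F by (metis finite_imageI)
  qed
  then show ?thesis using L2_fun_cnj[OF character_span_L2[OF g]] by (simp add: character_span_def)
qed

text \<open>Multiplication by the essentially bounded \<open>b\<close> is continuous in the square
  norm, so \<open>g\<close> may be replaced by a trigonometric polynomial. The product is then a
  linear combination of shifts of \<open>b\<close>, which lie in the span.\<close>

lemma character_span_mult:
  assumes g: "g \<in> character_span \<mu>" and b: "b \<in> character_span \<mu>" "AE \<xi> in \<mu>. cmod (b \<xi>) \<le> C"
  shows "(\<lambda>\<xi>. g \<xi> * b \<xi>) \<in> character_span \<mu>"
proof (rule character_span_closed)
  note g2 = character_span_L2[OF g] and b2 = character_span_L2[OF b(1)]
  note bm = L2_fun_measurable[OF b2]
  have bC: "AE \<xi> in \<mu>. cmod (b \<xi>) \<le> \<bar>C\<bar>" using b(2) by eventually_elim simp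
  show "L2_fun \<mu> (\<lambda>\<xi>. g \<xi> * b \<xi>)"
    by (rule L2_fun_mult_bounded(1)[OF g2 bm bC]) simp
  fix e :: real assume e: "0 < e"
  then have "0 < e / (\<bar>C\<bar> + 1)" by simp
  then obtain F d where F: "finite F" "L2n \<mu> (\<lambda>\<xi>. g \<xi> - trig_poly F d \<xi>) < e / (\<bar>C\<bar> + 1)"
    using g unfolding character_span_def by blast
  have "(\<lambda>\<xi>. \<Sum>n\<in>F. d n * (\<xi> (- n) * b \<xi>)) \<in> character_span \<mu>"
    by (intro character_span_sum character_span_scale character_span_shift b F)
  then have tb: "(\<lambda>\<xi>. trig_poly F d \<xi> * b \<xi>) \<in> character_span \<mu>"
    by (simp add: trig_poly_def sum_distrib_right mult.assoc)
  have "L2n \<mu> (\<lambda>\<xi>. g \<xi> * b \<xi> - trig_poly F d \<xi> * b \<xi>) \<le>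
      \<bar>C\<bar> * L2n \<mu> (\<lambda>\<xi>. g \<xi> - trig_poly F d \<xi>)"
    unfolding left_diff_distrib[symmetric]
    by (intro L2_fun_mult_bounded(2) L2_fun_diff g2 L2_fun_trig_poly bm bC) simp
  also have "\<dots> \<le> (\<bar>C\<bar> + 1) * L2n \<mu> (\<lambda>\<xi>. g \<xi> - trig_poly F d \<xi>)"
    by (intro mult_right_mono) auto
  also have "\<dots> < e"
    using F(2) by (simp add: pos_less_divide_eq add_nonneg_pos mult.commute)
  finally show "\<exists>h\<in>character_span \<mu>. L2n \<mu> (\<lambda>\<xi>. g \<xi> * b \<xi> - h \<xi>) < e"
    using tb by (rule bexI)
qed

text \<open>For a partial sum of \<open>g\<close> the formula is a finite computation. The error is
  the integral of \<open>g\<close> minus the partial sum against \<open>b \<xi> * \<xi> n\<close>,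
  which Cauchy-Schwarz controls; convergence along finite sets gives the unconditional sum.\<close>

lemma fourier_coeff_mult:
  assumes g: "g \<in> character_span \<mu>" and b: "L2_fun \<mu> b"
  shows "((\<lambda>m. fourier_coeff \<mu> g m * fourier_coeff \<mu> b (n - m)) has_sum
    fourier_coeff \<mu> (\<lambda>\<xi>. g \<xi> * b \<xi>) n) UNIV"
proof -
  note g2 = character_span_L2[OF g]
  let ?t = "\<lambda>F. trig_poly F (fourier_coeff \<mu> g)"
  have b': "L2_fun \<mu> (\<lambda>\<xi>. b \<xi> * \<xi> n)" by (rule L2_fun_character_mult(1)[OF b])
  have gt: "L2_fun \<mu> (\<lambda>\<xi>. g \<xi> - ?t F \<xi>)" for F
    by (intro L2_fun_diff g2 L2_fun_trig_poly)
  have sum: "(\<Sum>m\<in>F. fourier_coeff \<mu> g m * fourier_coeff \<mu> b (n - m)) =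
      (\<integral>\<xi>. ?t F \<xi> * (b \<xi> * \<xi> n) \<partial>\<mu>)" for F
  proof -
    have "(\<integral>\<xi>. ?t F \<xi> * (b \<xi> * \<xi> n) \<partial>\<mu>) = (\<integral>\<xi>. (\<Sum>m\<in>F. fourier_coeff \<mu> g m * (b \<xi> * \<xi> (n - m))) \<partial>\<mu>)"
    proof (intro Bochner_Integration.integral_cong refl)
      fix \<xi> assume "\<xi> \<in> space \<mu>"
      then have \<xi>: "\<xi> \<in> dual_group" by (simp add: space_mu)
      have "\<xi> (n - m) = \<xi> n * \<xi> (- m)" for m
        using dual_group_add[OF \<xi>, of n "- m"] by simp
      then show "?t F \<xi> * (b \<xi> * \<xi> n) = (\<Sum>m\<in>F. fourier_coeff \<mu> g m * (b \<xi> * \<xi> (n - m)))"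
        unfolding trig_poly_def sum_distrib_right by (intro sum.cong) (simp_all add: mult_ac)
    qed
    then show ?thesis
      by (simp add: fourier_coeff_def[of \<mu> b] integrable_coeff[OF b])
  qed
  have diff: "cmod ((\<Sum>m\<in>F. fourier_coeff \<mu> g m * fourier_coeff \<mu> b (n - m)) -
      fourier_coeff \<mu> (\<lambda>\<xi>. g \<xi> * b \<xi>) n) \<le> L2n \<mu> (\<lambda>\<xi>. g \<xi> - ?t F \<xi>) * L2n \<mu> (\<lambda>\<xi>. b \<xi> * \<xi> n)" for F
  proof -
    have "(\<integral>\<xi>. (g \<xi> - ?t F \<xi>) * (b \<xi> * \<xi> n) \<partial>\<mu>) = fourier_coeff \<mu> (\<lambda>\<xi>. g \<xi> * b \<xi>) n -
        (\<Sum>m\<in>F. fourier_coeff \<mu> g m * fourier_coeff \<mu> b (n - m))"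
      unfolding sum fourier_coeff_def[of \<mu> "\<lambda>\<xi>. g \<xi> * b \<xi>"] left_diff_distrib mult.assoc
      by (rule Bochner_Integration.integral_diff)
        (intro L2_fun_integrable_times(1) g2 b' L2_fun_trig_poly)+
    then show ?thesis
      using L2_fun_integrable_times(2)[OF gt b', of F] by (simp add: norm_minus_commute)
  qed
  have "((\<lambda>F. L2n \<mu> (\<lambda>\<xi>. g \<xi> - ?t F \<xi>) * L2n \<mu> (\<lambda>\<xi>. b \<xi> * \<xi> n)) \<longlongrightarrow> 0) (finite_subsets_at_top UNIV)"
    by (rule tendsto_mult_left_zero[OF character_span_partial_sums[OF g]])
  then have "((\<lambda>F. (\<Sum>m\<in>F. fourier_coeff \<mu> g m * fourier_coeff \<mu> b (n - m)) -
      fourier_coeff \<mu> (\<lambda>\<xi>. g \<xi> * b \<xi>) n) \<longlongrightarrow> 0) (finite_subsets_at_top UNIV)"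
    by (rule Lim_null_comparison[rotated]) (simp add: diff)
  then show ?thesis unfolding has_sum_def by (rule LIM_zero_cancel)
qed

lemma character_span_unique:
  assumes f: "f \<in> character_span \<mu>" and g: "g \<in> character_span \<mu>"
    and eq: "fourier_coeff \<mu> f = fourier_coeff \<mu> g"
  shows "AE \<xi> in \<mu>. f \<xi> = g \<xi>"
proof -
  note d = character_span_diff[OF f g]
  have "fourier_coeff \<mu> (\<lambda>\<xi>. f \<xi> - g \<xi>) = (\<lambda>n. 0)"
    using eq by (simp add: fun_eq_iff fourier_coeff_diff character_span_L2[OF f] character_span_L2[OF g])
  then have "L2n \<mu> (\<lambda>\<xi>. f \<xi> - g \<xi>) = 0"
    using l2_norm_fourier_coeff[OF d] by (simp add: l2_norm_def)
  then show ?thesis using L2n_eq_0_iff[OF character_span_L2[OF d]] by simp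
qed

section \<open>Transforms of summable and square-summable functions\<close>

text \<open>Since characters have modulus 1, the tail of the series is bounded by the tail of the
  absolute values, the same for every \<open>\<xi>\<close>: the approximation is uniform on the dual
  group.\<close>

lemma fourier_l1_approx:
  assumes a: "summable1 a" and e: "0 < e"
  shows "\<exists>F0. finite F0 \<and> (\<forall>F. finite F \<longrightarrow> F0 \<subseteq> F \<longrightarrow>
    (\<forall>\<xi>\<in>dual_group. cmod (fourier_l1 a \<xi> - trig_poly F a \<xi>) \<le> e))"
proof -
  have sa: "(\<lambda>n. cmod (a n)) summable_on UNIV" using a by (simp add: summable1_def)
  then have "((\<lambda>F. \<Sum>n\<in>F. cmod (a n)) \<longlongrightarrow> (\<Sum>\<^sub>\<infinity>n. cmod (a n))) (finite_subsets_at_top UNIV)"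
    using has_sum_infsum has_sum_def by blast
  then have "\<forall>\<^sub>F F in finite_subsets_at_top UNIV. dist (\<Sum>n\<in>F. cmod (a n)) (\<Sum>\<^sub>\<infinity>n. cmod (a n)) < e"
    using e by (rule tendstoD)
  then obtain F0 where F0: "finite F0"
    "\<And>F. finite F \<Longrightarrow> F0 \<subseteq> F \<Longrightarrow> dist (\<Sum>n\<in>F. cmod (a n)) (\<Sum>\<^sub>\<infinity>n. cmod (a n)) < e"
    unfolding eventually_finite_subsets_at_top by auto
  have "cmod (fourier_l1 a \<xi> - trig_poly F a \<xi>) \<le> e"
    if F: "finite F" "F0 \<subseteq> F" and \<xi>: "\<xi> \<in> dual_group" for F \<xi>
  proof -
    have n: "cmod (a n * \<xi> (- n)) = cmod (a n)" for n
      by (simp add: norm_mult dual_group_norm[OF \<xi>])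
    have s: "(\<lambda>n. a n * \<xi> (- n)) summable_on UNIV"
      by (rule abs_summable_summable) (simp only: n sa)
    have "cmod (fourier_l1 a \<xi> - trig_poly F a \<xi>) = cmod (\<Sum>\<^sub>\<infinity>n\<in>- F. a n * \<xi> (- n))"
      unfolding fourier_l1_def trig_poly_def infsum_outside_finite(2)[OF s F(1)] ..
    also have "\<dots> \<le> (\<Sum>\<^sub>\<infinity>n\<in>- F. cmod (a n))"
      using norm_infsum_bound[of "\<lambda>n. a n * \<xi> (- n)" "- F"] infsum_outside_finite(1)[OF sa F(1)]
      by (simp add: n)
    also have "\<dots> = (\<Sum>\<^sub>\<infinity>n. cmod (a n)) - (\<Sum>n\<in>F. cmod (a n))"
      by (rule infsum_outside_finite(2)[OF sa F(1)])
    also have "\<dots> \<le> e" using F0(2)[OF F] by (simp add: dist_real_def)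
    finally show ?thesis .
  qed
  then show ?thesis using F0(1) by blast
qed

lemma fourier_l1_in_character_span:
  assumes a: "summable1 a"
  shows "fourier_l1 a \<in> character_span \<mu>" "fourier_coeff \<mu> (fourier_l1 a) = a"
proof -
  \<comment> \<open>Measurability passes to limits of sequences, so a sequence of finite sets is
    extracted from convergence along all finite subsets of a possibly uncountable group.\<close>
  have "\<forall>k. \<exists>F. finite F \<and> (\<forall>\<xi>\<in>dual_group. cmod (fourier_l1 a \<xi> - trig_poly F a \<xi>) \<le> 1 / real (Suc k))"
    using fourier_l1_approx[OF a] by (metis order_refl zero_less_divide_1_iff of_nat_0_less_iff zero_less_Suc)
  then obtain F where F: "\<And>k. finite (F k)"
    "\<And>k \<xi>. \<xi> \<in> dual_group \<Longrightarrow> cmod (fourier_l1 a \<xi> - trig_poly (F k) a \<xi>) \<le> 1 / real (Suc k)"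
    by metis
  have m: "fourier_l1 a \<in> borel_measurable \<mu>"
  proof (rule borel_measurable_LIMSEQ_metric)
    show "trig_poly (F k) a \<in> borel_measurable \<mu>" for k
      by (rule L2_fun_measurable[OF L2_fun_trig_poly])
    fix \<xi> assume "\<xi> \<in> space \<mu>"
    then have \<xi>: "\<xi> \<in> dual_group" by (simp add: space_mu)
    have "(\<lambda>k. trig_poly (F k) a \<xi> - fourier_l1 a \<xi>) \<longlonglongrightarrow> 0"
    proof (rule Lim_null_comparison[OF _ LIMSEQ_inverse_real_of_nat])
      show "\<forall>\<^sub>F k in sequentially. norm (trig_poly (F k) a \<xi> - fourier_l1 a \<xi>) \<le> inverse (real (Suc k))"
        using F(2)[OF \<xi>] by (simp add: norm_minus_commute inverse_eq_divide)
    qed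
    then show "(\<lambda>k. trig_poly (F k) a \<xi>) \<longlonglongrightarrow> fourier_l1 a \<xi>" by (rule LIM_zero_cancel)
  qed
  have L2: "L2_fun \<mu> (\<lambda>\<xi>. fourier_l1 a \<xi> - trig_poly G a \<xi>)"
    and bound: "L2n \<mu> (\<lambda>\<xi>. fourier_l1 a \<xi> - trig_poly G a \<xi>) \<le> e"
    if "0 < e" "\<forall>\<xi>\<in>dual_group. cmod (fourier_l1 a \<xi> - trig_poly G a \<xi>) \<le> e" for G e
  proof -
    have "(\<lambda>\<xi>. fourier_l1 a \<xi> - trig_poly G a \<xi>) \<in> borel_measurable \<mu>"
      by (intro borel_measurable_diff m L2_fun_measurable[OF L2_fun_trig_poly])
    moreover have "AE \<xi> in \<mu>. cmod (fourier_l1 a \<xi> - trig_poly G a \<xi>) \<le> e"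
      using that by (intro AE_dual_group) simp
    ultimately show "L2_fun \<mu> (\<lambda>\<xi>. fourier_l1 a \<xi> - trig_poly G a \<xi>)"
      "L2n \<mu> (\<lambda>\<xi>. fourier_l1 a \<xi> - trig_poly G a \<xi>) \<le> e"
      using L2_fun_bounded that(1) by auto
  qed
  have a2: "L2_fun \<mu> (fourier_l1 a)"
    using L2_fun_add(1)[OF L2[of 1 "F 0"] L2_fun_trig_poly[of "F 0" a]] F(2)[of _ 0] by simp
  show "fourier_l1 a \<in> character_span \<mu>"
  proof (rule character_span_closed[OF a2])
    fix e :: real assume e: "0 < e"
    then obtain G where G: "finite G" "\<forall>\<xi>\<in>dual_group. cmod (fourier_l1 a \<xi> - trig_poly G a \<xi>) \<le> e / 2"
      using fourier_l1_approx[OF a, of "e / 2"] by (meson half_gt_zero order_refl)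
    have "L2n \<mu> (\<lambda>\<xi>. fourier_l1 a \<xi> - trig_poly G a \<xi>) < e"
      using bound[OF _ G(2)] e by simp
    then show "\<exists>h\<in>character_span \<mu>. L2n \<mu> (\<lambda>\<xi>. fourier_l1 a \<xi> - h \<xi>) < e"
      using trig_poly_in_character_span[OF G(1)] by blast
  qed
  show "fourier_coeff \<mu> (fourier_l1 a) = a"
  proof
    fix n
    have le: "cmod (fourier_coeff \<mu> (fourier_l1 a) n - a n) \<le> e" if e: "0 < e" for e
    proof -
      obtain F0 where F0: "finite F0" "\<And>F. finite F \<Longrightarrow> F0 \<subseteq> F \<Longrightarrow>
          \<forall>\<xi>\<in>dual_group. cmod (fourier_l1 a \<xi> - trig_poly F a \<xi>) \<le> e"
        using fourier_l1_approx[OF a e] by blast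
      \<comment> \<open>Including \<open>n\<close> makes the coefficient of the partial sum at
        \<open>n\<close> equal to \<open>a n\<close>.\<close>
      define G where "G = insert n F0"
      have G: "finite G" "F0 \<subseteq> G" "n \<in> G" using F0(1) by (auto simp: G_def)
      have "fourier_coeff \<mu> (fourier_l1 a) n - a n =
          fourier_coeff \<mu> (\<lambda>\<xi>. fourier_l1 a \<xi> - trig_poly G a \<xi>) n"
        using G by (simp add: fourier_coeff_diff[OF a2 L2_fun_trig_poly] fourier_coeff_trig_poly)
      also have "cmod \<dots> \<le> e"
        using fourier_coeff_bound[OF L2[OF e F0(2)[OF G(1,2)]]] bound[OF e F0(2)[OF G(1,2)]]
        by (rule order_trans)
      finally show ?thesis .
    qed
    have "cmod (fourier_coeff \<mu> (fourier_l1 a) n - a n) \<le> 0"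
      by (rule field_le_epsilon) (simp only: add_0 le)
    then show "fourier_coeff \<mu> (fourier_l1 a) n = a n" by simp
  qed
qed

text \<open>From right to left, Parseval makes the distance of the transforms equal to the
  \<open>l2_norm\<close> distance, so \<open>\<delta>\<close> can be \<open>\<epsilon>\<close>. From
  left to right, truncations of \<open>f\<close> to finite sets are summable and tend to
  \<open>f\<close>, and their transforms are trigonometric polynomials; the defining limit thus puts
  \<open>g\<close> in the closed span and fixes its coefficients.\<close>

lemma fourier_iff:
  assumes f: "summable2 f"
  shows "g \<in> fourier \<mu> f \<longleftrightarrow> g \<in> character_span \<mu> \<and> fourier_coeff \<mu> g = f"
proof
  assume "g \<in> character_span \<mu> \<and> fourier_coeff \<mu> g = f"
  then have g: "g \<in> character_span \<mu>" and gf: "fourier_coeff \<mu> g = f" by auto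
  have "L2n \<mu> (\<lambda>\<xi>. fourier_l1 a \<xi> - g \<xi>) = l2_norm (\<lambda>n. a n - f n)" if a: "summable1 a" for a
  proof -
    note s = fourier_l1_in_character_span[OF a]
    have "fourier_coeff \<mu> (\<lambda>\<xi>. fourier_l1 a \<xi> - g \<xi>) = (\<lambda>n. a n - f n)"
      by (simp add: fun_eq_iff fourier_coeff_diff character_span_L2 g s gf)
    then show ?thesis using l2_norm_fourier_coeff[OF character_span_diff[OF s(1) g]] by simp
  qed
  then show "g \<in> fourier \<mu> f"
    using character_span_L2[OF g]
    by (auto simp: fourier_def square_integrable_eq_L2_fun L2_norm_eq_L2n)
next
  assume g: "g \<in> fourier \<mu> f"
  have g2: "L2_fun \<mu> g" using g by (simp add: fourier_def square_integrable_eq_L2_fun)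
  have sf: "(\<lambda>n. (cmod (f n))\<^sup>2) summable_on UNIV" using f by (simp add: summable2_def)
  define S where "S = (\<Sum>\<^sub>\<infinity>n. (cmod (f n))\<^sup>2)"
  define a where "a F n = (if n \<in> F then f n else 0)" for F n
  have a1: "summable1 (a F)" and af: "fourier_l1 (a F) = trig_poly F f" if F: "finite F" for F
  proof -
    have "((\<lambda>n. cmod (a F n)) has_sum (\<Sum>n\<in>F. cmod (f n))) UNIV"
      using F by (intro has_sum_finite_neutralI) (auto simp: a_def)
    then show "summable1 (a F)" unfolding summable1_def by (rule has_sum_imp_summable)
    have "((\<lambda>n. a F n * \<xi> (- n)) has_sum (\<Sum>n\<in>F. f n * \<xi> (- n))) UNIV" for \<xi> :: "'n \<Rightarrow> complex"
      using F by (intro has_sum_finite_neutralI) (auto simp: a_def)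
    then show "fourier_l1 (a F) = trig_poly F f"
      by (intro ext) (simp add: fourier_l1_def trig_poly_def infsumI)
  qed
  have al: "l2_norm (\<lambda>n. a F n - f n) = sqrt (S - (\<Sum>n\<in>F. (cmod (f n))\<^sup>2))" if F: "finite F" for F
  proof -
    have "(\<Sum>\<^sub>\<infinity>n. (cmod (a F n - f n))\<^sup>2) = (\<Sum>\<^sub>\<infinity>n\<in>- F. (cmod (f n))\<^sup>2)"
      by (intro infsum_cong_neutral) (auto simp: a_def)
    then show ?thesis
      unfolding l2_norm_def S_def infsum_outside_finite(2)[OF sf F, symmetric] by simp
  qed
  have lim: "((\<lambda>F. sqrt (S - (\<Sum>n\<in>F. (cmod (f n))\<^sup>2))) \<longlongrightarrow> sqrt (S - S)) (finite_subsets_at_top UNIV)"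
    using has_sum_infsum[OF sf] by (intro tendsto_intros) (simp add: has_sum_def S_def)
  have approx: "\<exists>F0. finite F0 \<and> (\<forall>F. finite F \<longrightarrow> F0 \<subseteq> F \<longrightarrow>
      L2n \<mu> (\<lambda>\<xi>. g \<xi> - trig_poly F f \<xi>) < e)" if e: "0 < e" for e
  proof -
    have "\<exists>\<delta>>0. \<forall>a. summable1 a \<and> l2_norm (\<lambda>n. a n - f n) < \<delta> \<longrightarrow>
        L2_norm \<mu> (\<lambda>\<xi>. fourier_l1 a \<xi> - g \<xi>) < e"
      using g e by (simp add: fourier_def)
    then obtain \<delta> where \<delta>: "0 < \<delta>" "\<And>a. summable1 a \<Longrightarrow> l2_norm (\<lambda>n. a n - f n) < \<delta> \<Longrightarrow>
        L2n \<mu> (\<lambda>\<xi>. fourier_l1 a \<xi> - g \<xi>) < e"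
      unfolding L2_norm_eq_L2n by auto
    have "\<forall>\<^sub>F F in finite_subsets_at_top UNIV. sqrt (S - (\<Sum>n\<in>F. (cmod (f n))\<^sup>2)) < \<delta>"
      using order_tendstoD(2)[OF lim, of \<delta>] \<delta>(1) by simp
    then obtain F0 where F0: "finite F0"
      "\<And>F. finite F \<Longrightarrow> F0 \<subseteq> F \<Longrightarrow> sqrt (S - (\<Sum>n\<in>F. (cmod (f n))\<^sup>2)) < \<delta>"
      unfolding eventually_finite_subsets_at_top by auto
    have "L2n \<mu> (\<lambda>\<xi>. g \<xi> - trig_poly F f \<xi>) < e" if F: "finite F" "F0 \<subseteq> F" for F
      using \<delta>(2)[OF a1[OF F(1)]] F0(2)[OF F]
      by (simp add: al[OF F(1)] af[OF F(1)] L2n_minus_commute[of \<mu> g])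
    then show ?thesis using F0(1) by blast
  qed
  have span: "g \<in> character_span \<mu>"
    using g2 approx unfolding character_span_def by blast
  moreover have "fourier_coeff \<mu> g = f"
  proof
    fix n
    have le: "cmod (fourier_coeff \<mu> g n - f n) \<le> e" if e: "0 < e" for e
    proof -
      obtain F0 where F0: "finite F0"
        "\<And>F. finite F \<Longrightarrow> F0 \<subseteq> F \<Longrightarrow> L2n \<mu> (\<lambda>\<xi>. g \<xi> - trig_poly F f \<xi>) < e"
        using approx[OF e] by blast
      define G where "G = insert n F0"
      have G: "finite G" "F0 \<subseteq> G" "n \<in> G" using F0(1) by (auto simp: G_def)
      have "fourier_coeff \<mu> g n - f n = fourier_coeff \<mu> (\<lambda>\<xi>. g \<xi> - trig_poly G f \<xi>) n"
        using G by (simp add: fourier_coeff_diff[OF g2 L2_fun_trig_poly] fourier_coeff_trig_poly)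
      also have "cmod \<dots> \<le> L2n \<mu> (\<lambda>\<xi>. g \<xi> - trig_poly G f \<xi>)"
        by (intro fourier_coeff_bound L2_fun_diff g2 L2_fun_trig_poly)
      finally show ?thesis using F0(2)[OF G(1,2)] by linarith
    qed
    have "cmod (fourier_coeff \<mu> g n - f n) \<le> 0"
      by (rule field_le_epsilon) (simp only: add_0 le)
    then show "fourier_coeff \<mu> g n = f n" by simp
  qed
  ultimately show "g \<in> character_span \<mu> \<and> fourier_coeff \<mu> g = f" ..
qed

text \<open>Uniqueness in the span gives one inclusion, stability under almost everywhere changes
  the other.\<close>

lemma fourier_fourier_coeff:
  assumes g: "g \<in> character_span \<mu>"
  shows "fourier \<mu> (fourier_coeff \<mu> g) = ae_class \<mu> g"
proof (intro set_eqI iffI)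
  fix k assume "k \<in> fourier \<mu> (fourier_coeff \<mu> g)"
  then have k: "k \<in> character_span \<mu>" "fourier_coeff \<mu> k = fourier_coeff \<mu> g"
    using fourier_iff[OF summable2_fourier_coeff[OF g]] by auto
  then show "k \<in> ae_class \<mu> g"
    using character_span_unique[OF k(1) g k(2)] L2_fun_measurable[OF character_span_L2[OF k(1)]]
    by (simp add: ae_class_def)
next
  fix k assume "k \<in> ae_class \<mu> g"
  then have k: "k \<in> borel_measurable \<mu>" "AE \<xi> in \<mu>. k \<xi> = g \<xi>" by (auto simp: ae_class_def)
  have "fourier_coeff \<mu> k = fourier_coeff \<mu> g"
    using fourier_coeff_cong_AE[OF k(1) L2_fun_measurable[OF character_span_L2[OF g]] k(2)] by blast
  then show "k \<in> fourier \<mu> (fourier_coeff \<mu> g)"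
    using fourier_iff[OF summable2_fourier_coeff[OF g]] character_span_cong_AE[OF k g] by simp
qed

lemma fourier_in_L_infinityE:
  assumes f: "summable2 f" and L: "fourier \<mu> f \<in> L_infinity \<mu>"
  obtains g C where "g \<in> character_span \<mu>" "fourier_coeff \<mu> g = f" "AE \<xi> in \<mu>. cmod (g \<xi>) \<le> C"
proof -
  obtain g C where g: "g \<in> borel_measurable \<mu>" "AE \<xi> in \<mu>. cmod (g \<xi>) \<le> C"
    "fourier \<mu> f = ae_class \<mu> g"
    using L unfolding L_infinity_def by blast
  have "g \<in> fourier \<mu> f" using g by (simp add: ae_class_def)
  then show thesis using that g(2) fourier_iff[OF f] by blast
qed

end

section \<open>The transfer matrix\<close>

text \<open>The finite second factor splits the index set into finitely many disjoint fibres, so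
  summability on each fibre already gives joint summability.\<close>

lemma has_sum_prod_finite:
  fixes f :: "'a \<times> 'b::finite \<Rightarrow> 'c::topological_comm_monoid_add"
  assumes "\<And>k. ((\<lambda>m. f (m, k)) has_sum s k) UNIV"
  shows "(f has_sum (\<Sum>k\<in>UNIV. s k)) UNIV"
proof -
  have "(f has_sum s k) (UNIV \<times> {k})" for k
  proof -
    have "bij_betw (\<lambda>m::'a. (m, k)) UNIV (UNIV \<times> {k})"
      by (auto simp: bij_betw_def inj_on_def)
    then show ?thesis using has_sum_reindex_bij_betw assms[of k] by fast
  qed
  then have "(f has_sum (\<Sum>k\<in>UNIV. s k)) (\<Union>k\<in>UNIV. UNIV \<times> {k})"
    by (intro sum_has_sum) auto
  moreover have "(\<Union>k\<in>UNIV. UNIV \<times> {k}) = (UNIV :: ('a \<times> 'b) set)" by auto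
  ultimately show ?thesis by simp
qed

section \<open>Pulling a C*-structure back along an order-reversing embedding\<close>

text \<open>An embedding that reverses products turns the C*-identity for \<open>x\<close> into the
  one for \<open>astar A (S x)\<close>; comparing the two requires the star to be isometric.\<close>

lemma (in cstar_algebra) norm_star:
  assumes x: "x \<in> acarrier A"
  shows "anorm A (astar A x) = anorm A x"
proof -
  have le: "anorm A y \<le> anorm A (astar A y)" if y: "y \<in> acarrier A" for y
  proof (cases "anorm A y = 0")
    case True
    then show ?thesis using norm_nonneg[OF star_closed[OF y]] by simp
  next
    case False
    have "anorm A y * anorm A y \<le> anorm A (astar A y) * anorm A y"
      using norm_mult[OF star_closed[OF y] y] cstar_identity[OF y] by (simp add: power2_eq_square)
    then show ?thesis using False norm_nonneg[OF y] by simp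
  qed
  show ?thesis
    using le[OF x] le[OF star_closed[OF x]] star_star[OF x] by simp
qed

text \<open>The target is known to be a C*-algebra, while the source only has operations matching
  those of the target along \<open>S\<close>. The condition \<open>S_closed\<close> on the range is
  what supplies limits in the source.\<close>

locale reversing_embedding = A: cstar_algebra A for A :: "'b star_algebra" +
  fixes L :: "'a star_algebra" and S :: "'a \<Rightarrow> 'b"
  assumes S_in: "x \<in> acarrier L \<Longrightarrow> S x \<in> acarrier A"
    and S_inj: "inj_on S (acarrier L)"
    and L_zero: "azero L \<in> acarrier L"
    and L_add: "\<lbrakk>x \<in> acarrier L; y \<in> acarrier L\<rbrakk> \<Longrightarrow> aadd L x y \<in> acarrier L"
    and L_scale: "x \<in> acarrier L \<Longrightarrow> ascale L c x \<in> acarrier L"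
    and L_mult: "\<lbrakk>x \<in> acarrier L; y \<in> acarrier L\<rbrakk> \<Longrightarrow> amult L x y \<in> acarrier L"
    and L_star: "x \<in> acarrier L \<Longrightarrow> astar L x \<in> acarrier L"
    and S_zero: "S (azero L) = azero A"
    and S_add: "\<lbrakk>x \<in> acarrier L; y \<in> acarrier L\<rbrakk> \<Longrightarrow> S (aadd L x y) = aadd A (S x) (S y)"
    and S_scale: "x \<in> acarrier L \<Longrightarrow> S (ascale L c x) = ascale A c (S x)"
    and S_mult: "\<lbrakk>x \<in> acarrier L; y \<in> acarrier L\<rbrakk> \<Longrightarrow> S (amult L x y) = amult A (S y) (S x)"
    and S_star: "x \<in> acarrier L \<Longrightarrow> S (astar L x) = astar A (S x)"
    and S_norm: "x \<in> acarrier L \<Longrightarrow> anorm L x = anorm A (S x)"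
    and S_closed: "\<lbrakk>\<And>k. X k \<in> acarrier L; a \<in> acarrier A; (\<lambda>k. adist A (S (X k)) a) \<longlonglongrightarrow> 0\<rbrakk>
          \<Longrightarrow> a \<in> S ` acarrier L"
begin

lemmas hom_simps = S_in L_zero L_add L_scale L_mult L_star S_zero S_add S_scale S_mult S_star S_norm
  A.zero_closed A.add_closed A.scale_closed A.mult_closed A.star_closed

lemma S_eqI: "\<lbrakk>x \<in> acarrier L; y \<in> acarrier L; S x = S y\<rbrakk> \<Longrightarrow> x = y"
  using S_inj by (rule inj_onD)

lemma S_dist: "\<lbrakk>x \<in> acarrier L; y \<in> acarrier L\<rbrakk> \<Longrightarrow> adist L x y = adist A (S x) (S y)"
  by (simp add: adist_def hom_simps)

text \<open>Each identity is checked after applying the injective \<open>S\<close>. Because products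
  are swapped, laws about the left factor come from laws about the right factor and conversely;
  completeness holds because limits in \<open>A\<close> stay in the closed range.\<close>

lemma cstar_algebra_source: "cstar_algebra L"
proof
  show "azero L \<in> acarrier L" by (rule L_zero)
  fix x y z c d
  assume x: "x \<in> acarrier L"
  show "ascale L c x \<in> acarrier L" "astar L x \<in> acarrier L"
    using x by (simp_all add: hom_simps)
  show "aadd L x (azero L) = x"
    by (rule S_eqI) (simp_all add: x hom_simps A.add_zero)
  show "aadd L x (ascale L (- 1) x) = azero L"
    by (rule S_eqI) (simp_all add: x hom_simps A.add_inverse)
  show "ascale L (c + d) x = aadd L (ascale L c x) (ascale L d x)"
    by (rule S_eqI) (simp_all add: x hom_simps A.scale_add_left)
  show "ascale L c (ascale L d x) = ascale L (c * d) x"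
    by (rule S_eqI) (simp_all add: x hom_simps A.scale_scale)
  show "ascale L 1 x = x"
    by (rule S_eqI) (simp_all add: x hom_simps A.scale_one)
  show "astar L (astar L x) = x"
    by (rule S_eqI) (simp_all add: x hom_simps A.star_star)
  show "astar L (ascale L c x) = ascale L (cnj c) (astar L x)"
    by (rule S_eqI) (simp_all add: x hom_simps A.star_scale)
  show "0 \<le> anorm L x"
    by (simp add: x hom_simps A.norm_nonneg)
  show "anorm L x = 0 \<longleftrightarrow> x = azero L"
    using S_eqI[OF x L_zero] by (auto simp: x hom_simps A.norm_eq_zero)
  show "anorm L (ascale L c x) = cmod c * anorm L x"
    by (simp add: x hom_simps A.norm_scale)
  show "anorm L (amult L (astar L x) x) = (anorm L x)\<^sup>2"
    using A.cstar_identity[OF A.star_closed[OF S_in[OF x]]]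
    by (simp add: x hom_simps A.star_star A.norm_star)
  assume y: "y \<in> acarrier L"
  show "aadd L x y \<in> acarrier L" "amult L x y \<in> acarrier L"
    by (simp_all add: x y hom_simps)
  show "aadd L x y = aadd L y x"
    by (rule S_eqI) (simp_all add: x y hom_simps A.add_commute[of "S x"])
  show "ascale L c (aadd L x y) = aadd L (ascale L c x) (ascale L c y)"
    by (rule S_eqI) (simp_all add: x y hom_simps A.scale_add_right)
  show "amult L (ascale L c x) y = ascale L c (amult L x y)"
    by (rule S_eqI) (simp_all add: x y hom_simps A.mult_scale_right)
  show "amult L x (ascale L c y) = ascale L c (amult L x y)"
    by (rule S_eqI) (simp_all add: x y hom_simps A.mult_scale_left)
  show "astar L (aadd L x y) = aadd L (astar L x) (astar L y)"
    by (rule S_eqI) (simp_all add: x y hom_simps A.star_add)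
  show "astar L (amult L x y) = amult L (astar L y) (astar L x)"
    by (rule S_eqI) (simp_all add: x y hom_simps A.star_mult)
  show "anorm L (aadd L x y) \<le> anorm L x + anorm L y"
    by (simp add: x y hom_simps A.norm_triangle)
  show "anorm L (amult L x y) \<le> anorm L x * anorm L y"
    using A.norm_mult[OF S_in[OF y] S_in[OF x]] by (simp add: x y hom_simps mult.commute)
  assume z: "z \<in> acarrier L"
  show "aadd L (aadd L x y) z = aadd L x (aadd L y z)"
    by (rule S_eqI) (simp_all add: x y z hom_simps A.add_assoc)
  show "amult L (amult L x y) z = amult L x (amult L y z)"
    by (rule S_eqI) (simp_all add: x y z hom_simps A.mult_assoc)
  show "amult L x (aadd L y z) = aadd L (amult L x y) (amult L x z)"
    by (rule S_eqI) (simp_all add: x y z hom_simps A.mult_add_left)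
  show "amult L (aadd L x y) z = aadd L (amult L x z) (amult L y z)"
    by (rule S_eqI) (simp_all add: x y z hom_simps A.mult_add_right)
next
  fix X :: "nat \<Rightarrow> 'a"
  assume X: "\<And>k. X k \<in> acarrier L"
    and Cauchy: "\<forall>\<epsilon>>0. \<exists>K. \<forall>j\<ge>K. \<forall>k\<ge>K. adist L (X j) (X k) < \<epsilon>"
  have "\<exists>y\<in>acarrier A. (\<lambda>k. adist A (S (X k)) y) \<longlonglongrightarrow> 0"
    using Cauchy by (intro A.complete S_in X) (simp add: S_dist X)
  then obtain y where y: "y \<in> acarrier A" "(\<lambda>k. adist A (S (X k)) y) \<longlonglongrightarrow> 0" by blast
  then obtain x where "x \<in> acarrier L" "y = S x" using S_closed[OF X y] by blast
  then show "\<exists>x\<in>acarrier L. (\<lambda>k. adist L (X k) x) \<longlonglongrightarrow> 0"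
    using y(2) by (intro bexI[of _ x]) (simp_all add: S_dist X)
qed

lemma cstar_subalgebra_image: "cstar_subalgebra (S ` acarrier L) A"
  unfolding cstar_subalgebra_def
proof (intro conjI allI ballI impI)
  show "cstar_algebra A" by (rule A.cstar_algebra_axioms)
  show "S ` acarrier L \<subseteq> acarrier A" using S_in by blast
  show "azero A \<in> S ` acarrier L" using L_zero S_zero by (metis imageI)
  fix u assume "u \<in> S ` acarrier L"
  then obtain x where x: "x \<in> acarrier L" "u = S x" by blast
  show "astar A u \<in> S ` acarrier L" "ascale A c u \<in> S ` acarrier L" for c
    unfolding x(2) using L_star[OF x(1)] L_scale[OF x(1), of c] S_star[OF x(1)] S_scale[OF x(1), of c]
    by (metis imageI)+
  fix v assume "v \<in> S ` acarrier L"
  then obtain y where y: "y \<in> acarrier L" "v = S y" by blast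
  show "aadd A u v \<in> S ` acarrier L" "amult A u v \<in> S ` acarrier L"
    unfolding x(2) y(2) using L_add[OF x(1) y(1)] S_add[OF x(1) y(1)]
      L_mult[OF y(1) x(1)] S_mult[OF y(1) x(1)] by (metis imageI)+
next
  fix U y assume y: "y \<in> acarrier A" and "(\<forall>k. U k \<in> S ` acarrier L) \<and> (\<lambda>k. adist A (U k) y) \<longlonglongrightarrow> 0"
  then have U: "\<forall>k. \<exists>x. x \<in> acarrier L \<and> U k = S x" "(\<lambda>k. adist A (U k) y) \<longlonglongrightarrow> 0" by auto
  obtain X where X: "\<And>k. X k \<in> acarrier L" "\<And>k. U k = S (X k)" using U(1) by metis
  show "y \<in> S ` acarrier L"
    using S_closed[OF X(1) y] U(2) by (simp add: X(2))
qed

lemma reversing_cstar_isomorphism_image: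
  "reversing_cstar_isomorphism L (A\<lparr>acarrier := S ` acarrier L\<rparr>) S"
  unfolding reversing_cstar_isomorphism_def
  by (simp add: hom_simps bij_betw_def S_inj)

end

section \<open>Components of functions on the semidirect product\<close>

locale transfer_setting = haar_measure \<mu>
  for \<mu> :: "('n::ab_group_add \<Rightarrow> complex) measure" +
  fixes \<sigma> :: "'h::{group_add,finite} \<Rightarrow> 'n \<Rightarrow> 'n"
  assumes action: "automorphism_action \<sigma>"
begin

lemma action_simps:
  "\<sigma> h (m + n) = \<sigma> h m + \<sigma> h n" "\<sigma> (h + l) n = \<sigma> h (\<sigma> l n)"
  "\<sigma> 0 n = n" "\<sigma> h 0 = 0" "\<sigma> h (- n) = - \<sigma> h n"
proof -
  show add: "\<sigma> h (m + n) = \<sigma> h m + \<sigma> h n" and "\<sigma> (h + l) n = \<sigma> h (\<sigma> l n)" for h l m n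
    using action unfolding automorphism_action_def by auto
  show "\<sigma> 0 n = n" and z: "\<sigma> h 0 = 0" for h n
    by (simp_all add: automorphism_action_zero[OF action])
  show "\<sigma> h (- n) = - \<sigma> h n"
    using add[of h n "- n"] z[of h] by (simp add: eq_neg_iff_add_eq_0 add.commute)
qed

lemma action_inverse: "\<sigma> h (\<sigma> (- h) n) = n" "\<sigma> (- h) (\<sigma> h n) = n"
  by (simp_all add: action_simps(2)[symmetric] action_simps(3))

text \<open>Every column of the matrix of components thus rearranges column 0: the row index becomes
  \<open>- l + h\<close> and the argument is moved by \<open>\<sigma> (- l)\<close>.\<close>

lemma component_eq: "component \<sigma> f h l n = f (\<sigma> (- l) n, - l + h)"
  by (simp add: component_def sd_inv_def sd_mult_def action_simps)

lemma summable2_component: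
  assumes "summable2 f"
  shows "summable2 (component \<sigma> f h l)"
proof -
  have "inj (\<lambda>n. (\<sigma> (- l) n, - l + h))"
    by (rule injI) (metis action_inverse(1) prod.inject)
  moreover have "(\<lambda>\<gamma>. (cmod (f \<gamma>))\<^sup>2) summable_on range (\<lambda>n. (\<sigma> (- l) n, - l + h))"
    using assms unfolding summable2_def by (rule summable_on_subset_banach) simp
  ultimately show ?thesis
    by (simp add: summable_on_reindex o_def summable2_def component_eq)
qed

text \<open>Column 0 already contains every value once, as
  \<open>component \<sigma> f h 0 n = f (n, h)\<close>.\<close>

lemma summable2_of_components:
  assumes "\<And>h. summable2 (component \<sigma> f h 0)"
  shows "summable2 f"
proof -
  have "((\<lambda>n. (cmod (f (n, h)))\<^sup>2) has_sum (\<Sum>\<^sub>\<infinity>n. (cmod (f (n, h)))\<^sup>2)) UNIV" for h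
    using assms[of h] by (simp add: summable2_def component_eq action_simps)
  then have "((\<lambda>\<gamma>. (cmod (f \<gamma>))\<^sup>2) has_sum (\<Sum>h\<in>UNIV. \<Sum>\<^sub>\<infinity>n. (cmod (f (n, h)))\<^sup>2)) UNIV"
    by (rule has_sum_prod_finite)
  then show ?thesis unfolding summable2_def by (rule has_sum_imp_summable)
qed

text \<open>A relation and not a function, since the matrix function is determined only up to null
  sets. The conditions on the entries are the criterion of \<open>fourier_iff\<close>, so no limit
  has to be handled again.\<close>

definition is_transfer ::
  "(('n \<Rightarrow> complex) \<Rightarrow> complex^('h::{group_add,finite})^('h::{group_add,finite})) \<Rightarrow>
   ('n \<times> 'h \<Rightarrow> complex) \<Rightarrow> bool" where
  "is_transfer F f \<longleftrightarrow> bounded_matrix \<mu> F \<and>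
     (\<forall>h l. (\<lambda>\<xi>. F \<xi> $ h $ l) \<in> character_span \<mu> \<and>
       fourier_coeff \<mu> (\<lambda>\<xi>. F \<xi> $ h $ l) = component \<sigma> f h l)"

lemma is_transferD:
  assumes "is_transfer F f"
  shows "bounded_matrix \<mu> F" "(\<lambda>\<xi>. F \<xi> $ h $ l) \<in> character_span \<mu>"
    "fourier_coeff \<mu> (\<lambda>\<xi>. F \<xi> $ h $ l) = component \<sigma> f h l"
  using assms by (auto simp: is_transfer_def)

lemma is_transfer_carrier:
  assumes F: "is_transfer F f"
  shows "f \<in> acarrier (L_star \<sigma> \<mu>)" "transfer_matrix \<sigma> \<mu> f = mat_class \<mu> F"
proof -
  have eq: "fourier \<mu> (component \<sigma> f h l) = ae_class \<mu> (\<lambda>\<xi>. F \<xi> $ h $ l)" for h l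
    using fourier_fourier_coeff[OF is_transferD(2)[OF F]] by (simp add: is_transferD(3)[OF F])
  then show "transfer_matrix \<sigma> \<mu> f = mat_class \<mu> F"
    by (simp add: transfer_matrix_def mat_class_def)
  have "summable2 f"
    using summable2_fourier_coeff[OF is_transferD(2)[OF F]]
    by (intro summable2_of_components) (simp add: is_transferD(3)[OF F])
  moreover have "fourier \<mu> (component \<sigma> f h l) \<in> L_infinity \<mu>" for h l
    using is_transferD(1)[OF F] unfolding eq L_infinity_def bounded_matrix_def by blast
  ultimately show "f \<in> acarrier (L_star \<sigma> \<mu>)" by (simp add: L_star_def)
qed

lemma carrier_is_transferE:
  assumes "f \<in> acarrier (L_star \<sigma> \<mu>)"
  obtains F where "is_transfer F f"
proof -
  have f: "summable2 f" "\<And>h l. fourier \<mu> (component \<sigma> f h l) \<in> L_infinity \<mu>"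
    using assms by (simp_all add: L_star_def)
  have "\<exists>g. g \<in> character_span \<mu> \<and> fourier_coeff \<mu> g = component \<sigma> f h l \<and>
      (\<exists>C. AE \<xi> in \<mu>. cmod (g \<xi>) \<le> C)" for h l
    by (rule fourier_in_L_infinityE[OF summable2_component[OF f(1)] f(2)]) blast
  then obtain g where g: "\<And>h l. g h l \<in> character_span \<mu>"
    "\<And>h l. fourier_coeff \<mu> (g h l) = component \<sigma> f h l"
    "\<And>h l. \<exists>C. AE \<xi> in \<mu>. cmod (g h l \<xi>) \<le> C"
    by metis
  have "is_transfer (\<lambda>\<xi>. \<chi> h l. g h l \<xi>) f"
    using g by (simp add: is_transfer_def bounded_matrix_def L2_fun_measurable[OF character_span_L2])
  then show thesis by (rule that)
qed

text \<open>Matrices with the same classes have the same Fourier coefficients, and the coefficients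
  of column 0 are the values of \<open>f\<close>.\<close>

lemma transfer_inj: "inj_on (transfer_matrix \<sigma> \<mu>) (acarrier (L_star \<sigma> \<mu>))"
proof (rule inj_onI)
  fix f g assume fg: "f \<in> acarrier (L_star \<sigma> \<mu>)" "g \<in> acarrier (L_star \<sigma> \<mu>)"
    "transfer_matrix \<sigma> \<mu> f = transfer_matrix \<sigma> \<mu> g"
  obtain F G where F: "is_transfer F f" and G: "is_transfer G g"
    using carrier_is_transferE[OF fg(1)] carrier_is_transferE[OF fg(2)] by metis
  have "mat_class \<mu> F = mat_class \<mu> G"
    using fg(3) is_transfer_carrier(2)[OF F] is_transfer_carrier(2)[OF G] by simp
  then have ae: "AE \<xi> in \<mu>. F \<xi> = G \<xi>"
    by (simp add: mat_class_eq_iff is_transferD(1)[OF F] is_transferD(1)[OF G])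
  have "component \<sigma> f h 0 n = component \<sigma> g h 0 n" for h n
    unfolding is_transferD(3)[OF F, symmetric] is_transferD(3)[OF G, symmetric]
  proof (rule fourier_coeff_cong_AE)
    show "AE \<xi> in \<mu>. F \<xi> $ h $ 0 = G \<xi> $ h $ 0" using ae by eventually_elim simp
  qed (auto intro: bounded_matrix_measurable is_transferD(1)[OF F] is_transferD(1)[OF G])
  then show "f = g" by (auto simp: fun_eq_iff component_eq action_simps)
qed

section \<open>Algebraic operations on transfer matrices\<close>

lemma is_transfer_zero: "is_transfer (\<lambda>\<xi>. 0) (\<lambda>\<gamma>. 0)"
  using trig_poly_in_character_span[of "{}" "\<lambda>_. 0"]
  by (simp add: is_transfer_def trig_poly_def[abs_def] component_def fourier_coeff_def fun_eq_iff)

lemma is_transfer_add: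
  assumes F: "is_transfer F f" and G: "is_transfer G g"
  shows "is_transfer (\<lambda>\<xi>. F \<xi> + G \<xi>) (\<lambda>\<gamma>. f \<gamma> + g \<gamma>)"
proof -
  note FG = is_transferD[OF F] is_transferD[OF G]
  show ?thesis
    unfolding is_transfer_def
  proof (intro conjI allI)
    show "bounded_matrix \<mu> (\<lambda>\<xi>. F \<xi> + G \<xi>)" by (intro bounded_matrix_add FG)
    fix h l
    show "(\<lambda>\<xi>. (F \<xi> + G \<xi>) $ h $ l) \<in> character_span \<mu>"
      using character_span_add[OF FG(2,5), of h l h l] by simp
    show "fourier_coeff \<mu> (\<lambda>\<xi>. (F \<xi> + G \<xi>) $ h $ l) = component \<sigma> (\<lambda>\<gamma>. f \<gamma> + g \<gamma>) h l"
      by (simp add: fun_eq_iff fourier_coeff_add character_span_L2 FG)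
        (simp add: component_def)
  qed
qed

lemma is_transfer_scale:
  assumes F: "is_transfer F f"
  shows "is_transfer (\<lambda>\<xi>. \<chi> h l. c * F \<xi> $ h $ l) (\<lambda>\<gamma>. c * f \<gamma>)"
proof -
  note F' = is_transferD[OF F]
  show ?thesis
    unfolding is_transfer_def
  proof (intro conjI allI)
    show "bounded_matrix \<mu> (\<lambda>\<xi>. \<chi> h l. c * F \<xi> $ h $ l)" by (intro bounded_matrix_scale F')
    fix h l
    show "(\<lambda>\<xi>. (\<chi> h l. c * F \<xi> $ h $ l) $ h $ l) \<in> character_span \<mu>"
      using character_span_scale[OF F'(2)] by simp
    show "fourier_coeff \<mu> (\<lambda>\<xi>. (\<chi> h l. c * F \<xi> $ h $ l) $ h $ l) = component \<sigma> (\<lambda>\<gamma>. c * f \<gamma>) h l"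
      by (simp add: fun_eq_iff fourier_coeff_scale F'(3)) (simp add: component_def)
  qed
qed

lemma is_transfer_star:
  assumes F: "is_transfer F f"
  shows "is_transfer (\<lambda>\<xi>. adjoint_matrix (F \<xi>)) (group_star \<sigma> f)"
proof -
  note F' = is_transferD[OF F]
  \<comment> \<open>The inverse of \<open>(0, l)\<close> inverse times \<open>(n, h)\<close> is
    \<open>(0, h)\<close> inverse times \<open>(- n, l)\<close>: the indices are swapped and
    \<open>n\<close> is negated, just as conjugating a function reflects its coefficients.\<close>
  have comp: "component \<sigma> (group_star \<sigma> f) h l n = cnj (component \<sigma> f l h (- n))" for h l n
    by (simp add: component_eq group_star_def sd_inv_def minus_add action_simps action_inverse)
  show ?thesis
    unfolding is_transfer_def
  proof (intro conjI allI)
    show "bounded_matrix \<mu> (\<lambda>\<xi>. adjoint_matrix (F \<xi>))" by (intro bounded_matrix_adjoint F')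
    fix h l
    show "(\<lambda>\<xi>. adjoint_matrix (F \<xi>) $ h $ l) \<in> character_span \<mu>"
      using character_span_cnj[OF F'(2)] by (simp add: adjoint_matrix_def)
    show "fourier_coeff \<mu> (\<lambda>\<xi>. adjoint_matrix (F \<xi>) $ h $ l) = component \<sigma> (group_star \<sigma> f) h l"
      by (simp add: fun_eq_iff adjoint_matrix_def fourier_coeff_cnj F'(3) comp)
  qed
qed

text \<open>Substituting \<open>\<eta> = (0, l)\<^sup>-\<^sup>1(m, k)\<close> in the convolution at \<open>(0, l)\<^sup>-\<^sup>1(n, h)\<close> turns it into
  convolutions over N of the components.\<close>

lemma component_convolution:
  "component \<sigma> (convolution \<sigma> g f) h l n =
    (\<Sum>\<^sub>\<infinity>(m, k). component \<sigma> g k l m * component \<sigma> f h k (n - m))"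
proof -
  define \<gamma> where "\<gamma> = (\<sigma> (- l) n, - l + h)"
  define s where "s = (\<lambda>(m, k). (\<sigma> (- l) m, - l + k))"
  have bij: "bij s"
  proof (rule o_bij)
    show "(\<lambda>(m, k). (\<sigma> l m, l + k)) \<circ> s = id" "s \<circ> (\<lambda>(m, k). (\<sigma> l m, l + k)) = id"
      by (auto simp: s_def fun_eq_iff action_inverse add.assoc[symmetric])
  qed
  have term_eq: "g (s (m, k)) * f (sd_mult \<sigma> (sd_inv \<sigma> (s (m, k))) \<gamma>) =
      component \<sigma> g k l m * component \<sigma> f h k (n - m)" for m k
  proof -
    have 1: "- (- l + k) = - k + l" by (simp add: minus_add)
    have 2: "\<sigma> (- k + l) (\<sigma> (- l) x) = \<sigma> (- k) x" for x
      by (simp add: action_simps(2) action_inverse)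
    have 3: "- k + l + (- l + h) = - k + h" by (simp add: add.assoc)
    have "sd_mult \<sigma> (sd_inv \<sigma> (s (m, k))) \<gamma> = (\<sigma> (- k) (n - m), - k + h)"
      by (simp only: sd_mult_def sd_inv_def s_def \<gamma>_def prod.case fst_conv snd_conv 1 3
          action_simps(5) 2) (simp add: action_simps(1,5) diff_conv_add_uminus add.commute
          del: add_uminus_conv_diff)
    then show ?thesis by (simp add: component_eq s_def)
  qed
  have "component \<sigma> (convolution \<sigma> g f) h l n =
      (\<Sum>\<^sub>\<infinity>\<eta>. g \<eta> * f (sd_mult \<sigma> (sd_inv \<sigma> \<eta>) \<gamma>))"
    by (simp add: component_eq convolution_def \<gamma>_def)
  also have "\<dots> = (\<Sum>\<^sub>\<infinity>\<eta>. g (s \<eta>) * f (sd_mult \<sigma> (sd_inv \<sigma> (s \<eta>)) \<gamma>))"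
    by (rule infsum_reindex_bij_betw[OF bij, symmetric])
  also have "\<dots> = (\<Sum>\<^sub>\<infinity>(m, k). component \<sigma> g k l m * component \<sigma> f h k (n - m))"
    by (intro infsum_cong) (auto simp: term_eq)
  finally show ?thesis .
qed

text \<open>For fixed \<open>k\<close> the sum over \<open>m\<close> in
  \<open>component_convolution\<close> is a coefficient of the scalar product of
  \<open>G \<xi> $ k $ l\<close> and \<open>F \<xi> $ h $ k\<close>. Summing over \<open>k\<close>
  gives the matrix product with \<open>F\<close> on the left, and this is where the order is
  reversed.\<close>

lemma is_transfer_convolution:
  assumes F: "is_transfer F f" and G: "is_transfer G g"
  shows "is_transfer (\<lambda>\<xi>. F \<xi> ** G \<xi>) (convolution \<sigma> g f)"
proof -
  note FG = is_transferD[OF F] is_transferD[OF G]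
  have span: "(\<lambda>\<xi>. G \<xi> $ k $ l * F \<xi> $ h $ k) \<in> character_span \<mu>" for h k l
  proof -
    obtain C where "AE \<xi> in \<mu>. cmod (F \<xi> $ h $ k) \<le> C"
      using FG(1) unfolding bounded_matrix_def by blast
    then show ?thesis by (rule character_span_mult[OF FG(5,2)])
  qed
  have eq: "(F \<xi> ** G \<xi>) $ h $ l = (\<Sum>k\<in>UNIV. G \<xi> $ k $ l * F \<xi> $ h $ k)" for \<xi> h l
    by (simp add: matrix_matrix_mult_def mult.commute)
  show ?thesis
    unfolding is_transfer_def
  proof (intro conjI allI)
    show "bounded_matrix \<mu> (\<lambda>\<xi>. F \<xi> ** G \<xi>)" by (intro bounded_matrix_mult FG)
    fix h l
    show "(\<lambda>\<xi>. (F \<xi> ** G \<xi>) $ h $ l) \<in> character_span \<mu>"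
      unfolding eq by (intro character_span_sum span) simp
    show "fourier_coeff \<mu> (\<lambda>\<xi>. (F \<xi> ** G \<xi>) $ h $ l) = component \<sigma> (convolution \<sigma> g f) h l"
    proof
      fix n
      have "((\<lambda>m. component \<sigma> g k l m * component \<sigma> f h k (n - m)) has_sum
          fourier_coeff \<mu> (\<lambda>\<xi>. G \<xi> $ k $ l * F \<xi> $ h $ k) n) UNIV" for k
        using fourier_coeff_mult[OF FG(5) character_span_L2[OF FG(2)]] unfolding FG(3,6) .
      then have "((\<lambda>(m, k). component \<sigma> g k l m * component \<sigma> f h k (n - m)) has_sum
          (\<Sum>k\<in>UNIV. fourier_coeff \<mu> (\<lambda>\<xi>. G \<xi> $ k $ l * F \<xi> $ h $ k) n)) UNIV"
        by (intro has_sum_prod_finite) simp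
      then show "fourier_coeff \<mu> (\<lambda>\<xi>. (F \<xi> ** G \<xi>) $ h $ l) n = component \<sigma> (convolution \<sigma> g f) h l n"
        unfolding eq component_convolution
        by (subst fourier_coeff_sum) (auto simp: character_span_L2[OF span] infsumI)
    qed
  qed
qed

text \<open>A matrix with entries in the span is a transfer matrix only if its columns are tied
  together as in \<open>component_eq\<close>. Those ties equate coefficients of different entries,
  and they pass to the limit because each coefficient is bounded by the operator norm.\<close>

lemma transfer_image_closed:
  assumes X: "\<And>k. X k \<in> acarrier (L_star \<sigma> \<mu>)" and y: "y \<in> acarrier (matrix_algebra \<mu>)"
    and lim: "(\<lambda>k. adist (matrix_algebra \<mu>) (transfer_matrix \<sigma> \<mu> (X k)) y) \<longlonglongrightarrow> 0"
  shows "y \<in> transfer_matrix \<sigma> \<mu> ` acarrier (L_star \<sigma> \<mu>)"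
proof -
  have "\<forall>k. \<exists>F. is_transfer F (X k)" using carrier_is_transferE[OF X] by metis
  then obtain F where F: "\<And>k. is_transfer (F k) (X k)" by metis
  obtain G where G: "bounded_matrix \<mu> G" "y = mat_class \<mu> G"
    using matrix_algebra_carrierE[OF y] .
  define d where "d k = operator_norm \<mu> (\<lambda>\<xi>. F k \<xi> - G \<xi>)" for k
  have FG: "bounded_matrix \<mu> (\<lambda>\<xi>. F k \<xi> - G \<xi>)" for k
    by (intro bounded_matrix_diff is_transferD(1)[OF F] G)
  have d: "d \<longlonglongrightarrow> 0"
    using lim by (simp add: is_transfer_carrier(2)[OF F] G(2) d_def[abs_def]
        adist_mat_class[OF is_transferD(1)[OF F] G(1)])
  have G2: "L2_fun \<mu> (\<lambda>\<xi>. G \<xi> $ h $ l)" for h l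
  proof -
    obtain C where C: "AE \<xi> in \<mu>. cmod (G \<xi> $ h $ l) \<le> C"
      using G(1) unfolding bounded_matrix_def by blast
    have "AE \<xi> in \<mu>. cmod (G \<xi> $ h $ l) \<le> \<bar>C\<bar>" using C by eventually_elim simp
    then show ?thesis
      by (rule L2_fun_bounded(1)[OF bounded_matrix_measurable[OF G(1)]]) simp
  qed
  have F2: "L2_fun \<mu> (\<lambda>\<xi>. F k \<xi> $ h $ l)" for k h l
    by (rule character_span_L2[OF is_transferD(2)[OF F]])
  \<comment> \<open>Total mass 1 turns the essential bound on an entry into a bound on its square
    norm.\<close>
  have near: "L2n \<mu> (\<lambda>\<xi>. F k \<xi> $ h $ l - G \<xi> $ h $ l) \<le> d k" for k h l
  proof (rule L2_fun_bounded(2))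
    show "(\<lambda>\<xi>. F k \<xi> $ h $ l - G \<xi> $ h $ l) \<in> borel_measurable \<mu>"
      by (rule L2_fun_measurable[OF L2_fun_diff[OF F2 G2]])
    show "AE \<xi> in \<mu>. cmod (F k \<xi> $ h $ l - G \<xi> $ h $ l) \<le> d k"
      using entry_le_operator_norm[OF FG[of k]] unfolding d_def by eventually_elim simp
    show "0 \<le> d k" unfolding d_def by (rule operator_norm_nonneg[OF FG])
  qed
  have span: "(\<lambda>\<xi>. G \<xi> $ h $ l) \<in> character_span \<mu>" for h l
  proof (rule character_span_closed[OF G2])
    fix e :: real assume "0 < e"
    then have "\<forall>\<^sub>F k in sequentially. d k < e" using d by (rule order_tendstoD(2)[rotated])
    then obtain k where "d k < e" by (auto simp: eventually_sequentially)
    then have "L2n \<mu> (\<lambda>\<xi>. G \<xi> $ h $ l - F k \<xi> $ h $ l) < e"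
      using near[of k h l] by (simp add: L2n_minus_commute)
    then show "\<exists>u\<in>character_span \<mu>. L2n \<mu> (\<lambda>\<xi>. G \<xi> $ h $ l - u \<xi>) < e"
      by (rule bexI[where x = "\<lambda>\<xi>. F k \<xi> $ h $ l"]) (rule is_transferD(2)[OF F])
  qed
  have coeff_lim: "(\<lambda>k. component \<sigma> (X k) h l n) \<longlonglongrightarrow> fourier_coeff \<mu> (\<lambda>\<xi>. G \<xi> $ h $ l) n" for h l n
  proof -
    have "(\<lambda>k. component \<sigma> (X k) h l n - fourier_coeff \<mu> (\<lambda>\<xi>. G \<xi> $ h $ l) n) \<longlonglongrightarrow> 0"
    proof (rule Lim_null_comparison[OF always_eventually d], rule allI)
      fix k
      have "component \<sigma> (X k) h l n - fourier_coeff \<mu> (\<lambda>\<xi>. G \<xi> $ h $ l) n =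
          fourier_coeff \<mu> (\<lambda>\<xi>. F k \<xi> $ h $ l - G \<xi> $ h $ l) n"
        by (simp add: fourier_coeff_diff[OF F2 G2] is_transferD(3)[OF F])
      also have "cmod \<dots> \<le> d k"
        using fourier_coeff_bound[OF L2_fun_diff[OF F2 G2]] near by (rule order_trans)
      finally show "norm (component \<sigma> (X k) h l n - fourier_coeff \<mu> (\<lambda>\<xi>. G \<xi> $ h $ l) n) \<le> d k" .
    qed
    then show ?thesis by (rule LIM_zero_cancel)
  qed
  \<comment> \<open>The only candidate, since column 0 of the components of a function consists of
    its own values.\<close>
  define f where "f = (\<lambda>(n, h). fourier_coeff \<mu> (\<lambda>\<xi>. G \<xi> $ h $ 0) n)"
  have "fourier_coeff \<mu> (\<lambda>\<xi>. G \<xi> $ h $ l) n = component \<sigma> f h l n" for h l n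
  proof -
    \<comment> \<open>The same number seen in column 0 and in column \<open>l\<close>; taking limits
      on both sides carries the tie between columns over to \<open>G\<close>.\<close>
    have "component \<sigma> (X k) (- l + h) 0 (\<sigma> (- l) n) = component \<sigma> (X k) h l n" for k
      by (simp add: component_eq action_simps)
    then have "(\<lambda>k. component \<sigma> (X k) h l n) \<longlonglongrightarrow> component \<sigma> f h l n"
      using coeff_lim[of "- l + h" 0 "\<sigma> (- l) n"] by (simp add: f_def component_eq[of "\<lambda>(n, h). u n h" for u])
    then show ?thesis using coeff_lim LIMSEQ_unique by blast
  qed
  then have "is_transfer G f"
    using G(1) span by (simp add: is_transfer_def fun_eq_iff)
  then show ?thesis
    using is_transfer_carrier[of G f] G(2) by (intro image_eqI[where x = f]) simp_all
qed

text \<open>Every element of the carrier has a matrix function with \<open>is_transfer\<close>, so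
  each condition reduces to the corresponding operation on such functions.\<close>

sublocale reversing_embedding "matrix_algebra \<mu>" "L_star \<sigma> \<mu>" "transfer_matrix \<sigma> \<mu>"
proof (intro reversing_embedding.intro reversing_embedding_axioms.intro
    cstar_algebra_matrix_algebra transfer_inj transfer_image_closed)
  have ops: "azero (L_star \<sigma> \<mu>) = (\<lambda>\<gamma>. 0)" "aadd (L_star \<sigma> \<mu>) f g = (\<lambda>\<gamma>. f \<gamma> + g \<gamma>)"
    "ascale (L_star \<sigma> \<mu>) c f = (\<lambda>\<gamma>. c * f \<gamma>)" "amult (L_star \<sigma> \<mu>) f g = convolution \<sigma> f g"
    "astar (L_star \<sigma> \<mu>) f = group_star \<sigma> f" for f g c
    by (simp_all add: L_star_def)
  note T = is_transfer_carrier
  show "azero (L_star \<sigma> \<mu>) \<in> acarrier (L_star \<sigma> \<mu>)"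
    "transfer_matrix \<sigma> \<mu> (azero (L_star \<sigma> \<mu>)) = azero (matrix_algebra \<mu>)"
    unfolding ops using T[OF is_transfer_zero] by (simp_all add: matrix_algebra_zero)
  fix f assume f: "f \<in> acarrier (L_star \<sigma> \<mu>)"
  obtain F where F: "is_transfer F f" using carrier_is_transferE[OF f] .
  note F' = is_transferD(1)[OF F]
  show "transfer_matrix \<sigma> \<mu> f \<in> acarrier (matrix_algebra \<mu>)"
    by (simp add: T(2)[OF F] mat_class_in_carrier F')
  show "ascale (L_star \<sigma> \<mu>) c f \<in> acarrier (L_star \<sigma> \<mu>)"
    "transfer_matrix \<sigma> \<mu> (ascale (L_star \<sigma> \<mu>) c f) =
      ascale (matrix_algebra \<mu>) c (transfer_matrix \<sigma> \<mu> f)" for c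
    unfolding ops using T[OF is_transfer_scale[OF F, of c]]
    by (simp_all add: T(2)[OF F] mat_class_scale F')
  show "astar (L_star \<sigma> \<mu>) f \<in> acarrier (L_star \<sigma> \<mu>)"
    "transfer_matrix \<sigma> \<mu> (astar (L_star \<sigma> \<mu>) f) = astar (matrix_algebra \<mu>) (transfer_matrix \<sigma> \<mu> f)"
    unfolding ops using T[OF is_transfer_star[OF F]]
    by (simp_all add: T(2)[OF F] mat_class_star F')
  show "anorm (L_star \<sigma> \<mu>) f = anorm (matrix_algebra \<mu>) (transfer_matrix \<sigma> \<mu> f)"
    by (simp add: L_star_def matrix_algebra_def)
  fix g assume g: "g \<in> acarrier (L_star \<sigma> \<mu>)"
  obtain G where G: "is_transfer G g" using carrier_is_transferE[OF g] .
  note G' = is_transferD(1)[OF G]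
  show "aadd (L_star \<sigma> \<mu>) f g \<in> acarrier (L_star \<sigma> \<mu>)"
    "transfer_matrix \<sigma> \<mu> (aadd (L_star \<sigma> \<mu>) f g) =
      aadd (matrix_algebra \<mu>) (transfer_matrix \<sigma> \<mu> f) (transfer_matrix \<sigma> \<mu> g)"
    unfolding ops using T[OF is_transfer_add[OF F G]]
    by (simp_all add: T(2)[OF F] T(2)[OF G] mat_class_add F' G')
  show "amult (L_star \<sigma> \<mu>) f g \<in> acarrier (L_star \<sigma> \<mu>)"
    "transfer_matrix \<sigma> \<mu> (amult (L_star \<sigma> \<mu>) f g) =
      amult (matrix_algebra \<mu>) (transfer_matrix \<sigma> \<mu> g) (transfer_matrix \<sigma> \<mu> f)"
    unfolding ops using T[OF is_transfer_convolution[OF G F]]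
    by (simp_all add: T(2)[OF F] T(2)[OF G] mat_class_mult F' G')
qed

end

theorem theorem12:
  fixes \<sigma> :: "'h::{group_add,finite} \<Rightarrow> 'n::ab_group_add \<Rightarrow> 'n"
    and \<mu> :: "('n \<Rightarrow> complex) measure"
  assumes "automorphism_action \<sigma>"
    and "normalized_haar \<mu>"
  shows "cstar_algebra (L_star \<sigma> \<mu>) \<and>
    (\<exists>B. cstar_subalgebra B (matrix_algebra \<mu>) \<and>
       reversing_cstar_isomorphism (L_star \<sigma> \<mu>) ((matrix_algebra \<mu>)\<lparr>acarrier := B\<rparr>)
         (transfer_matrix \<sigma> \<mu>))"
proof -
  interpret transfer_setting \<mu> \<sigma>
    using assms by unfold_locales
  \<comment> \<open>The witness for \<open>B\<close> is the range of the transfer matrix on the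
    carrier of \<open>L_star \<sigma> \<mu>\<close>.\<close>
  show ?thesis
    using cstar_algebra_source cstar_subalgebra_image reversing_cstar_isomorphism_image by blast
qed

end
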